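(* Let $k\ge1$ and $\diamond\in\{\prec,\succ,\prec',\succ'\}^k$, and let $T_\diamond(q)$ be the generating function of admissible matchings of $G_\diamond$ that can be obtained from the minimal matching $\mathfrak{m}_\diamond$ by a finite sequence of flips, where the exponent of $q$ is the length of a shortest such sequence. Then $$T_\diamond(q)=\prod_{\substack{i<j\\ \diamond_i\in\{\prec,\prec'\}\\ \diamond_j\in\{\succ,\succ'\}}}\left(1+\epsilon_{i,j}q^{j-i}\right)^{\epsilon_{i,j}},$$ where $\epsilon_{i,j}=1$ if $(\diamond_i,\diamond_j)\in\{(\prec,\succ'),(\prec',\succ)\}$ and $\epsilon_{i,j}=-1$ if $(\diamond_i,\diamond_j)\in\{(\prec,\succ),(\prec',\succ')\}$.
   Context: The graph $G_\diamond$: vertex set $V=\bigcup_{j=0}^kV_j\cup\bigcup_{j=1}^kW_j$, $V_j=\{(\frac32j,y):y\in\mathbb{Z}+\frac{j+1}{2}\}$, $W_j=\{(\frac32j-1,y):y\in\mathbb{Z}+\frac{j+1}{2}\}$ if $\diamond_j\in\{\prec,\succ\}$ and $W_j=\{(\frac32j-\frac12,y):y\in\mathbb{Z}+\frac j2\}$ if $\diamond_j\in\{\prec',\succ'\}$; edges join vertices differing by $(1,0)$, $(\frac12,\frac12)$ or $(\frac12,-\frac12)$ (straight-line plane embedding). $Y_0=0$, $Y_j=Y_{j-1}+\frac12$ if $\diamond_j\in\{\prec,\succ'\}$, $Y_j=Y_{j-1}-\frac12$ if $\diamond_j\in\{\prec',\succ\}$. Matchings (sets of disjoint edges) considered cover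 all of $V\setminus(V_0\cup V_k)$; a vertex is matched to the left (right) if it is matched to a vertex with smaller (larger) abscissa, or is uncovered and lies in $V_0$ (resp. $V_k$). Admissible: for each $j$, the number of vertices of $V_j$ above ordinate $Y_j$ matched to the left is finite and equals the number of vertices of $V_j$ below $Y_j$ matched to the right. The minimal matching $\mathfrak{m}_\diamond$ is the admissible matching in which, for every $j$, the vertices of $V_j$ matched to the left are exactly those with ordinate $<Y_j$. Flip: if a bounded face bordered by $2p$ edges has $p$ of them in the matching, replace them by the other $p$ edges of the face.
   Formalization: Edges are required to join a vertex of some V_i to one of some W_j. Read literally, W_j and W_{j+1} would also be joined by (1,0) when ◇_j is primed and ◇_{j+1} is not, and the claim fails: for k=2, (≺',≻) all bounded faces are triangles, so T=1, not 1+q. *)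

theory Defs
  imports "HOL-Analysis.Analysis" "HOL-Computational_Algebra.Formal_Power_Series"
begin

datatype diamond = Prec | Succ | Prec' | Succ'

type_synonym point = "real \<times> real"

(* A sequence in {Prec, Succ, Prec', Succ'}^k is given by d :: nat => diamond, of which only
   the values d 1, ..., d k are used. *)

definition Vcol :: "nat \<Rightarrow> point set" where
  "Vcol j = {(3/2 * real j, of_int n + (real j + 1) / 2) | n :: int. True}"

definition Wcol :: "(nat \<Rightarrow> diamond) \<Rightarrow> nat \<Rightarrow> point set" where
  "Wcol d j =
     (if d j \<in> {Prec, Succ}
      then {(3/2 * real j - 1, of_int n + (real j + 1) / 2) | n :: int. True}
      else {(3/2 * real j - 1/2, of_int n + real j / 2) | n :: int. True})"

definition Vverts :: "nat \<Rightarrow> point set" where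
  "Vverts k = (\<Union>j\<in>{0..k}. Vcol j)"

definition Wverts :: "nat \<Rightarrow> (nat \<Rightarrow> diamond) \<Rightarrow> point set" where
  "Wverts k d = (\<Union>j\<in>{1..k}. Wcol d j)"

definition verts :: "nat \<Rightarrow> (nat \<Rightarrow> diamond) \<Rightarrow> point set" where
  "verts k d = Vverts k \<union> Wverts k d"

(* Edges are two-element sets of points. The graph is bipartite between the V- and the
   W-vertices. This has to be required: if d j is primed and d (j+1) is not, then Wcol d j and
   Wcol d (j+1) contain points differing by (1,0), but these are the two opposite corners of a
   square face around column j, and not adjacent. In all other cases the displacement
   condition alone already implies that an edge joins a V-vertex and a W-vertex. *)
definition edges :: "nat \<Rightarrow> (nat \<Rightarrow> diamond) \<Rightarrow> point set set" where
  "edges k d = {{u, v} | u v.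
     (u \<in> Vverts k \<and> v \<in> Wverts k d \<or> u \<in> Wverts k d \<and> v \<in> Vverts k) \<and>
     v - u \<in> {(1, 0), (1/2, 1/2), (1/2, - 1/2)}}"

fun Yord :: "(nat \<Rightarrow> diamond) \<Rightarrow> nat \<Rightarrow> real" where
  "Yord d 0 = 0"
| "Yord d (Suc j) = (if d (Suc j) \<in> {Prec, Succ'} then Yord d j + 1/2 else Yord d j - 1/2)"

definition matching :: "nat \<Rightarrow> (nat \<Rightarrow> diamond) \<Rightarrow> point set set \<Rightarrow> bool" where
  "matching k d M \<longleftrightarrow>
     M \<subseteq> edges k d \<and> pairwise disjnt M \<and> verts k d - (Vcol 0 \<union> Vcol k) \<subseteq> \<Union>M"

definition matched_left :: "point set set \<Rightarrow> point \<Rightarrow> bool" where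
  "matched_left M v \<longleftrightarrow> (\<exists>u. {u, v} \<in> M \<and> fst u < fst v) \<or> (v \<notin> \<Union>M \<and> v \<in> Vcol 0)"

definition matched_right :: "nat \<Rightarrow> point set set \<Rightarrow> point \<Rightarrow> bool" where
  "matched_right k M v \<longleftrightarrow> (\<exists>u. {u, v} \<in> M \<and> fst u > fst v) \<or> (v \<notin> \<Union>M \<and> v \<in> Vcol k)"

definition left_above :: "(nat \<Rightarrow> diamond) \<Rightarrow> point set set \<Rightarrow> nat \<Rightarrow> point set" where
  "left_above d M j = {v \<in> Vcol j. snd v > Yord d j \<and> matched_left M v}"

definition right_below :: "nat \<Rightarrow> (nat \<Rightarrow> diamond) \<Rightarrow> point set set \<Rightarrow> nat \<Rightarrow> point set" where
  "right_below k d M j = {v \<in> Vcol j. snd v < Yord d j \<and> matched_right k M v}"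

definition admissible :: "nat \<Rightarrow> (nat \<Rightarrow> diamond) \<Rightarrow> point set set \<Rightarrow> bool" where
  "admissible k d M \<longleftrightarrow> matching k d M \<and>
     (\<forall>j\<in>{0..k}. finite (left_above d M j) \<and> finite (right_below k d M j) \<and>
        card (left_above d M j) = card (right_below k d M j))"

definition minimal_matching :: "nat \<Rightarrow> (nat \<Rightarrow> diamond) \<Rightarrow> point set set" where
  "minimal_matching k d = (THE M. admissible k d M \<and>
     (\<forall>j\<in>{0..k}. \<forall>v\<in>Vcol j. matched_left M v \<longleftrightarrow> snd v < Yord d j))"

(* For an edge e = {u, v}, the convex hull of e is the closed segment joining u and v. *)
definition bounded_faces :: "nat \<Rightarrow> (nat \<Rightarrow> diamond) \<Rightarrow> point set set" where
  "bounded_faces k d = {F \<in> components (- (\<Union>e\<in>edges k d. convex hull e)). bounded F}"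

definition border :: "nat \<Rightarrow> (nat \<Rightarrow> diamond) \<Rightarrow> point set \<Rightarrow> point set set" where
  "border k d F = {e \<in> edges k d. convex hull e \<subseteq> frontier F}"

definition flip :: "nat \<Rightarrow> (nat \<Rightarrow> diamond) \<Rightarrow> point set set \<Rightarrow> point set set \<Rightarrow> bool" where
  "flip k d M M' \<longleftrightarrow> (\<exists>F\<in>bounded_faces k d. \<exists>p.
     finite (border k d F) \<and> card (border k d F) = 2 * p \<and> card (border k d F \<inter> M) = p \<and>
     M' = (M - border k d F) \<union> (border k d F - M))"

definition flip_dist :: "nat \<Rightarrow> (nat \<Rightarrow> diamond) \<Rightarrow> point set set \<Rightarrow> nat" where
  "flip_dist k d M = (LEAST n. (flip k d ^^ n) (minimal_matching k d) M)"

definition reachable :: "nat \<Rightarrow> (nat \<Rightarrow> diamond) \<Rightarrow> point set set set" where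
  "reachable k d = {M. admissible k d M \<and> rtranclp (flip k d) (minimal_matching k d) M}"

definition T_gf :: "nat \<Rightarrow> (nat \<Rightarrow> diamond) \<Rightarrow> rat fps" where
  "T_gf k d = Abs_fps (\<lambda>n. of_nat (card {M \<in> reachable k d. flip_dist k d M = n}))"

(* Only used for a in {Prec, Prec'} and b in {Succ, Succ'}. *)
definition eps :: "diamond \<Rightarrow> diamond \<Rightarrow> int" where
  "eps a b = (if (a, b) \<in> {(Prec, Succ'), (Prec', Succ)} then 1 else - 1)"

end

theory Submission
  imports Defs
begin

text \<open>A matching is encoded by a height function on the faces: every edge is a difference of the
  heights of the two adjacent faces, and a flip changes the height of one bounded face by one.
  Relative to the minimal matching the heights are nonnegative, and any nonzero height function
  can be decremented somewhere, so the flip distance is the sum of the heights.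
  In column \<open>j\<close> the heights are the lengths of the diagonals of a Young diagram, and the edges
  between consecutive columns say that consecutive diagrams differ by a horizontal or vertical
  strip (depending on whether the step is primed), added or removed. Such sequences of
  diagrams are counted by moving every removal to the left of all additions, as for commuting
  vertex operators: each exchange of an addition with a later adjacent removal contributes one
  factor of the product, and in the end only the constant sequence of empty diagrams is left.\<close>

section \<open>The graph\<close>

text \<open>The faces are defined as components of the complement of a plane drawing, so they have
  to be found analytically. Each strip contains one zigzag, the graph of a function of the ordinate;
  these functions are ordered from left to right, and this order separates the faces and shows that
  nothing else is bounded. A flip only asks that half of the border edges be matched. It is a height
  change because consecutive border edges are never both matched, so half of the cycle means every
  other edge. The exponent \<open>j - i\<close> arises because each step keeps its original index as
  a label while it moves. Addition \<open>i\<close> passes a later removal \<open>j\<close> exactly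
  once, and at that moment the diagram between them has weight \<open>j - i\<close>. After the
  exchange that weight is negative, so nonnegativity and finiteness of the weighted count cannot be
  read off the weight; they are carried back through the exchanges from the constant sequence.
  Exchanging two strips of the same kind leaves a free natural number, hence a geometric series;
  strips of different kinds leave one bit, hence a factor with two terms.\<close>

definition primed :: "(nat \<Rightarrow> diamond) \<Rightarrow> nat \<Rightarrow> bool" where
  "primed d j \<longleftrightarrow> d j \<in> {Prec', Succ'}"

lemma primed_iff: "primed d j \<longleftrightarrow> d j = Prec' \<or> d j = Succ'"
  by (simp add: primed_def)

lemma not_primed_iff: "\<not> primed d j \<longleftrightarrow> d j = Prec \<or> d j = Succ"
  by (cases "d j") (auto simp: primed_def)

definition Vp :: "nat \<Rightarrow> int \<Rightarrow> point" where
  "Vp j n = (3/2 * real j, of_int n + (real j + 1) / 2)"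

definition Wp :: "(nat \<Rightarrow> diamond) \<Rightarrow> nat \<Rightarrow> int \<Rightarrow> point" where
  "Wp d j n = (if primed d j then (3/2 * real j - 1/2, of_int n + real j / 2)
               else (3/2 * real j - 1, of_int n + (real j + 1) / 2))"

lemma Vcol_eq: "Vcol j = range (Vp j)"
  by (auto simp: Vcol_def Vp_def)

lemma Wcol_eq: "Wcol d j = range (Wp d j)"
  using not_primed_iff[of d j] by (auto simp: Wcol_def Wp_def primed_iff)

lemma Vp_eq_iff [simp]: "Vp i m = Vp j n \<longleftrightarrow> i = j \<and> m = n"
  by (auto simp: Vp_def)

text \<open>Twice the abscissa is an integer whose residue mod 3 is 2 for primed and 1 for unprimed
  \<open>j\<close>, so it fixes \<open>j\<close>. The \<open>V\<close>-vertices have residue 0,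
  which keeps the two families apart.\<close>

lemma Wp_eq_iff [simp]: "Wp d i m = Wp d j n \<longleftrightarrow> i = j \<and> m = n"
proof
  assume h: "Wp d i m = Wp d j n"
  have "i = j"
  proof -
    consider "3/2 * real i = 3/2 * real j" | "3/2 * real i - 1/2 = 3/2 * real j - 1"
      | "3/2 * real i - 1 = 3/2 * real j - 1/2"
      using h by (auto simp: Wp_def split: if_splits)
    then show ?thesis
    proof cases
      case 2
      then have "real (3 * i + 1) = real (3 * j)" by simp
      then have "3 * i + 1 = 3 * j" using of_nat_eq_iff by blast
      then show ?thesis by presburger
    next
      case 3
      then have "real (3 * i) = real (3 * j + 1)" by simp
      then have "3 * i = 3 * j + 1" using of_nat_eq_iff by blast
      then show ?thesis by presburger
    qed auto
  qed
  then show "i = j \<and> m = n" using h by (auto simp: Wp_def split: if_splits)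
qed auto

lemma Vp_neq_Wp [simp]: "Vp i m \<noteq> Wp d j n" "Wp d j n \<noteq> Vp i m"
proof -
  have "Vp i m \<noteq> Wp d j n"
  proof
    assume h: "Vp i m = Wp d j n"
    consider "3/2 * real i = 3/2 * real j - 1/2" | "3/2 * real i = 3/2 * real j - 1"
      using h by (auto simp: Vp_def Wp_def split: if_splits)
    then show False
    proof cases
      case 1
      then have "real (3 * i + 1) = real (3 * j)" by simp
      then have "3 * i + 1 = 3 * j" using of_nat_eq_iff by blast
      then show ?thesis by presburger
    next
      case 2
      then have "real (3 * i + 2) = real (3 * j)" by simp
      then have "3 * i + 2 = 3 * j" using of_nat_eq_iff by blast
      then show ?thesis by presburger
    qed
  qed
  then show "Vp i m \<noteq> Wp d j n" "Wp d j n \<noteq> Vp i m" by auto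
qed

text \<open>Between columns \<open>j - 1\<close> and \<open>j\<close> the diagonal edges form a zigzag through the points
  \<open>Lp d j n\<close> and \<open>Rp d j n\<close>; one of the two families consists of the \<open>W\<close>-vertices, and
  horizontal edges join these to the other column.\<close>

definition Lp :: "(nat \<Rightarrow> diamond) \<Rightarrow> nat \<Rightarrow> int \<Rightarrow> point" where
  "Lp d j n = (if primed d j then Wp d j n else Vp (j - 1) n)"

definition Rp :: "(nat \<Rightarrow> diamond) \<Rightarrow> nat \<Rightarrow> int \<Rightarrow> point" where
  "Rp d j n = (if primed d j then Vp j n else Wp d j n)"

text \<open>Seen from a left zigzag point, \<open>Up\<close> leads to the right point half a unit
  higher and \<open>Dn\<close> to the one half a unit lower. Every \<open>W\<close>-vertex has
  degree three: two zigzag edges and one \<open>Hz\<close>.\<close>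

datatype ekind = Up | Dn | Hz

fun gedge :: "(nat \<Rightarrow> diamond) \<Rightarrow> ekind \<times> nat \<times> int \<Rightarrow> point set" where
  "gedge d (Up, j, n) = {Lp d j n, Rp d j n}"
| "gedge d (Dn, j, n) = {Lp d j n, Rp d j (n - 1)}"
| "gedge d (Hz, j, n) = (if primed d j then {Vp (j - 1) n, Wp d j n} else {Wp d j n, Vp j n})"

definition Idx :: "nat \<Rightarrow> (ekind \<times> nat \<times> int) set" where
  "Idx k = {(t, j, n). 1 \<le> j \<and> j \<le> k}"

text \<open>The abscissa of the left zigzag points of strip \<open>j\<close>; the right ones lie at
  distance 1/2.\<close>

definition zc :: "(nat \<Rightarrow> diamond) \<Rightarrow> nat \<Rightarrow> real" where
  "zc d j = 3/2 * real j - (if primed d j then 1/2 else 3/2)"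

lemma Lp_coord: "1 \<le> j \<Longrightarrow> Lp d j n = (zc d j, of_int n + real j / 2)"
  by (auto simp: Lp_def zc_def Wp_def Vp_def of_nat_diff field_simps)

lemma Rp_coord: "Rp d j n = (zc d j + 1/2, of_int n + (real j + 1) / 2)"
  by (auto simp: Rp_def zc_def Wp_def Vp_def)

lemma gedge_inj: "inj_on (gedge d) (Idx k)"
proof (rule inj_onI)
  fix a b assume a: "a \<in> Idx k" and b: "b \<in> Idx k" and eq: "gedge d a = gedge d b"
  obtain s i m t j n where ab: "a = (s, i, m)" "b = (t, j, n)" by (metis prod_cases3)
  have ij: "1 \<le> i" "1 \<le> j" using a b ab by (auto simp: Idx_def)
  then have "i = j"
    using eq unfolding ab
    by (cases s; cases t) (auto simp: Lp_def Rp_def doubleton_eq_iff split: if_splits)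
  then show "a = b"
    using eq ij unfolding ab
    by (cases s; cases t) (auto simp: Lp_def Rp_def doubleton_eq_iff split: if_splits)
qed

text \<open>Doubling the abscissas turns each admissible displacement into an equation between
  naturals, and its residue mod 3 excludes the displacements that do not occur for this kind of
  strip. The ordinates then select the edge.\<close>

lemma edge_step_VW:
  assumes "1 \<le> j" "Wp d j m - Vp i n \<in> {(1, 0), (1/2, 1/2), (1/2, - 1/2)}"
  shows "{Vp i n, Wp d j m} \<in> gedge d ` {(t, j, n) | t n. True}"
proof (cases "primed d j")
  case True
  have "real (3 * j) = real (3 * (i + 1)) \<or> real (3 * j) = real (3 * i + 2)"
    using assms(2) True by (auto simp: Vp_def Wp_def)
  then have "j = i + 1" unfolding of_nat_eq_iff by presburger
  then have "of_int m = (of_int n :: real)" "i = j - 1"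
    using assms(2) True by (auto simp: Vp_def Wp_def field_simps simp del: of_int_eq_iff)
  then show ?thesis using True by (intro image_eqI[of _ _ "(Hz, j, n)"]) auto
next
  case False
  have "real (3 * j) = real (3 * i + 4) \<or> real (3 * j) = real (3 * (i + 1))"
    using assms(2) False by (auto simp: Vp_def Wp_def)
  then have i: "j = i + 1" unfolding of_nat_eq_iff by presburger
  then have "of_int m = (of_int n :: real) \<or> of_int m = (of_int (n - 1) :: real)"
    using assms(2) False by (auto simp: Vp_def Wp_def field_simps simp del: of_int_eq_iff)
  then have "m = n \<or> m = n - 1" unfolding of_int_eq_iff .
  then show ?thesis
  proof
    assume "m = n"
    then show ?thesis using False i by (intro image_eqI[of _ _ "(Up, j, n)"]) (auto simp: Lp_def Rp_def)
  next
    assume "m = n - 1"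
    then show ?thesis using False i by (intro image_eqI[of _ _ "(Dn, j, n)"]) (auto simp: Lp_def Rp_def)
  qed
qed

lemma edge_step_WV:
  assumes "1 \<le> j" "Vp i n - Wp d j m \<in> {(1, 0), (1/2, 1/2), (1/2, - 1/2)}"
  shows "{Vp i n, Wp d j m} \<in> gedge d ` {(t, j, n) | t n. True}"
proof (cases "primed d j")
  case False
  have "real (3 * j) = real (3 * i) \<or> real (3 * j) = real (3 * i + 1)"
    using assms(2) False by (auto simp: Vp_def Wp_def)
  then have "j = i" unfolding of_nat_eq_iff by presburger
  then have "of_int m = (of_int n :: real)" "i = j"
    using assms(2) False by (auto simp: Vp_def Wp_def)
  then show ?thesis using False by (intro image_eqI[of _ _ "(Hz, j, n)"]) auto
next
  case True
  have "real (3 * j + 1) = real (3 * i) \<or> real (3 * j) = real (3 * i)"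
    using assms(2) True by (auto simp: Vp_def Wp_def)
  then have i: "j = i" unfolding of_nat_eq_iff by presburger
  then have "of_int m = (of_int n :: real) \<or> of_int m = (of_int (n + 1) :: real)"
    using assms(2) True by (auto simp: Vp_def Wp_def field_simps simp del: of_int_eq_iff)
  then have "m = n \<or> m = n + 1" unfolding of_int_eq_iff .
  then show ?thesis
  proof
    assume "m = n"
    then show ?thesis using True i by (intro image_eqI[of _ _ "(Up, j, m)"]) (auto simp: Lp_def Rp_def)
  next
    assume "m = n + 1"
    then show ?thesis using True i by (intro image_eqI[of _ _ "(Dn, j, m)"]) (auto simp: Lp_def Rp_def)
  qed
qed

lemma Vverts_eq: "Vverts k = {Vp j n | j n. j \<le> k}"
  by (auto simp: Vverts_def Vcol_eq)

lemma Wverts_eq: "Wverts k d = {Wp d j n | j n. 1 \<le> j \<and> j \<le> k}"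
  by (auto simp: Wverts_def Wcol_eq)

lemma gedge_cases:
  assumes "1 \<le> j"
  obtains i m n where "gedge d (t, j, l) = {Vp i m, Wp d j n}" "i \<le> j"
    "Wp d j n - Vp i m \<in> {(1, 0), (1/2, 1/2), (1/2, - 1/2)} \<or>
     Vp i m - Wp d j n \<in> {(1, 0), (1/2, 1/2), (1/2, - 1/2)}"
proof -
  have r: "real j = real (j - Suc 0) + 1" using assms by simp
  have L: "Lp d j n = (zc d j, of_int n + real j / 2)" for n using assms by (rule Lp_coord)
  have 1: "Rp d j n - Lp d j n = (1/2, 1/2)" "Rp d j (n - 1) - Lp d j n = (1/2, - 1/2)" for n
    by (simp_all add: L Rp_coord add_divide_distrib)
  have 2: "Wp d j n - Vp (j - 1) n = (1, 0)" if "primed d j" for n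
    using that by (simp add: Vp_def Wp_def r add_divide_distrib distrib_left)
  have 3: "Vp j n - Wp d j n = (1, 0)" if "\<not> primed d j" for n
    using that by (simp add: Vp_def Wp_def)
  show ?thesis
  proof (cases t)
    case Up
    show ?thesis
      by (rule that[of "if primed d j then j else j - 1" l l])
        (use 1(1)[of l] in \<open>auto simp: Up Lp_def Rp_def split: if_splits\<close>)
  next
    case Dn
    show ?thesis
      by (rule that[of "if primed d j then j else j - 1" "if primed d j then l - 1 else l"
            "if primed d j then l else l - 1"])
        (use 1(2)[of l] in \<open>auto simp: Dn Lp_def Rp_def split: if_splits\<close>)
  next
    case Hz
    show ?thesis
      by (rule that[of "if primed d j then j - 1 else j" l l])
        (use 2[of l] 3[of l] in \<open>auto simp: Hz split: if_splits\<close>)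
  qed
qed

lemma edges_eq: "edges k d = gedge d ` Idx k"
proof (intro equalityI subsetI)
  fix e assume "e \<in> edges k d"
  then obtain u v where uv: "e = {u, v}"
    "u \<in> Vverts k \<and> v \<in> Wverts k d \<or> u \<in> Wverts k d \<and> v \<in> Vverts k"
    "v - u \<in> {(1, 0), (1/2, 1/2), (1/2, - 1/2)}"
    unfolding edges_def by blast
  have sub: "gedge d ` {(t, j, n) | t n. True} \<subseteq> gedge d ` Idx k" if "1 \<le> j" "j \<le> k" for j
    using that by (intro image_mono) (auto simp: Idx_def)
  from uv(2) show "e \<in> gedge d ` Idx k"
  proof
    assume "u \<in> Vverts k \<and> v \<in> Wverts k d"
    then obtain i n j m where "u = Vp i n" "v = Wp d j m" "1 \<le> j" "j \<le> k"
      by (auto simp: Vverts_eq Wverts_eq)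
    then have "{Vp i n, Wp d j m} \<in> gedge d ` Idx k"
      using uv(3) by (intro subsetD[OF sub edge_step_VW]) auto
    then show ?thesis unfolding uv(1) \<open>u = _\<close> \<open>v = _\<close> .
  next
    assume "u \<in> Wverts k d \<and> v \<in> Vverts k"
    then obtain i n j m where "v = Vp i n" "u = Wp d j m" "1 \<le> j" "j \<le> k"
      by (auto simp: Vverts_eq Wverts_eq)
    then have "{Vp i n, Wp d j m} \<in> gedge d ` Idx k"
      using uv(3) by (intro subsetD[OF sub edge_step_WV]) auto
    then show ?thesis unfolding uv(1) \<open>v = _\<close> \<open>u = _\<close> by (simp only: insert_commute)
  qed
next
  fix e assume "e \<in> gedge d ` Idx k"
  then obtain t j l where e: "e = gedge d (t, j, l)" "1 \<le> j" "j \<le> k" by (auto simp: Idx_def)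
  from e(2) obtain i m n where *: "gedge d (t, j, l) = {Vp i m, Wp d j n}" "i \<le> j"
    "Wp d j n - Vp i m \<in> {(1, 0), (1/2, 1/2), (1/2, - 1/2)} \<or>
     Vp i m - Wp d j n \<in> {(1, 0), (1/2, 1/2), (1/2, - 1/2)}"
    by (rule gedge_cases)
  have V: "Vp i m \<in> Vverts k" using * e by (auto simp: Vverts_eq)
  have W: "Wp d j n \<in> Wverts k d" using e by (auto simp: Wverts_eq)
  from *(3) show "e \<in> edges k d"
  proof
    assume "Wp d j n - Vp i m \<in> {(1, 0), (1/2, 1/2), (1/2, - 1/2)}"
    then show ?thesis
      unfolding edges_def e(1) *(1)
      by (intro CollectI exI[of _ "Vp i m"] exI[of _ "Wp d j n"] conjI disjI1 V W refl)
  next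
    assume "Vp i m - Wp d j n \<in> {(1, 0), (1/2, 1/2), (1/2, - 1/2)}"
    then show ?thesis
      unfolding edges_def e(1) *(1)
      by (intro CollectI exI[of _ "Wp d j n"] exI[of _ "Vp i m"] conjI disjI2 V W insert_commute)
  qed
qed

section \<open>The bounded faces\<close>

text \<open>The distance to the nearest integer, a triangle wave of period 1.\<close>

definition tri :: "real \<Rightarrow> real" where
  "tri x = min (frac x) (1 - frac x)"

lemma tri_eq:
  assumes "\<bar>x - of_int n\<bar> \<le> 1/2"
  shows "tri x = \<bar>x - of_int n\<bar>"
proof (cases "of_int n \<le> x")
  case True
  then have "\<lfloor>x\<rfloor> = n" using assms by (intro floor_unique) auto
  then show ?thesis using True assms by (auto simp: tri_def frac_def)
next
  case False
  then have "\<lfloor>x\<rfloor> = n - 1" using assms by (intro floor_unique) auto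
  then show ?thesis using False assms by (auto simp: tri_def frac_def)
qed

lemma tri_bounds: "0 \<le> tri x" "tri x \<le> 1/2"
  using frac_lt_1[of x] by (auto simp: tri_def min_def)

lemma ex_near_int: "\<exists>n::int. \<bar>x - of_int n\<bar> \<le> (1/2::real)"
  by (rule exI[of _ "round x"]) (metis abs_minus_commute of_int_round_abs_le)

text \<open>The zigzag of strip \<open>j\<close> is the graph of \<open>zz d j\<close> over the ordinate axis.\<close>

definition zz :: "(nat \<Rightarrow> diamond) \<Rightarrow> nat \<Rightarrow> real \<Rightarrow> real" where
  "zz d j t = zc d j + tri (t - real j / 2)"

lemma zz_near:
  assumes "\<bar>t - (of_int n + real j / 2)\<bar> \<le> 1/2"
  shows "zz d j t = zc d j + \<bar>t - (of_int n + real j / 2)\<bar>"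
  using tri_eq[of "t - real j / 2" n] assms by (simp add: zz_def algebra_simps)

text \<open>Consecutive zigzags are half a period out of phase, so around the centre of a face the
  right one bends opposite to the left one.\<close>

lemma zz_Suc_near:
  assumes "\<bar>t - (of_int n + real j / 2)\<bar> \<le> 1/2"
  shows "zz d (Suc j) t = zc d (Suc j) + 1/2 - \<bar>t - (of_int n + real j / 2)\<bar>"
proof (cases "t \<ge> of_int n + real j / 2")
  case True
  then show ?thesis using assms zz_near[of t n "Suc j" d] by (auto simp: field_simps)
next
  case False
  then show ?thesis using assms zz_near[of t "n - 1" "Suc j" d] by (auto simp: field_simps)
qed

lemma zz_le_col: "zz d j t \<le> 3/2 * real j"
  using tri_bounds(2)[of "t - real j / 2"] by (auto simp: zz_def zc_def)

lemma col_le_zz: "3/2 * real j \<le> zz d (Suc j) t"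
  using tri_bounds(1)[of "t - real (Suc j) / 2"] by (auto simp: zz_def zc_def add_divide_distrib algebra_simps)

text \<open>The vertical line through column \<open>j\<close> separates zigzag \<open>j\<close> from
  zigzag \<open>Suc j\<close>.\<close>

lemma zz_mono: "i \<le> j \<Longrightarrow> zz d i t \<le> zz d j t"
proof (induction j rule: dec_induct)
  case (step n)
  then show ?case using zz_le_col[of d n t] col_le_zz[of n d t] by linarith
qed simp

section \<open>The drawing as zigzags and horizontal segments\<close>

definition skel :: "nat \<Rightarrow> (nat \<Rightarrow> diamond) \<Rightarrow> point set" where
  "skel k d = (\<Union>e\<in>edges k d. convex hull e)"

text \<open>The ordinate window is the gap between \<open>Vp j (n - 1)\<close> and
  \<open>Vp j n\<close>. At its two ends horizontal edges close the face, unless the two zigzags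
  already touch there.\<close>

definition face :: "(nat \<Rightarrow> diamond) \<Rightarrow> nat \<Rightarrow> int \<Rightarrow> point set" where
  "face d j n = {(x, t). \<bar>t - (of_int n + real j / 2)\<bar> < 1/2 \<and> zz d j t < x \<and> x < zz d (Suc j) t}"

lemma hull_Up:
  assumes "1 \<le> j"
  shows "convex hull (gedge d (Up, j, n)) =
    {(x, t). of_int n + real j / 2 \<le> t \<and> t \<le> of_int n + real j / 2 + 1/2 \<and> x = zz d j t}"
proof (intro set_eqI)
  fix p :: point obtain x t where p: "p = (x, t)" by force
  show "p \<in> convex hull (gedge d (Up, j, n)) \<longleftrightarrow> p \<in>
    {(x, t). of_int n + real j / 2 \<le> t \<and> t \<le> of_int n + real j / 2 + 1/2 \<and> x = zz d j t}"
    (is "?l \<longleftrightarrow> ?r")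
  proof
    assume ?l
    then obtain u where u: "0 \<le> u" "u \<le> 1" "p = (1 - u) *\<^sub>R Lp d j n + u *\<^sub>R Rp d j n"
      by (auto simp: segment_convex_hull[symmetric] in_segment)
    have "x = zc d j + u / 2" "t = of_int n + real j / 2 + u / 2"
      using u(3) unfolding p by (auto simp: Lp_coord[OF assms] Rp_coord algebra_simps) (simp add: field_simps)?
    then show ?r using u zz_near[of t n j d] by (auto simp: p)
  next
    assume r: ?r
    have "\<exists>u. 0 \<le> u \<and> u \<le> 1 \<and> p = (1 - u) *\<^sub>R Lp d j n + u *\<^sub>R Rp d j n"
      by (rule exI[of _ "2 * (t - (of_int n + real j / 2))"])
        (use r zz_near[of t n j d] in \<open>auto simp: p Lp_coord[OF assms] Rp_coord field_simps\<close>)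
    then show ?l by (auto simp: segment_convex_hull[symmetric] in_segment)
  qed
qed

lemma hull_Dn:
  assumes "1 \<le> j"
  shows "convex hull (gedge d (Dn, j, n)) =
    {(x, t). of_int n + real j / 2 - 1/2 \<le> t \<and> t \<le> of_int n + real j / 2 \<and> x = zz d j t}"
proof (intro set_eqI)
  fix p :: point obtain x t where p: "p = (x, t)" by force
  show "p \<in> convex hull (gedge d (Dn, j, n)) \<longleftrightarrow> p \<in>
    {(x, t). of_int n + real j / 2 - 1/2 \<le> t \<and> t \<le> of_int n + real j / 2 \<and> x = zz d j t}"
    (is "?l \<longleftrightarrow> ?r")
  proof
    assume ?l
    then obtain u where u: "0 \<le> u" "u \<le> 1" "p = (1 - u) *\<^sub>R Lp d j n + u *\<^sub>R Rp d j (n - 1)"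
      by (auto simp: segment_convex_hull[symmetric] in_segment)
    have "x = zc d j + u / 2" "t = of_int n + real j / 2 - u / 2"
      using u(3) unfolding p by (auto simp: Lp_coord[OF assms] Rp_coord algebra_simps) (simp add: field_simps)?
    then show ?r using u zz_near[of t n j d] by (auto simp: p)
  next
    assume r: ?r
    have "\<exists>u. 0 \<le> u \<and> u \<le> 1 \<and> p = (1 - u) *\<^sub>R Lp d j n + u *\<^sub>R Rp d j (n - 1)"
      by (rule exI[of _ "2 * (of_int n + real j / 2 - t)"])
        (use r zz_near[of t n j d] in \<open>auto simp: p Lp_coord[OF assms] Rp_coord field_simps\<close>)
    then show ?l by (auto simp: segment_convex_hull[symmetric] in_segment)
  qed
qed

lemma closed_segment_horizontal:
  fixes a b t :: real
  assumes "a \<le> b"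
  shows "closed_segment (a, t) (b, t) = {(x, s). s = t \<and> a \<le> x \<and> x \<le> b}"
proof -
  have "closed_segment (a, t) (b, t) = (\<lambda>x. (x, t)) ` closed_segment a b"
  proof (intro set_eqI iffI)
    fix p assume "p \<in> closed_segment (a, t) (b, t)"
    then obtain u where "0 \<le> u" "u \<le> 1" "p = ((1 - u) * a + u * b, (1 - u) * t + u * t)"
      by (auto simp: in_segment)
    then show "p \<in> (\<lambda>x. (x, t)) ` closed_segment a b"
      by (intro image_eqI[of _ _ "(1 - u) * a + u * b"]) (auto simp: in_segment algebra_simps)
  next
    fix p assume "p \<in> (\<lambda>x. (x, t)) ` closed_segment a b"
    then show "p \<in> closed_segment (a, t) (b, t)"
      by (auto simp: in_segment algebra_simps)
  qed
  then show ?thesis using assms by (auto simp: closed_segment_eq_real_ivl)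
qed

lemma hull_Hz:
  assumes "1 \<le> j"
  shows "convex hull (gedge d (Hz, j, n)) =
    (if primed d j then {(x, t). t = of_int n + real j / 2 \<and> 3/2 * real (j - 1) \<le> x \<and> x \<le> zc d j}
     else {(x, t). t = of_int n + (real j + 1) / 2 \<and> zc d j + 1/2 \<le> x \<and> x \<le> 3/2 * real j})"
proof (cases "primed d j")
  case True
  have "Vp (j - 1) n = (3/2 * real (j - 1), of_int n + real j / 2)"
       "Wp d j n = (zc d j, of_int n + real j / 2)" "3/2 * real (j - 1) \<le> zc d j"
    using True assms by (auto simp: Vp_def Wp_def zc_def of_nat_diff)
  then show ?thesis using True
    by (simp add: segment_convex_hull[symmetric] closed_segment_horizontal)
next
  case False
  have "Vp j n = (3/2 * real j, of_int n + (real j + 1) / 2)"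
       "Wp d j n = (zc d j + 1/2, of_int n + (real j + 1) / 2)" "zc d j + 1/2 \<le> 3/2 * real j"
    using False assms by (auto simp: Vp_def Wp_def zc_def)
  then show ?thesis using False
    by (simp add: segment_convex_hull[symmetric] closed_segment_horizontal)
qed

lemma in_skelI:
  assumes "p \<in> convex hull (gedge d (e, j, n))" "1 \<le> j" "j \<le> k"
  shows "p \<in> skel k d"
  unfolding skel_def edges_eq
  by (rule UN_I[of "gedge d (e, j, n)"])
    (use assms in \<open>auto simp: Idx_def simp del: gedge.simps\<close>)

lemma zigzag_in_skel:
  assumes "1 \<le> j" "j \<le> k"
  shows "(zz d j t, t) \<in> skel k d"
proof -
  obtain n :: int where n: "\<bar>t - real j / 2 - of_int n\<bar> \<le> 1/2" using ex_near_int by blast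
  have "(zz d j t, t) \<in> convex hull (gedge d (if of_int n + real j / 2 \<le> t then Up else Dn, j, n))"
    using n hull_Up[OF assms(1), of d n] hull_Dn[OF assms(1), of d n] by (auto simp: abs_le_iff)
  then show ?thesis using assms by (elim in_skelI; simp)
qed

lemma zz_at_Vp: "t = of_int n + (real j + 1) / 2 \<Longrightarrow> zz d j t = zc d j + 1/2"
  using zz_near[of t n j d] by (simp add: field_simps)

lemma zz_Suc_at_Vp: "t = of_int n + (real j + 1) / 2 \<Longrightarrow> zz d (Suc j) t = zc d (Suc j)"
  using zz_near[of t n "Suc j" d] by (simp add: field_simps)

text \<open>On both sides of \<open>Vp j n\<close> the way to the zigzag is either a horizontal edge
  or a single point, the vertex itself then lying on the zigzag.\<close>

lemma horizontal_in_skel: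
  assumes "1 \<le> j" "j < k" and t: "t = of_int n + (real j + 1) / 2"
    and x: "zz d j t \<le> x" "x \<le> zz d (Suc j) t"
  shows "(x, t) \<in> skel k d"
proof (cases "x \<le> 3/2 * real j")
  case x': True
  show ?thesis
  proof (cases "primed d j")
    case True
    then have "x = zz d j t"
      using x(1) x' zz_at_Vp[OF t, of d] by (simp add: zc_def)
    then show ?thesis using zigzag_in_skel[of j k d t] assms by simp
  next
    case False
    then have "(x, t) \<in> convex hull (gedge d (Hz, j, n))"
      using x' x(1) t zz_at_Vp[OF t, of d] by (simp add: hull_Hz[OF assms(1)] del: gedge.simps)
    then show ?thesis using assms by (elim in_skelI; simp)
  qed
next
  case x': False
  show ?thesis
  proof (cases "primed d (Suc j)")
    case True
    then have "(x, t) \<in> convex hull (gedge d (Hz, Suc j, n))"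
      using x' x(2) t zz_Suc_at_Vp[OF t, of d] by (simp add: hull_Hz del: gedge.simps)
    then show ?thesis using assms by (elim in_skelI; simp)
  next
    case False
    then have "x \<le> 3/2 * real j"
      using x(2) zz_Suc_at_Vp[OF t, of d] by (simp add: zc_def add_divide_distrib)
    then show ?thesis using x' by simp
  qed
qed

text \<open>A horizontal edge is filed under the column \<open>i\<close> of its
  \<open>V\<close>-vertex and lies in the gap between zigzags \<open>i\<close> and
  \<open>Suc i\<close>. The outer columns border on only one zigzag of the graph, so there the last
  two facts bound the segment by the column itself.\<close>

lemma skel_cases:
  assumes "(x, t) \<in> skel k d"
  obtains i where "1 \<le> i" "i \<le> k" "x = zz d i t"
  | i m where "i \<le> k" "t = of_int m + (real i + 1) / 2" "zz d i t \<le> x" "x \<le> zz d (Suc i) t"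
      "i = 0 \<Longrightarrow> 0 \<le> x" "i = k \<Longrightarrow> x \<le> 3/2 * real k"
proof -
  obtain e i m where i: "1 \<le> i" "i \<le> k" "(x, t) \<in> convex hull (gedge d (e, i, m))"
    using assms unfolding skel_def edges_eq by (auto simp: Idx_def)
  show ?thesis
  proof (cases e)
    case Up
    then show ?thesis using i hull_Up[of i d m] that(1)[of i] by auto
  next
    case Dn
    then show ?thesis using i hull_Dn[of i d m] that(1)[of i] by auto
  next
    case Hz
    show ?thesis
    proof (cases "primed d i")
      case True
      obtain i' where i': "i = Suc i'" using i(1) by (cases i) auto
      have *: "t = of_int m + (real i' + 1) / 2" "3/2 * real i' \<le> x" "x \<le> zc d (Suc i')"
        using i True unfolding i' by (auto simp: Hz hull_Hz add_ac simp del: gedge.simps)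
      show ?thesis
        by (rule that(2)[of i' m])
          (use * i zz_Suc_at_Vp[OF *(1), of d] zz_le_col[of d i' t] in \<open>auto simp: i'\<close>)
    next
      case False
      then have *: "t = of_int m + (real i + 1) / 2" "zc d i + 1/2 \<le> x" "x \<le> 3/2 * real i"
        using i by (auto simp: Hz hull_Hz simp del: gedge.simps)
      show ?thesis
        by (rule that(2)[of i m])
          (use * i zz_at_Vp[OF *(1), of d] col_le_zz[of i d t] in auto)
    qed
  qed
qed

lemma half_odd_not_near:
  assumes "\<bar>of_int m + (real j + 1) / 2 - (of_int n + real j / 2)\<bar> < 1/2"
  shows False
proof -
  have "real_of_int n - 1 < real_of_int m" "real_of_int m < real_of_int n"
    using assms by (auto simp: abs_less_iff field_simps)
  then have "real_of_int (n - 1) < real_of_int m" "real_of_int m < real_of_int n" by simp_all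
  then show False unfolding of_int_less_iff by simp
qed

text \<open>By the order of the zigzags only horizontal edges of column \<open>j\<close> could enter
  the face, and their ordinates are at distance at least 1/2 from its centre.\<close>

lemma face_skel_disjoint: "face d j n \<inter> skel k d = {}"
proof (rule ccontr)
  assume "face d j n \<inter> skel k d \<noteq> {}"
  then obtain x t where "(x, t) \<in> face d j n" and sk: "(x, t) \<in> skel k d" by auto
  then have f: "\<bar>t - (of_int n + real j / 2)\<bar> < 1/2" "zz d j t < x" "x < zz d (Suc j) t"
    by (auto simp: face_def)
  have mono: "zz d a t \<le> zz d b t" if "a \<le> b" for a b using zz_mono that .
  from sk show False
  proof (cases rule: skel_cases)
    case (1 i)
    then show False using f mono[of i j] mono[of "Suc j" i] by (cases "i \<le> j") auto
  next
    case (2 i m)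
    consider "i < j" | "i = j" | "j < i" by linarith
    then show False
    proof cases
      case 1 then show False using 2 f mono[of "Suc i" j] by auto
    next
      case 3 then show False using 2 f mono[of "Suc j" i] by auto
    next
      case i: 2
      then show False using 2(2) f(1) half_odd_not_near[of m j n] by simp
    qed
  qed
qed

section \<open>Faces as convex polygons\<close>

definition cface :: "(nat \<Rightarrow> diamond) \<Rightarrow> nat \<Rightarrow> int \<Rightarrow> point set" where
  "cface d j n = {(x, t). \<bar>t - (of_int n + real j / 2)\<bar> \<le> 1/2 \<and>
     zc d j + \<bar>t - (of_int n + real j / 2)\<bar> \<le> x \<and>
     x \<le> zc d (Suc j) + 1/2 - \<bar>t - (of_int n + real j / 2)\<bar>}"

lemma face_eq: "face d j n = {(x, t). \<bar>t - (of_int n + real j / 2)\<bar> < 1/2 \<and>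
     zc d j + \<bar>t - (of_int n + real j / 2)\<bar> < x \<and>
     x < zc d (Suc j) + 1/2 - \<bar>t - (of_int n + real j / 2)\<bar>}"
  unfolding face_def using zz_near[of _ n j d] zz_Suc_near[of _ n j d] by auto

text \<open>As an intersection of six half-planes the closed face is convex and closed, and its
  interior is obtained by making every inequality strict.\<close>

lemma cface_halfspaces:
  fixes d j n
  defines "c \<equiv> of_int n + real j / 2" and "a \<equiv> zc d j" and "b \<equiv> zc d (Suc j) + 1/2"
  shows "cface d j n =
    {p. (0, 1) \<bullet> p \<le> c + 1/2} \<inter> {p. (0, -1) \<bullet> p \<le> 1/2 - c} \<inter> {p. (-1, 1) \<bullet> p \<le> c - a} \<inter>
    {p. (-1, -1) \<bullet> p \<le> - c - a} \<inter> {p. (1, 1) \<bullet> p \<le> b + c} \<inter> {p. (1, -1) \<bullet> p \<le> b - c}"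
    (is "_ = ?R")
    and "face d j n =
    {p. (0, 1) \<bullet> p < c + 1/2} \<inter> {p. (0, -1) \<bullet> p < 1/2 - c} \<inter> {p. (-1, 1) \<bullet> p < c - a} \<inter>
    {p. (-1, -1) \<bullet> p < - c - a} \<inter> {p. (1, 1) \<bullet> p < b + c} \<inter> {p. (1, -1) \<bullet> p < b - c}"
    (is "_ = ?S")
proof -
  have "cface d j n = {(x, t). \<bar>t - c\<bar> \<le> 1/2 \<and> a + \<bar>t - c\<bar> \<le> x \<and> x \<le> b - \<bar>t - c\<bar>}"
    by (simp add: cface_def c_def a_def b_def)
  also have "\<dots> = ?R" by (auto simp: inner_Pair abs_if split: if_splits)
  finally show "cface d j n = ?R" .
  have "face d j n = {(x, t). \<bar>t - c\<bar> < 1/2 \<and> a + \<bar>t - c\<bar> < x \<and> x < b - \<bar>t - c\<bar>}"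
    by (simp add: face_eq c_def a_def b_def)
  also have "\<dots> = ?S" by (auto simp: inner_Pair abs_if split: if_splits)
  finally show "face d j n = ?S" .
qed

lemma interior_cface: "interior (cface d j n) = face d j n"
proof -
  have nz: "((0, 1) :: point) \<noteq> 0" "((0, -1) :: point) \<noteq> 0" "((-1, 1) :: point) \<noteq> 0"
    "((-1, -1) :: point) \<noteq> 0" "((1, 1) :: point) \<noteq> 0" "((1, -1) :: point) \<noteq> 0"
    by (simp_all add: zero_prod_def)
  show ?thesis
    unfolding cface_halfspaces interior_Int nz[THEN interior_halfspace_le] ..
qed

lemma convex_cface: "convex (cface d j n)"
  unfolding cface_halfspaces by (intro convex_Int convex_halfspace_le)

lemma closed_cface: "closed (cface d j n)"
  unfolding cface_halfspaces by (intro closed_Int closed_halfspace_le)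

lemma open_face: "open (face d j n)"
  by (metis interior_cface open_interior)

lemma connected_face: "connected (face d j n)"
  by (metis interior_cface convex_interior convex_cface convex_connected)

lemma face_nonempty: "face d j n \<noteq> {}"
proof -
  have "zc d j < 3/2 * real j" "3/2 * real j < zc d (Suc j) + 1/2"
    by (auto simp: zc_def add_divide_distrib)
  then have "(3/2 * real j, of_int n + real j / 2) \<in> face d j n" by (simp add: face_eq)
  then show ?thesis by blast
qed

lemma frontier_face: "frontier (face d j n) = cface d j n - face d j n"
proof -
  have "closure (face d j n) = cface d j n"
    using convex_closure_interior[OF convex_cface] face_nonempty closed_cface
    by (metis interior_cface closure_closed)
  then show ?thesis by (simp add: frontier_def interior_open[OF open_face])
qed

lemma bounded_face: "bounded (face d j n)"
proof (rule bounded_subset)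
  let ?c = "of_int n + real j / 2"
  show "bounded ({zc d j .. zc d (Suc j) + 1/2} \<times> {?c - 1/2 .. ?c + 1/2})"
    by (intro bounded_Times) auto
  show "face d j n \<subseteq> {zc d j .. zc d (Suc j) + 1/2} \<times> {?c - 1/2 .. ?c + 1/2}"
    by (auto simp: face_eq abs_if split: if_splits)
qed

lemma cface_boundary:
  assumes "1 \<le> j" "j < k"
  shows "cface d j n - face d j n \<subseteq> skel k d"
proof
  fix p assume p: "p \<in> cface d j n - face d j n"
  obtain x t where xt: "p = (x, t)" by force
  let ?c = "of_int n + real j / 2"
  have *: "\<bar>t - ?c\<bar> \<le> 1/2" "zz d j t \<le> x" "x \<le> zz d (Suc j) t"
    using p zz_near[of t n j d] zz_Suc_near[of t n j d] by (auto simp: xt cface_def)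
  have "\<bar>t - ?c\<bar> = 1/2 \<or> x = zz d j t \<or> x = zz d (Suc j) t"
    using p * by (auto simp: xt face_def)
  then consider "t = ?c + 1/2" | "t = ?c - 1/2" | "x = zz d j t" | "x = zz d (Suc j) t"
    by linarith
  then show "p \<in> skel k d"
  proof cases
    case 1
    then show ?thesis using horizontal_in_skel[of j k t n d x] * assms by (auto simp: xt field_simps)
  next
    case 2
    then show ?thesis using horizontal_in_skel[of j k t "n - 1" d x] * assms
      by (auto simp: xt field_simps)
  next
    case 3
    then show ?thesis using zigzag_in_skel[of j k d t] assms by (simp add: xt)
  next
    case 4
    then show ?thesis using zigzag_in_skel[of "Suc j" k d t] assms by (simp add: xt)
  qed
qed

text \<open>A strictly larger connected subset of \<open>S\<close> would have to cross the frontier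
  of \<open>F\<close>, which lies outside \<open>S\<close>.\<close>

lemma open_connected_component:
  fixes F S :: "'a::real_normed_vector set"
  assumes "open F" "connected F" "F \<noteq> {}" "F \<subseteq> S" "frontier F \<inter> S = {}"
  shows "F \<in> components S"
  unfolding in_components_maximal
proof (intro conjI allI impI)
  fix c assume c: "c \<noteq> {} \<and> F \<subseteq> c \<and> c \<subseteq> S \<and> connected c"
  then have "c \<inter> F \<noteq> {}" "c \<inter> frontier F = {}" using assms by auto
  then have "c - F = {}" using connected_Int_frontier[of c F] c by blast
  then show "c = F" using c by auto
qed (use assms in auto)

lemma face_component:
  assumes "1 \<le> j" "j < k"
  shows "face d j n \<in> components (- skel k d)"
  by (rule open_connected_component)
    (use face_skel_disjoint[of d j n k] cface_boundary[OF assms, of d n] in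
      \<open>auto simp: open_face connected_face face_nonempty frontier_face\<close>)

section \<open>The remaining components are unbounded\<close>

lemma unbounded_ray:
  fixes x t :: real
  shows "\<not> bounded ({..x} \<times> {t})" "\<not> bounded ({x..} \<times> {t})"
    "connected ({..x} \<times> {t})" "connected ({x..} \<times> {t})"
proof -
  show "\<not> bounded ({..x} \<times> {t})"
  proof
    assume "bounded ({..x} \<times> {t})"
    then have "bounded (fst ` ({..x} \<times> {t}))" by (rule bounded_fst)
    then have "bdd_below {..x}" by (simp add: bounded_imp_bdd_below)
    then obtain l where l: "\<And>y. y \<le> x \<Longrightarrow> l \<le> y" by (auto simp: bdd_below_def)
    have "l \<le> min l x - 1" by (rule l) linarith
    then show False by linarith
  qed
  show "\<not> bounded ({x..} \<times> {t})"
  proof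
    assume "bounded ({x..} \<times> {t})"
    then have "bounded (fst ` ({x..} \<times> {t}))" by (rule bounded_fst)
    then have "bdd_above {x..}" by (simp add: bounded_imp_bdd_above)
    then obtain u where u: "\<And>y. x \<le> y \<Longrightarrow> y \<le> u" by (auto simp: bdd_above_def)
    have "max u x + 1 \<le> u" by (rule u) linarith
    then show False by linarith
  qed
qed (auto intro!: connected_Times)

text \<open>The only edges left of the first zigzag are horizontal ones from column 0 up to that
  zigzag. Such an edge meeting the ray would also contain its end point
  \<open>(x, t)\<close>.\<close>

lemma left_ray_avoids_skel:
  assumes "1 \<le> k" "(x, t) \<notin> skel k d" "x < zz d 1 t"
  shows "({..x} \<times> {t}) \<inter> skel k d = {}"
proof (rule ccontr)
  assume "({..x} \<times> {t}) \<inter> skel k d \<noteq> {}"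
  then obtain x' where x': "x' \<le> x" "(x', t) \<in> skel k d" by auto
  have mono: "zz d a t \<le> zz d b t" if "a \<le> b" for a b using zz_mono that .
  from x'(2) show False
  proof (cases rule: skel_cases)
    case (1 i)
    then show False using mono[of 1 i] assms x'(1) by auto
  next
    case (2 i m)
    show False
    proof (cases "i = 0")
      case False
      then show False using 2 mono[of 1 i] assms x' by auto
    next
      case True
      then have t: "t = of_int m + (real 0 + 1) / 2" and "0 \<le> x" using 2 x' by auto
      have z: "zz d (Suc 0) t = zc d (Suc 0)" using zz_Suc_at_Vp[OF t, of d] by simp
      then have pr: "primed d 1" using assms(3) \<open>0 \<le> x\<close> by (auto simp: zc_def split: if_splits)
      have "(x, t) \<in> convex hull (gedge d (Hz, 1, m))"
        using pr \<open>0 \<le> x\<close> assms(3) t z by (simp add: hull_Hz del: gedge.simps)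
      then have "(x, t) \<in> skel k d" using assms(1) by (elim in_skelI; simp)
      then show False using assms by simp
    qed
  qed
qed

lemma right_ray_avoids_skel:
  assumes "1 \<le> k" "(x, t) \<notin> skel k d" "zz d k t < x"
  shows "({x..} \<times> {t}) \<inter> skel k d = {}"
proof (rule ccontr)
  assume "({x..} \<times> {t}) \<inter> skel k d \<noteq> {}"
  then obtain x' where x': "x \<le> x'" "(x', t) \<in> skel k d" by auto
  have mono: "zz d a t \<le> zz d b t" if "a \<le> b" for a b using zz_mono that .
  from x'(2) show False
  proof (cases rule: skel_cases)
    case (1 i)
    then show False using mono[of i k] assms x'(1) by auto
  next
    case (2 i m)
    show False
    proof (cases "i = k")
      case False
      then show False using 2 mono[of "Suc i" k] assms x' by auto
    next
      case True
      then have t: "t = of_int m + (real k + 1) / 2" and "x \<le> 3/2 * real k" using 2 x' by auto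
      have z: "zz d k t = zc d k + 1/2" using zz_at_Vp[OF t, of d] by simp
      then have pr: "\<not> primed d k" using assms(3) \<open>x \<le> 3/2 * real k\<close> by (auto simp: zc_def)
      have "(x, t) \<in> convex hull (gedge d (Hz, k, m))"
        using pr \<open>x \<le> 3/2 * real k\<close> assms t z by (simp add: hull_Hz del: gedge.simps)
      then have "(x, t) \<in> skel k d" using assms(1) by (elim in_skelI; simp)
      then show False using assms by simp
    qed
  qed
qed

text \<open>A point of a bounded component lies between the first and the last zigzag, since
  otherwise a horizontal ray inside the component runs to infinity. The two zigzags around it and
  the nearest face centre then name a face, and distinct components are disjoint.\<close>

lemma bounded_faces_eq:
  assumes "1 \<le> k"
  shows "bounded_faces k d = {face d j n | j n. 1 \<le> j \<and> j < k}"
proof (intro equalityI subsetI)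
  fix C assume "C \<in> bounded_faces k d"
  then have C: "C \<in> components (- skel k d)" "bounded C"
    by (auto simp: bounded_faces_def skel_def)
  then obtain p where p: "p \<in> C" using in_components_nonempty by blast
  obtain x t where xt: "p = (x, t)" by force
  have ns: "(x, t) \<notin> skel k d" using C p in_components_subset xt by blast
  have ray: False if "connected R" "(x, t) \<in> R" "R \<inter> skel k d = {}" "\<not> bounded R" for R
  proof -
    have "R \<subseteq> C"
      using components_maximal[OF C(1) that(1)] that p xt by blast
    then show False using C(2) bounded_subset that(4) by blast
  qed
  have "zz d 1 t \<le> x"
  proof (rule ccontr)
    assume "\<not> zz d 1 t \<le> x"
    then show False
      using left_ray_avoids_skel[OF assms ns] by (intro ray[OF unbounded_ray(3)[of x t]]) (auto simp: unbounded_ray)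
  qed
  moreover have "x \<le> zz d k t"
  proof (rule ccontr)
    assume "\<not> x \<le> zz d k t"
    then show False
      using right_ray_avoids_skel[OF assms ns] by (intro ray[OF unbounded_ray(4)[of x t]]) (auto simp: unbounded_ray)
  qed
  moreover have "x \<noteq> zz d i t" if "1 \<le> i" "i \<le> k" for i
    using zigzag_in_skel[OF that, of d t] ns by auto
  ultimately have "zz d 1 t < x" "x < zz d k t" using assms by (auto simp: order_less_le)
  \<comment> \<open>The first zigzag to the right of the point is number \<open>Suc j\<close>; by
    minimality zigzag \<open>j\<close> is not to its right.\<close>
  define j where "j = (LEAST i. 1 \<le> i \<and> x < zz d (Suc i) t)"
  have "1 \<le> k - 1" "x < zz d (Suc (k - 1)) t"
    using \<open>zz d 1 t < x\<close> \<open>x < zz d k t\<close> assms by (cases "k = 1"; simp)+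
  then have j: "1 \<le> j" "x < zz d (Suc j) t" "j \<le> k - 1"
    unfolding j_def using LeastI[of "\<lambda>i. 1 \<le> i \<and> x < zz d (Suc i) t" "k - 1"]
    by (auto intro: Least_le)
  have jk: "j < k" using j(3) \<open>1 \<le> k - 1\<close> by linarith
  have "zz d j t \<le> x"
  proof (cases "j = 1")
    case False
    then have "1 \<le> j - 1" "j - 1 < j" using j by auto
    then show ?thesis
      using not_less_Least[of "j - 1" "\<lambda>i. 1 \<le> i \<and> x < zz d (Suc i) t"] unfolding j_def[symmetric]
      by (auto simp: Suc_diff_le not_less)
  qed (use \<open>zz d 1 t < x\<close> in auto)
  then have zj: "zz d j t < x" using zigzag_in_skel[of j k d t] j jk ns by (auto simp: order_less_le)
  obtain n :: int where n: "\<bar>t - real j / 2 - of_int n\<bar> \<le> 1/2" using ex_near_int by blast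
  have "\<bar>t - (of_int n + real j / 2)\<bar> \<noteq> 1/2"
  proof
    assume "\<bar>t - (of_int n + real j / 2)\<bar> = 1/2"
    then have "t = of_int n + (real j + 1) / 2 \<or> t = of_int (n - 1) + (real j + 1) / 2"
      by (auto simp: abs_if field_simps split: if_splits)
    then show False
      using horizontal_in_skel[of j k t n d x] horizontal_in_skel[of j k t "n - 1" d x] j jk zj ns
      by auto
  qed
  then have "(x, t) \<in> face d j n" using n zj j by (auto simp: face_def algebra_simps)
  then have "C = face d j n"
    using C(1) face_component[OF j(1) jk, of d n] p xt components_nonoverlap by blast
  then show "C \<in> {face d j n | j n. 1 \<le> j \<and> j < k}" using j jk by blast
next
  fix C assume "C \<in> {face d j n | j n. 1 \<le> j \<and> j < k}"
  then show "C \<in> bounded_faces k d"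
    using face_component bounded_face by (auto simp: bounded_faces_def skel_def)
qed

text \<open>Four zigzag edges always, and two horizontal ones for each side on which the face
  reaches past the column: the faces are squares, hexagons or octagons.\<close>

definition Bd :: "(nat \<Rightarrow> diamond) \<Rightarrow> nat \<Rightarrow> int \<Rightarrow> (ekind \<times> nat \<times> int) set" where
  "Bd d j n = {(Up, j, n), (Dn, j, n), (Up, Suc j, n - 1), (Dn, Suc j, n)} \<union>
     (if primed d j then {} else {(Hz, j, n), (Hz, j, n - 1)}) \<union>
     (if primed d (Suc j) then {(Hz, Suc j, n), (Hz, Suc j, n - 1)} else {})"

text \<open>The closed face is convex, so an edge lies in it as soon as its end points do; and it
  then lies on the frontier because the drawing avoids the open face.\<close>

lemma border_eq_subset_cface:
  "border k d (face d j n) = {e \<in> edges k d. e \<subseteq> cface d j n}"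
proof -
  have "convex hull e \<subseteq> frontier (face d j n) \<longleftrightarrow> e \<subseteq> cface d j n" if "e \<in> edges k d" for e
  proof
    assume "convex hull e \<subseteq> frontier (face d j n)"
    then show "e \<subseteq> cface d j n" using hull_subset[of e convex] by (auto simp: frontier_face)
  next
    assume "e \<subseteq> cface d j n"
    then have "convex hull e \<subseteq> cface d j n" by (intro hull_minimal convex_cface)
    moreover have "convex hull e \<subseteq> skel k d" using that by (auto simp: skel_def)
    ultimately show "convex hull e \<subseteq> frontier (face d j n)"
      using face_skel_disjoint[of d j n k] by (auto simp: frontier_face)
  qed
  then show ?thesis by (auto simp: border_def)
qed

lemma zc_bounds:
  "3/2 * real j - 3/2 \<le> zc d j" "zc d j \<le> 3/2 * real j - 1/2"
  "3/2 * real j \<le> zc d (Suc j)" "zc d (Suc j) \<le> 3/2 * real j + 1"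
  by (auto simp: zc_def add_divide_distrib)

lemma half_int_cases:
  fixes u :: real
  assumes "2 * u = of_int z" "\<bar>u\<bar> \<le> 1/2"
  shows "z = - 1 \<or> z = 0 \<or> z = 1"
proof -
  have "of_int (- 1) \<le> (of_int z :: real)" "(of_int z :: real) \<le> of_int 1"
    using assms by (auto simp: abs_le_iff)
  then have "- 1 \<le> z" "z \<le> 1" unfolding of_int_le_iff .
  then show ?thesis by auto
qed

text \<open>Twice the ordinate offset of the left end from the face centre is an integer
  \<open>z\<close> in {-1, 0, 1}, and an ascending edge cannot start at the top, so \<open>z\<close>
  is not 1. The abscissas leave \<open>i = j\<close> or \<open>i = Suc j\<close>, and the parity of
  \<open>z\<close> is that of \<open>i - j\<close>, which determines \<open>m\<close>. The other two
  kinds of edges are treated alike.\<close>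

lemma gedge_Up_cface:
  assumes "1 \<le> i" "1 \<le> j"
  shows "gedge d (Up, i, m) \<subseteq> cface d j n \<longleftrightarrow> (i = j \<and> m = n) \<or> (i = Suc j \<and> m = n - 1)"
proof
  assume "gedge d (Up, i, m) \<subseteq> cface d j n"
  then have L: "(zc d i, of_int m + real i / 2) \<in> cface d j n"
    and R: "(zc d i + 1/2, of_int m + (real i + 1) / 2) \<in> cface d j n"
    by (simp_all add: Lp_coord[OF assms(1)] Rp_coord)
  define u where "u = of_int m + real i / 2 - (of_int n + real j / 2)"
  have L': "\<bar>u\<bar> \<le> 1/2" "zc d j + \<bar>u\<bar> \<le> zc d i" "zc d i \<le> zc d (Suc j) + 1/2 - \<bar>u\<bar>"
    using L by (auto simp: cface_def u_def)
  have "of_int m + (real i + 1) / 2 - (of_int n + real j / 2) = u + 1/2"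
    by (simp add: u_def add_divide_distrib)
  then have R': "\<bar>u + 1/2\<bar> \<le> 1/2" "zc d j + \<bar>u + 1/2\<bar> \<le> zc d i + 1/2"
    "zc d i + 1/2 \<le> zc d (Suc j) + 1/2 - \<bar>u + 1/2\<bar>"
    using R by (auto simp: cface_def)
  define z where "z = 2 * m + int i - 2 * n - int j"
  have z: "2 * u = of_int z" by (simp add: u_def z_def)
  have "z \<noteq> 1" using z R'(1) by auto
  then have "z = 0 \<or> z = - 1" using half_int_cases[OF z L'(1)] by auto
  moreover have "real i < real j + 2" "real j < real i + 1"
    using calculation z L' R' zc_bounds[where d = d and j = i] zc_bounds[where d = d and j = j] by auto
  then have "i < j + 2" "j \<le> i" by linarith+
  ultimately show "(i = j \<and> m = n) \<or> (i = Suc j \<and> m = n - 1)" unfolding z_def by presburger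
next
  assume "(i = j \<and> m = n) \<or> (i = Suc j \<and> m = n - 1)"
  then show "gedge d (Up, i, m) \<subseteq> cface d j n"
    using zc_bounds[where d = d and j = j]
    by (auto simp: Lp_coord[OF assms(1)] Lp_coord Rp_coord cface_def add_divide_distrib)
qed

lemma gedge_Dn_cface:
  assumes "1 \<le> i" "1 \<le> j"
  shows "gedge d (Dn, i, m) \<subseteq> cface d j n \<longleftrightarrow> (i = j \<and> m = n) \<or> (i = Suc j \<and> m = n)"
proof
  assume "gedge d (Dn, i, m) \<subseteq> cface d j n"
  then have L: "(zc d i, of_int m + real i / 2) \<in> cface d j n"
    and R: "(zc d i + 1/2, of_int (m - 1) + (real i + 1) / 2) \<in> cface d j n"
    by (simp_all add: Lp_coord[OF assms(1)] Rp_coord)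
  define u where "u = of_int m + real i / 2 - (of_int n + real j / 2)"
  have L': "\<bar>u\<bar> \<le> 1/2" "zc d j + \<bar>u\<bar> \<le> zc d i" "zc d i \<le> zc d (Suc j) + 1/2 - \<bar>u\<bar>"
    using L by (auto simp: cface_def u_def)
  have "of_int (m - 1) + (real i + 1) / 2 - (of_int n + real j / 2) = u - 1/2"
    by (simp add: u_def add_divide_distrib)
  then have R': "\<bar>u - 1/2\<bar> \<le> 1/2" "zc d j + \<bar>u - 1/2\<bar> \<le> zc d i + 1/2"
    "zc d i + 1/2 \<le> zc d (Suc j) + 1/2 - \<bar>u - 1/2\<bar>"
    using R unfolding cface_def by auto
  define z where "z = 2 * m + int i - 2 * n - int j"
  have z: "2 * u = of_int z" by (simp add: u_def z_def)
  have "z \<noteq> - 1" using z R'(1) by auto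
  then have "z = 0 \<or> z = 1" using half_int_cases[OF z L'(1)] by auto
  moreover have "real i < real j + 2" "real j < real i + 1"
    using calculation z L' R' zc_bounds[where d = d and j = i] zc_bounds[where d = d and j = j] by auto
  then have "i < j + 2" "j \<le> i" by linarith+
  ultimately show "(i = j \<and> m = n) \<or> (i = Suc j \<and> m = n)" unfolding z_def by presburger
next
  assume "(i = j \<and> m = n) \<or> (i = Suc j \<and> m = n)"
  then show "gedge d (Dn, i, m) \<subseteq> cface d j n"
    using zc_bounds[where d = d and j = j]
    by (auto simp: Lp_coord[OF assms(1)] Lp_coord Rp_coord cface_def add_divide_distrib)
qed

lemma gedge_Hz_cface:
  assumes "1 \<le> i" "1 \<le> j"
  shows "gedge d (Hz, i, m) \<subseteq> cface d j n \<longleftrightarrow>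
    (i = j \<and> \<not> primed d j \<or> i = Suc j \<and> primed d (Suc j)) \<and> (m = n \<or> m = n - 1)"
    (is "?l \<longleftrightarrow> ?r")
proof (cases "primed d i")
  case False
  define u where "u = of_int m + (real i + 1) / 2 - (of_int n + real j / 2)"
  have iff: "?l \<longleftrightarrow> \<bar>u\<bar> \<le> 1/2 \<and> zc d j + \<bar>u\<bar> \<le> 3/2 * real i - 1 \<and>
    3/2 * real i \<le> zc d (Suc j) + 1/2 - \<bar>u\<bar>"
    using False by (auto simp: Vp_def Wp_def cface_def u_def)
  show ?thesis
  proof
    assume ?l
    then have *: "\<bar>u\<bar> \<le> 1/2" "zc d j + \<bar>u\<bar> \<le> 3/2 * real i - 1"
      "3/2 * real i \<le> zc d (Suc j) + 1/2 - \<bar>u\<bar>" using iff by auto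
    define z where "z = 2 * m + int i + 1 - 2 * n - int j"
    have z: "2 * u = of_int z" by (simp add: u_def z_def add_divide_distrib)
    have zz: "z = - 1 \<or> z = 0 \<or> z = 1" using half_int_cases[OF z *(1)] .
    have "real i < real j + 2" "real j < real i + 1"
      using * zc_bounds[where d = d and j = j] by auto
    then have ij: "i < j + 2" "j \<le> i" by linarith+
    have "i \<noteq> Suc j" using * False by (auto simp: zc_def add_divide_distrib)
    then have "i = j" using ij by auto
    then show ?r using False zz unfolding z_def by presburger
  next
    assume r: ?r
    then have "i = j" "m = n \<or> m = n - 1" using False by auto
    then have "\<bar>u\<bar> = 1/2" by (auto simp: u_def add_divide_distrib)
    then show ?l unfolding iff using zc_bounds[where d = d and j = j] False \<open>i = j\<close> by (auto simp: zc_def)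
  qed
next
  case True
  define u where "u = of_int m + real i / 2 - (of_int n + real j / 2)"
  obtain i' where i': "i = Suc i'" using assms by (cases i) auto
  have ends: "Vp (i - 1) m = (3/2 * real i - 3/2, of_int m + real i / 2)"
    "Wp d i m = (3/2 * real i - 1/2, of_int m + real i / 2)"
    using True by (simp_all add: Vp_def Wp_def i' add_divide_distrib)
  have iff: "?l \<longleftrightarrow> \<bar>u\<bar> \<le> 1/2 \<and> zc d j + \<bar>u\<bar> \<le> 3/2 * real i - 3/2 \<and>
    3/2 * real i - 1/2 \<le> zc d (Suc j) + 1/2 - \<bar>u\<bar>"
    unfolding gedge.simps ends using True by (auto simp: cface_def u_def)
  show ?thesis
  proof
    assume ?l
    then have *: "\<bar>u\<bar> \<le> 1/2" "zc d j + \<bar>u\<bar> \<le> 3/2 * real i - 3/2"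
      "3/2 * real i - 1/2 \<le> zc d (Suc j) + 1/2 - \<bar>u\<bar>" using iff by auto
    define z where "z = 2 * m + int i - 2 * n - int j"
    have z: "2 * u = of_int z" by (simp add: u_def z_def add_divide_distrib)
    have zz: "z = - 1 \<or> z = 0 \<or> z = 1" using half_int_cases[OF z *(1)] .
    have "real i < real j + 2" "real j < real i + 1"
      using * zc_bounds[where d = d and j = j] by auto
    then have ij: "i < j + 2" "j \<le> i" by linarith+
    have "i \<noteq> j" using * True by (auto simp: zc_def add_divide_distrib)
    then have "i = Suc j" using ij by auto
    then show ?r using True zz unfolding z_def by presburger
  next
    assume r: ?r
    then have "i = Suc j" "m = n \<or> m = n - 1" using True by auto
    then have "\<bar>u\<bar> = 1/2" by (auto simp: u_def add_divide_distrib)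
    then show ?l unfolding iff using zc_bounds[where d = d and j = j] True \<open>i = Suc j\<close>
      by (auto simp: zc_def add_divide_distrib)
  qed
qed

lemma border_face:
  assumes "1 \<le> j" "j < k"
  shows "border k d (face d j n) = gedge d ` Bd d j n"
proof -
  have sub: "Bd d j n \<subseteq> Idx k" using assms by (auto simp: Bd_def Idx_def)
  have "gedge d (e, i, m) \<subseteq> cface d j n \<longleftrightarrow> (e, i, m) \<in> Bd d j n" if "1 \<le> i" for e i m
    using gedge_Up_cface[OF that assms(1), of d m n] gedge_Dn_cface[OF that assms(1), of d m n]
      gedge_Hz_cface[OF that assms(1), of d m n]
    by (cases e) (auto simp: Bd_def simp del: gedge.simps)
  then show ?thesis
    unfolding border_eq_subset_cface edges_eq using sub
    by (force simp: Idx_def simp del: gedge.simps)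
qed

section \<open>Height functions\<close>

text \<open>The level \<open>Yord d j\<close> as an index: \<open>Vp j n\<close> lies below it
  exactly when \<open>n < yy d j\<close>, and it is the ordinate of the centre of face
  \<open>yy d j\<close>.\<close>

fun yy :: "(nat \<Rightarrow> diamond) \<Rightarrow> nat \<Rightarrow> int" where
  "yy d 0 = 0"
| "yy d (Suc j) = (if d (Suc j) \<in> {Prec, Succ'} then yy d j else yy d j - 1)"

lemma Yord_eq: "Yord d j = of_int (yy d j) + real j / 2"
  by (induction j) (auto simp: add_divide_distrib)

fun ss :: "(nat \<Rightarrow> diamond) \<Rightarrow> nat \<Rightarrow> int" where
  "ss d 0 = 0"
| "ss d (Suc j) = ss d j - (if d (Suc j) = Prec then 1 else 0)"

type_synonym height = "nat \<Rightarrow> int \<Rightarrow> int"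

text \<open>The height \<open>G j n\<close> belongs to the face between the vertices \<open>Vp j (n - 1)\<close> and \<open>Vp j n\<close>, and
  \<open>val d G\<close> is the indicator of the matching: on each edge it is the difference of the heights of
  the two adjacent faces, up to a constant. The shift \<open>ss\<close> makes these constants depend on
  \<open>primed\<close> only.\<close>

definition G0 :: "(nat \<Rightarrow> diamond) \<Rightarrow> height" where
  "G0 d j n = max 0 (yy d j - n) + ss d j"

fun val :: "(nat \<Rightarrow> diamond) \<Rightarrow> height \<Rightarrow> ekind \<times> nat \<times> int \<Rightarrow> int" where
  "val d G (Up, j, n) =
    (if primed d j then G j n - G (j - 1) (n + 1) else G (j - 1) (n + 1) - G j n)"
| "val d G (Dn, j, n) =
    (if primed d j then G (j - 1) n - G j n else G j n - G (j - 1) n + 1)"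
| "val d G (Hz, j, n) =
    (if primed d j then 1 - G (j - 1) n + G (j - 1) (n + 1) else G j n - G j (n + 1))"

definition valid :: "nat \<Rightarrow> (nat \<Rightarrow> diamond) \<Rightarrow> height \<Rightarrow> bool" where
  "valid k d G \<longleftrightarrow> (\<forall>i\<in>Idx k. val d G i \<in> {0, 1}) \<and>
     (\<forall>j n. j = 0 \<or> k \<le> j \<longrightarrow> G j n = G0 d j n) \<and> finite {(j, n). G j n \<noteq> G0 d j n}"

lemma validD:
  assumes "valid k d G" "1 \<le> j" "j \<le> k"
  shows "val d G (e, j, n) = 0 \<or> val d G (e, j, n) = 1"
  using assms by (auto simp: valid_def Idx_def)

lemma valid_G0: "valid k d (G0 d)"
proof -
  have "val d (G0 d) (e, Suc j, n) \<in> {0, 1}" for e j n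
    by (cases e; cases "d (Suc j)") (auto simp: primed_iff G0_def)
  then have "val d (G0 d) (e, j, n) \<in> {0, 1}" if "1 \<le> j" for e j n
    using that by (cases j) auto
  then show ?thesis by (auto simp: valid_def Idx_def simp del: val.simps)
qed

lemma G0_col: "G0 d j n - G0 d j (n + 1) = of_bool (n < yy d j)"
  by (auto simp: G0_def)

text \<open>In an inner column the values on the edges to the left of \<open>Vp j n\<close> add up
  to this difference and those to the right to one minus it, and both sums are nonnegative. In the
  outer columns \<open>G\<close> is \<open>G0\<close>.\<close>

lemma valid_col:
  assumes "valid k d G" "j \<le> k"
  shows "G j n - G j (n + 1) = 0 \<or> G j n - G j (n + 1) = 1"
proof (cases "j = 0 \<or> k \<le> j")
  case True
  then show ?thesis using assms G0_col[of d j n] by (auto simp: valid_def)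
next
  case False
  then have j: "1 \<le> j" "j \<le> k" "1 \<le> Suc j" "Suc j \<le> k" by auto
  show ?thesis
    using validD[OF assms(1) j(1,2), of Hz n] validD[OF assms(1) j(1,2), of Up n]
      validD[OF assms(1) j(1,2), of Dn "n + 1"] validD[OF assms(1) j(3,4), of Hz n]
      validD[OF assms(1) j(3,4), of Up n] validD[OF assms(1) j(3,4), of Dn n]
    by (cases "primed d j"; cases "primed d (Suc j)") (simp; linarith)+
qed

definition upd :: "height \<Rightarrow> nat \<Rightarrow> int \<Rightarrow> int \<Rightarrow> height" where
  "upd G j n s = G(j := (G j)(n := G j n + s))"

lemma upd_apply: "upd G j n s i m = G i m + (if i = j \<and> m = n then s else 0)"
  by (simp add: upd_def)

lemma finite_upd:
  assumes "finite {(j, n). G j n \<noteq> G0 d j n}"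
  shows "finite {(i, m). upd G j n s i m \<noteq> G0 d i m}"
  by (rule finite_subset[of _ "insert (j, n) {(j, n). G j n \<noteq> G0 d j n}"])
    (use assms in \<open>auto simp: upd_apply split: if_splits\<close>)

section \<open>Matchings from height functions, and flips\<close>

definition Psi :: "nat \<Rightarrow> (nat \<Rightarrow> diamond) \<Rightarrow> height \<Rightarrow> point set set" where
  "Psi k d G = gedge d ` {i \<in> Idx k. val d G i = 1}"

lemma gedge_in_Psi: "i \<in> Idx k \<Longrightarrow> gedge d i \<in> Psi k d G \<longleftrightarrow> val d G i = 1"
  using gedge_inj[of d k] by (auto simp: Psi_def inj_on_def)

text \<open>The heights in column 0 are prescribed, and the values on the \<open>Dn\<close> edges
  carry equality from each column to the next.\<close>

lemma Psi_inj:
  assumes "valid k d G" "valid k d G'" "Psi k d G = Psi k d G'"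
  shows "G = G'"
proof -
  have eq: "val d G (e, j, n) = val d G' (e, j, n)" if "1 \<le> j" "j \<le> k" for e j n
    using validD[OF assms(1) that, of e n] validD[OF assms(2) that, of e n]
      gedge_in_Psi[of "(e, j, n)" k d G] gedge_in_Psi[of "(e, j, n)" k d G'] assms(3) that
    by (auto simp: Idx_def simp del: val.simps gedge.simps)
  have "G j n = G' j n" if "j \<le> k" for j n
    using that
  proof (induction j arbitrary: n)
    case 0
    then show ?case using assms(1,2) by (simp add: valid_def)
  next
    case (Suc j)
    then show ?case using eq[of "Suc j" Dn n] by (auto split: if_splits)
  qed
  moreover have "G j n = G' j n" if "k < j" for j n
    using assms(1,2) that by (simp add: valid_def)
  ultimately show ?thesis by (metis ext linorder_not_less)
qed

text \<open>The two perfect matchings of the border of a face: incrementing the height of the face adds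
  the edges of \<open>Bp\<close> and removes those of \<open>Bm\<close>.\<close>

definition Bp :: "(nat \<Rightarrow> diamond) \<Rightarrow> nat \<Rightarrow> int \<Rightarrow> (ekind \<times> nat \<times> int) set" where
  "Bp d j n = (if primed d j then {(Up, j, n)} else {(Dn, j, n), (Hz, j, n)}) \<union>
    (if primed d (Suc j) then {(Dn, Suc j, n), (Hz, Suc j, n - 1)} else {(Up, Suc j, n - 1)})"

definition Bm :: "(nat \<Rightarrow> diamond) \<Rightarrow> nat \<Rightarrow> int \<Rightarrow> (ekind \<times> nat \<times> int) set" where
  "Bm d j n = (if primed d j then {(Dn, j, n)} else {(Up, j, n), (Hz, j, n - 1)}) \<union>
    (if primed d (Suc j) then {(Up, Suc j, n - 1), (Hz, Suc j, n)} else {(Dn, Suc j, n)})"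

lemma Bd_eq: "Bd d j n = Bp d j n \<union> Bm d j n" and Bp_Bm_disjoint: "Bp d j n \<inter> Bm d j n = {}"
  and finite_Bp: "finite (Bp d j n)" and finite_Bm: "finite (Bm d j n)"
  and card_Bp: "card (Bp d j n) = card (Bm d j n)"
  by (auto simp: Bd_def Bp_def Bm_def)

lemma val_upd_at:
  assumes "1 \<le> i" "1 \<le> j"
  shows "val d (upd G j n s) (e, i, m) = val d G (e, i, m) +
    (if (e, i, m) \<in> Bp d j n then s else 0) - (if (e, i, m) \<in> Bm d j n then s else 0)"
proof -
  obtain i' where "i = Suc i'" using assms by (cases i) auto
  then show ?thesis using assms
    by (cases e) (auto simp: upd_apply Bp_def Bm_def)
qed

lemma val_upd:
  assumes "i \<in> Idx k" "1 \<le> j"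
  shows "val d (upd G j n s) i = val d G i +
    (if i \<in> Bp d j n then s else 0) - (if i \<in> Bm d j n then s else 0)"
proof -
  obtain e h m where "i = (e, h, m)" by (cases i)
  then show ?thesis using assms val_upd_at[of h j d G n s e m] by (simp add: Idx_def)
qed

text \<open>The increments are matched to the weights 4 and 2 of the potential in
  \<open>ex_decrement\<close>: crossing a blocking zigzag edge raises the potential by 1 or 3,
  crossing a blocking horizontal edge by 2.\<close>

fun bb :: "(nat \<Rightarrow> diamond) \<Rightarrow> nat \<Rightarrow> int" where
  "bb d 0 = 0"
| "bb d (Suc j) = bb d j + (if primed d (Suc j) then 1 else 3)"

text \<open>If decrementing \<open>G\<close> at a face with \<open>G > G'\<close> violates a constraint, that constraint leads to
  an adjacent face where again \<open>G > G'\<close>, and where the potential \<open>4 G + 2 n + bb\<close> is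
  larger. So a face maximising the potential can be decremented.\<close>

lemma ex_decrement:
  assumes v: "valid k d G" and v': "valid k d G'" and less: "G' j0 n0 < G j0 n0"
  shows "\<exists>j n. 1 \<le> j \<and> j < k \<and> G' j n < G j n \<and> valid k d (upd G j n (- 1))"
proof -
  define A where "A = {(j, n). G' j n < G j n}"
  define P where "P = (\<lambda>(j, n). 4 * G j n + 2 * n + bb d j)"
  have "A \<subseteq> {(j, n). G j n \<noteq> G0 d j n} \<union> {(j, n). G' j n \<noteq> G0 d j n}" by (auto simp: A_def)
  then have fin: "finite A" using v v' finite_subset by (fastforce simp: valid_def)
  have ne: "A \<noteq> {}" using less by (auto simp: A_def)
  have "Max (P ` A) \<in> P ` A" using fin ne by simp
  then obtain f where f: "f \<in> A" "P f = Max (P ` A)" by auto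
  obtain j n where jn: "f = (j, n)" by force
  have max: "4 * G i m + 2 * m + bb d i \<le> 4 * G j n + 2 * n + bb d j" if "G' i m < G i m" for i m
  proof -
    have "P (i, m) \<le> P f" unfolding f(2) using fin that by (intro Max_ge) (auto simp: A_def)
    then show ?thesis by (simp add: P_def jn)
  qed
  have less': "G' j n < G j n" using f by (simp add: A_def jn)
  then have j: "1 \<le> j" "j < k"
    using v v' by (auto simp: valid_def Suc_le_eq intro!: gr0I) (metis linorder_not_less order_less_irrefl)
  obtain i where i: "j = Suc i" using j by (cases j) auto
  have k: "j \<le> k" "1 \<le> Suc j" "Suc j \<le> k" using j by auto
  have ran: "0 \<le> val d H (e, h, m)" "val d H (e, h, m) \<le> 1"
    if "valid k d H" "1 \<le> h" "h \<le> k" for H e h m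
    using validD[OF that, of e m] by auto
  note B = ran[OF v j(1) k(1)] ran[OF v k(2,3)] and B' = ran[OF v' j(1) k(1)] ran[OF v' k(2,3)]
  \<comment> \<open>A decrement lowers the values on \<open>Bp\<close> and raises those on
    \<open>Bm\<close>, so it is blocked by a 0 on \<open>Bp\<close> or a 1 on \<open>Bm\<close>.
    There \<open>G\<close> attains the extreme height difference allowed across the edge, while
    \<open>G'\<close> stays within the same bounds, so the excess of \<open>G\<close> over
    \<open>G'\<close> persists at the neighbouring face, against maximality.\<close>
  have plus: "val d G f = 1" if f: "f \<in> Bp d j n" for f
  proof -
    consider "primed d j" "f = (Up, j, n)" | "\<not> primed d j" "f = (Dn, j, n)"
      | "\<not> primed d j" "f = (Hz, j, n)" | "primed d (Suc j)" "f = (Dn, Suc j, n)"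
      | "primed d (Suc j)" "f = (Hz, Suc j, n - 1)" | "\<not> primed d (Suc j)" "f = (Up, Suc j, n - 1)"
      using f by (auto simp: Bp_def split: if_splits)
    then show ?thesis
    proof cases
      case 1
      then show ?thesis using max[of i "n + 1"] B(1,2)[of Up n] B'(1,2)[of Up n] less'
        by (simp add: i) presburger
    next
      case 2
      then show ?thesis using max[of i n] B(1,2)[of Dn n] B'(1,2)[of Dn n] less'
        by (simp add: i) presburger
    next
      case 3
      then show ?thesis using max[of j "n + 1"] B(1,2)[of Hz n] B'(1,2)[of Hz n] less'
        by simp presburger
    next
      case 4
      then show ?thesis using max[of "Suc j" n] B(3,4)[of Dn n] B'(3,4)[of Dn n] less'
        by simp presburger
    next
      case 5
      then show ?thesis using max[of j "n - 1"] B(3,4)[of Hz "n - 1"] B'(3,4)[of Hz "n - 1"] less'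
        by simp presburger
    next
      case 6
      then show ?thesis
        using max[of "Suc j" "n - 1"] B(3,4)[of Up "n - 1"] B'(3,4)[of Up "n - 1"] less'
        by simp presburger
    qed
  qed
  have minus: "val d G f = 0" if f: "f \<in> Bm d j n" for f
  proof -
    consider "primed d j" "f = (Dn, j, n)" | "\<not> primed d j" "f = (Up, j, n)"
      | "\<not> primed d j" "f = (Hz, j, n - 1)" | "primed d (Suc j)" "f = (Up, Suc j, n - 1)"
      | "primed d (Suc j)" "f = (Hz, Suc j, n)" | "\<not> primed d (Suc j)" "f = (Dn, Suc j, n)"
      using f by (auto simp: Bm_def split: if_splits)
    then show ?thesis
    proof cases
      case 1
      then show ?thesis using max[of i n] B(1,2)[of Dn n] B'(1,2)[of Dn n] less'
        by (simp add: i) presburger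
    next
      case 2
      then show ?thesis using max[of i "n + 1"] B(1,2)[of Up n] B'(1,2)[of Up n] less'
        by (simp add: i) presburger
    next
      case 3
      then show ?thesis using max[of j "n - 1"] B(1,2)[of Hz "n - 1"] B'(1,2)[of Hz "n - 1"] less'
        by simp presburger
    next
      case 4
      then show ?thesis
        using max[of "Suc j" "n - 1"] B(3,4)[of Up "n - 1"] B'(3,4)[of Up "n - 1"] less'
        by simp presburger
    next
      case 5
      then show ?thesis using max[of j "n + 1"] B(3,4)[of Hz n] B'(3,4)[of Hz n] less'
        by simp presburger
    next
      case 6
      then show ?thesis using max[of "Suc j" n] B(3,4)[of Dn n] B'(3,4)[of Dn n] less'
        by simp presburger
    qed
  qed
  have "val d (upd G j n (- 1)) (e, h, m) \<in> {0, 1}" if "1 \<le> h" "h \<le> k" for e h m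
    unfolding val_upd_at[OF that(1) j(1)]
    using plus[of "(e, h, m)"] minus[of "(e, h, m)"] validD[OF v that, of e m] Bp_Bm_disjoint[of d j n]
    by (auto simp del: val.simps)
  moreover have "finite {(i, m). upd G j n (- 1) i m \<noteq> G0 d i m}"
    by (rule finite_upd) (use v in \<open>simp add: valid_def\<close>)
  ultimately have "valid k d (upd G j n (- 1))"
    using v j by (auto simp: valid_def Idx_def upd_apply simp del: val.simps)
  then show ?thesis using j less' by blast
qed

text \<open>\<open>ex_decrement\<close> with the roles exchanged would decrement \<open>G0\<close>
  somewhere. This is impossible: a decrement at \<open>m\<close> raises the column difference at
  \<open>m - 1\<close>, which is already 1 if \<open>m <= yy d i\<close>, and lowers the one at
  \<open>m\<close>, which is already 0 if \<open>m >= yy d i\<close>.\<close>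

lemma valid_ge_G0:
  assumes "valid k d G"
  shows "G0 d j n \<le> G j n"
proof (rule ccontr)
  assume "\<not> G0 d j n \<le> G j n"
  then obtain i m where im: "1 \<le> i" "i < k" "valid k d (upd (G0 d) i m (- 1))"
    using ex_decrement[OF valid_G0 assms, of j n] by auto
  show False
    using valid_col[OF im(3), of i m] valid_col[OF im(3), of i "m - 1"] im(2)
      G0_col[of d i m] G0_col[of d i "m - 1"]
    by (auto simp: upd_apply of_bool_def split: if_splits)
qed

definition area :: "(nat \<Rightarrow> diamond) \<Rightarrow> height \<Rightarrow> nat" where
  "area d G = (\<Sum>(j, n)\<in>{(j, n). G j n \<noteq> G0 d j n}. nat (G j n - G0 d j n))"

lemma area_superset:
  assumes "finite A" "{(j, n). G j n \<noteq> G0 d j n} \<subseteq> A"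
  shows "area d G = (\<Sum>(j, n)\<in>A. nat (G j n - G0 d j n))"
  unfolding area_def using assms by (intro sum.mono_neutral_left) auto

lemma area_upd:
  assumes "valid k d G"
  shows "area d (upd G j n 1) = area d G + 1"
proof -
  define A where "A = insert (j, n) {(j, n). G j n \<noteq> G0 d j n}"
  have fin: "finite A" using assms by (simp add: A_def valid_def)
  have "area d (upd G j n 1) = (\<Sum>(i, m)\<in>A. nat (upd G j n 1 i m - G0 d i m))"
    by (rule area_superset[OF fin]) (auto simp: A_def upd_apply split: if_splits)
  also have "\<dots> = (\<Sum>(i, m)\<in>A. nat (G i m - G0 d i m) + (if (i, m) = (j, n) then 1 else 0))"
    using valid_ge_G0[OF assms] by (intro sum.cong) (auto simp: upd_apply nat_add_distrib diff_add_eq[symmetric])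
  also have "\<dots> = area d G + (\<Sum>f\<in>A. if f = (j, n) then 1 else 0)"
    using area_superset[OF fin, of G d] by (simp add: sum.distrib case_prod_beta A_def subset_insertI prod_eq_iff)
  also have "\<dots> = area d G + 1" using fin by (simp add: A_def)
  finally show ?thesis .
qed

lemma upd_upd: "upd (upd G j n s) j n (- s) = G" "upd (upd G j n (- s)) j n s = G"
  by (auto simp: upd_def)

text \<open>Repeated decrements lower the area and can only stop at \<open>G0\<close>. Read
  backwards, they give a sequence of exactly \<open>area d G\<close> upward flips.\<close>

lemma valid_induct [consumes 1, case_names base step]:
  assumes "valid k d G" and base: "Q (G0 d)"
    and step: "\<And>G j n. valid k d G \<Longrightarrow> 1 \<le> j \<Longrightarrow> j < k \<Longrightarrow> valid k d (upd G j n 1) \<Longrightarrow> Q G \<Longrightarrow>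
      Q (upd G j n 1)"
  shows "Q G"
  using assms(1)
proof (induction "area d G" arbitrary: G rule: less_induct)
  case less
  show ?case
  proof (cases "G = G0 d")
    case True
    then show ?thesis using base by simp
  next
    case False
    then obtain i m where "G i m \<noteq> G0 d i m" by (auto simp: fun_eq_iff)
    then have "G0 d i m < G i m" using valid_ge_G0[OF less.prems, of i m] by simp
    then obtain j n where jn: "1 \<le> j" "j < k" "valid k d (upd G j n (- 1))"
      using ex_decrement[OF less.prems valid_G0] by blast
    let ?H = "upd G j n (- 1)"
    have G: "upd ?H j n 1 = G" by (rule upd_upd)
    have "area d G = area d ?H + 1" using area_upd[OF jn(3), of j n] G by simp
    then have "Q ?H" using less.hyps jn(3) by simp
    then show ?thesis using step[OF jn(3,1,2), of n] G less.prems by simp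
  qed
qed

section \<open>Which flips a matching admits\<close>

lemma adjacent_vals:
  assumes "valid k d G" "1 \<le> i" "i \<le> k"
  shows "val d G (Up, i, n) + val d G (Dn, i, n) \<le> 1" (is ?a)
    and "val d G (Up, i, n) + val d G (Dn, i, n + 1) \<le> 1" (is ?b)
    and "val d G (Up, i, n) + val d G (Hz, i, n) \<le> 1" (is ?c)
    and "val d G (Dn, i, if primed d i then n else n + 1) + val d G (Hz, i, n) \<le> 1" (is ?d)
proof -
  obtain j where j: "i = Suc j" using assms(2) by (cases i) auto
  note f = valid_col[OF assms(1,3), of n] valid_col[OF assms(1), of j n]
    validD[OF assms, of Up n] validD[OF assms, of Dn n] validD[OF assms, of Dn "n + 1"]
  show ?a using f(2) assms(3) by (cases "primed d i") (auto simp: j)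
  show ?b using f(1) by (cases "primed d i") (auto simp: j)
  show ?c using f(3,4,5) by (cases "primed d i") (simp add: j; linarith)+
  show ?d using f(3,4,5) by (cases "primed d i") (simp add: j; linarith)+
qed

lemma adjacent_vals_col:
  assumes "valid k d G" "1 \<le> j" "j \<le> k" "1 \<le> Suc j" "Suc j \<le> k"
  shows "primed d j \<Longrightarrow> primed d (Suc j) \<Longrightarrow> val d G (Up, j, n) + val d G (Hz, Suc j, n) \<le> 1"
    and "primed d j \<Longrightarrow> primed d (Suc j) \<Longrightarrow> val d G (Dn, j, n + 1) + val d G (Hz, Suc j, n) \<le> 1"
    and "primed d j \<Longrightarrow> \<not> primed d (Suc j) \<Longrightarrow> val d G (Up, j, n) + val d G (Dn, Suc j, n) \<le> 1"
    and "primed d j \<Longrightarrow> \<not> primed d (Suc j) \<Longrightarrow> val d G (Dn, j, n + 1) + val d G (Up, Suc j, n) \<le> 1"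
    and "\<not> primed d j \<Longrightarrow> primed d (Suc j) \<Longrightarrow> val d G (Hz, j, n) + val d G (Hz, Suc j, n) \<le> 1"
    and "\<not> primed d j \<Longrightarrow> \<not> primed d (Suc j) \<Longrightarrow> val d G (Hz, j, n) + val d G (Up, Suc j, n) \<le> 1"
    and "\<not> primed d j \<Longrightarrow> \<not> primed d (Suc j) \<Longrightarrow> val d G (Hz, j, n) + val d G (Dn, Suc j, n) \<le> 1"
  using validD[OF assms(1-3), of Up n] validD[OF assms(1-3), of Dn "n + 1"]
    validD[OF assms(1,4,5), of Up n] validD[OF assms(1,4,5), of Dn n]
  by (simp; linarith)+

text \<open>Going round the border, two consecutive values add up to at most 1 because the edges
  share a vertex. A cycle of \<open>2 p\<close> values with sum \<open>p\<close> therefore has every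
  consecutive sum equal to 1, and the value of one edge determines all the others.\<close>

lemma border_alternates:
  assumes v: "valid k d G" and j: "1 \<le> j" "j < k"
    and sum: "(\<Sum>i\<in>Bd d j n. val d G i) = int (card (Bp d j n))"
  shows "(\<forall>i\<in>Bp d j n. val d G i = 0) \<and> (\<forall>i\<in>Bm d j n. val d G i = 1) \<or>
    (\<forall>i\<in>Bp d j n. val d G i = 1) \<and> (\<forall>i\<in>Bm d j n. val d G i = 0)"
proof -
  have k: "j \<le> k" "1 \<le> Suc j" "Suc j \<le> k" using j by auto
  define u1 d1 h1 h1' where "u1 = val d G (Up, j, n)" and "d1 = val d G (Dn, j, n)"
    and "h1 = val d G (Hz, j, n)" and "h1' = val d G (Hz, j, n - 1)"
  define u2 d2 h2 h2' where "u2 = val d G (Up, Suc j, n - 1)" and "d2 = val d G (Dn, Suc j, n)"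
    and "h2 = val d G (Hz, Suc j, n)" and "h2' = val d G (Hz, Suc j, n - 1)"
  note defs = u1_def d1_def h1_def h1'_def u2_def d2_def h2_def h2'_def
  have u1: "0 \<le> u1" "u1 \<le> 1"
    using validD[OF v j(1) k(1), of Up n] by (auto simp: defs)
  have c: "u1 + d1 \<le> 1" "u1 + h1 \<le> 1" "u2 + d2 \<le> 1" "u2 + h2' \<le> 1"
    using adjacent_vals(1)[OF v j(1) k(1), of n] adjacent_vals(3)[OF v j(1) k(1), of n]
      adjacent_vals(2)[OF v k(2,3), of "n - 1"] adjacent_vals(3)[OF v k(2,3), of "n - 1"]
    by (simp_all add: defs)
  have c1: "d1 + h1' \<le> 1" if "\<not> primed d j"
    using adjacent_vals(4)[OF v j(1) k(1), of "n - 1"] that by (simp add: defs)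
  have c2: "d2 + h2 \<le> 1" if "primed d (Suc j)"
    using adjacent_vals(4)[OF v k(2,3), of n] that by (simp add: defs)
  note m = adjacent_vals_col[OF v j(1) k, of n] adjacent_vals_col[OF v j(1) k, of "n - 1"]
  show ?thesis
  proof (cases "primed d j"; cases "primed d (Suc j)")
    assume p: "primed d j" "primed d (Suc j)"
    have "u1 + h2 \<le> 1" "d1 + h2' \<le> 1" using m p by (simp_all add: defs)
    moreover have "u1 + d2 + h2' + d1 + u2 + h2 = 3"
      using sum p by (simp add: Bd_def Bp_def defs add_ac del: val.simps)
    ultimately have "h2 = 1 - u1" "d2 = u1" "u2 = 1 - u1" "h2' = u1" "d1 = 1 - u1"
      using c c2[OF p(2)] p by linarith+
    then show ?thesis
      using u1 p by (auto simp add: Bp_def Bm_def defs simp del: val.simps)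
  next
    assume p: "primed d j" "\<not> primed d (Suc j)"
    have "u1 + d2 \<le> 1" "d1 + u2 \<le> 1" using m p by (simp_all add: defs)
    moreover have "u1 + d1 + u2 + d2 = 2"
      using sum p by (simp add: Bd_def Bp_def defs add_ac del: val.simps)
    ultimately have "d2 = 1 - u1" "u2 = u1" "d1 = 1 - u1"
      using c p by linarith+
    then show ?thesis
      using u1 p by (auto simp add: Bp_def Bm_def defs simp del: val.simps)
  next
    assume p: "\<not> primed d j" "primed d (Suc j)"
    have "h1 + h2 \<le> 1" "h1' + h2' \<le> 1" using m p by (simp_all add: defs)
    moreover have "u1 + h2 + u2 + h1' + h1 + d2 + h2' + d1 = 4"
      using sum p by (simp add: Bd_def Bp_def defs add_ac del: val.simps)
    ultimately have "h1 = 1 - u1" "h2 = u1" "d2 = 1 - u1" "u2 = u1" "h2' = 1 - u1" "h1' = u1" "d1 = 1 - u1"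
      using c c1[OF p(1)] c2[OF p(2)] p by linarith+
    then show ?thesis
      using u1 p by (auto simp add: Bp_def Bm_def defs simp del: val.simps)
  next
    assume p: "\<not> primed d j" "\<not> primed d (Suc j)"
    have "h1 + d2 \<le> 1" "h1' + u2 \<le> 1" using m p by (simp_all add: defs)
    moreover have "u1 + d2 + h1' + h1 + u2 + d1 = 3"
      using sum p by (simp add: Bd_def Bp_def defs add_ac del: val.simps)
    ultimately have "h1 = 1 - u1" "d2 = u1" "u2 = 1 - u1" "h1' = u1" "d1 = 1 - u1"
      using c c1[OF p(1)] p by linarith+
    then show ?thesis
      using u1 p by (auto simp add: Bp_def Bm_def defs simp del: val.simps)
  qed
qed

lemma flip_Psi_iff:
  assumes v: "valid k d G" and k: "1 \<le> k"
  shows "flip k d (Psi k d G) M \<longleftrightarrow> (\<exists>j n s. 1 \<le> j \<and> j < k \<and> s \<in> {1, - 1} \<and>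
    valid k d (upd G j n s) \<and> M = Psi k d (upd G j n s))"
proof -
  \<comment> \<open>The border has equally many edges in \<open>Bp\<close> and in \<open>Bm\<close>,
    which fixes \<open>p\<close>; what is left of the flip condition is the sum of the
    values.\<close>
  have *: "(finite (border k d (face d j n)) \<and> card (border k d (face d j n)) = 2 * p \<and>
      card (border k d (face d j n) \<inter> Psi k d G) = p) \<longleftrightarrow>
      p = card (Bp d j n) \<and> (\<Sum>i\<in>Bd d j n. val d G i) = int p" (is "?l \<longleftrightarrow> ?r")
    if j: "1 \<le> j" "j < k" for j n p
  proof -
    have sub: "Bd d j n \<subseteq> Idx k" using j by (auto simp: Bd_def Idx_def)
    have inj: "inj_on (gedge d) (Bd d j n)" using gedge_inj sub by (rule inj_on_subset)
    have fin: "finite (Bd d j n)" by (simp add: Bd_eq finite_Bp finite_Bm)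
    have "card (gedge d ` Bd d j n) = 2 * card (Bp d j n)"
      by (simp add: card_image[OF inj])
        (simp add: Bd_eq card_Un_disjoint finite_Bp finite_Bm Bp_Bm_disjoint card_Bp)
    moreover have "gedge d ` Bd d j n \<inter> Psi k d G = gedge d ` {i \<in> Bd d j n. val d G i = 1}"
      using gedge_in_Psi sub by auto
    then have "card (gedge d ` Bd d j n \<inter> Psi k d G) = card {i \<in> Bd d j n. val d G i = 1}"
      by (simp add: card_image inj_on_subset[OF inj])
    moreover have "(\<Sum>i\<in>Bd d j n. val d G i) = (\<Sum>i\<in>Bd d j n. if val d G i = 1 then 1 else 0)"
      using v sub by (intro sum.cong) (auto simp: valid_def)
    then have "(\<Sum>i\<in>Bd d j n. val d G i) = int (card {i \<in> Bd d j n. val d G i = 1})"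
      using fin by (simp add: sum.If_cases Int_def)
    ultimately show ?thesis unfolding border_face[OF j] using fin by auto
  qed
  \<comment> \<open>The terms \<open>(1 - s) div 2\<close> and \<open>(1 + s) div 2\<close> encode
    the two alternating patterns: for \<open>s = 1\<close> the matched border edges are those of
    \<open>Bm\<close>, for \<open>s = - 1\<close> those of \<open>Bp\<close>. In either case the
    height change complements all border values.\<close>
  have new: "(Psi k d G - border k d (face d j n)) \<union> (border k d (face d j n) - Psi k d G) =
      Psi k d (upd G j n s) \<and> valid k d (upd G j n s)"
    if j: "1 \<le> j" "j < k" and s: "s \<in> {1, - 1}"
      and alt: "\<forall>i\<in>Bp d j n. val d G i = (1 - s) div 2" "\<forall>i\<in>Bm d j n. val d G i = (1 + s) div 2"
    for j n s
  proof
    have val: "val d (upd G j n s) i = (if i \<in> Bd d j n then 1 - val d G i else val d G i)"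
      if "i \<in> Idx k" for i
      using val_upd[of i k j d G n s] that j s alt Bp_Bm_disjoint[of d j n]
      by (auto simp: Bd_eq)
    have "finite {(i, m). upd G j n s i m \<noteq> G0 d i m}"
      by (rule finite_upd) (use v in \<open>simp add: valid_def\<close>)
    then show "valid k d (upd G j n s)"
      using v val j by (auto simp: valid_def upd_apply)
    have sub: "Bd d j n \<subseteq> Idx k" using j by (auto simp: Bd_def Idx_def)
    have inj: "gedge d i \<in> gedge d ` Bd d j n \<longleftrightarrow> i \<in> Bd d j n" if "i \<in> Idx k" for i
      using gedge_inj[of d k] sub that by (auto simp: inj_on_def)
    have "e \<in> (Psi k d G - gedge d ` Bd d j n) \<union> (gedge d ` Bd d j n - Psi k d G) \<longleftrightarrow>
        e \<in> Psi k d (upd G j n s)" for e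
    proof (cases "e \<in> gedge d ` Idx k")
      case True
      then obtain i where i: "e = gedge d i" "i \<in> Idx k" by auto
      have "val d G i = 0 \<or> val d G i = 1" using v i by (auto simp: valid_def)
      then show ?thesis using i by (auto simp: gedge_in_Psi inj val)
    next
      case False
      then show ?thesis using sub by (auto simp: Psi_def)
    qed
    then show "(Psi k d G - border k d (face d j n)) \<union> (border k d (face d j n) - Psi k d G) =
      Psi k d (upd G j n s)" unfolding border_face[OF j] by blast
  qed
  show ?thesis
  proof
    assume "flip k d (Psi k d G) M"
    then obtain j n p where j: "1 \<le> j" "j < k"
      and fl: "finite (border k d (face d j n))" "card (border k d (face d j n)) = 2 * p"
        "card (border k d (face d j n) \<inter> Psi k d G) = p"
      and M: "M = (Psi k d G - border k d (face d j n)) \<union> (border k d (face d j n) - Psi k d G)"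
      unfolding flip_def bounded_faces_eq[OF k] by blast
    then have sum: "(\<Sum>i\<in>Bd d j n. val d G i) = int (card (Bp d j n))"
      using *[OF j, of n p] by auto
    from border_alternates[OF v j sum] show "\<exists>j n s. 1 \<le> j \<and> j < k \<and> s \<in> {1, - 1} \<and>
      valid k d (upd G j n s) \<and> M = Psi k d (upd G j n s)"
    proof
      assume "(\<forall>i\<in>Bp d j n. val d G i = 0) \<and> (\<forall>i\<in>Bm d j n. val d G i = 1)"
      then show ?thesis using new[OF j, of 1 n] j M by (intro exI[of _ j] exI[of _ n] exI[of _ 1]) auto
    next
      assume "(\<forall>i\<in>Bp d j n. val d G i = 1) \<and> (\<forall>i\<in>Bm d j n. val d G i = 0)"
      then show ?thesis using new[OF j, of "- 1" n] j M
        by (intro exI[of _ j] exI[of _ n] exI[of _ "- 1"]) auto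
    qed
  next
    assume "\<exists>j n s. 1 \<le> j \<and> j < k \<and> s \<in> {1, - 1} \<and>
      valid k d (upd G j n s) \<and> M = Psi k d (upd G j n s)"
    then obtain j n s where j: "1 \<le> j" "j < k" and s: "s \<in> {1, - 1}"
      and v': "valid k d (upd G j n s)" and M: "M = Psi k d (upd G j n s)" by blast
    have sub: "Bp d j n \<subseteq> Idx k" "Bm d j n \<subseteq> Idx k" using j by (auto simp: Bp_def Bm_def Idx_def)
    have vals: "val d G i \<in> {0, 1}" "val d (upd G j n s) i \<in> {0, 1}" if "i \<in> Idx k" for i
      using v v' that by (auto simp: valid_def)
    have alt: "val d G i = (1 - s) div 2" if "i \<in> Bp d j n" for i
    proof -
      have "i \<in> Idx k" "i \<notin> Bm d j n" using that sub Bp_Bm_disjoint[of d j n] by auto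
      then show ?thesis using val_upd[of i k j d G n s] that j s vals[of i] by auto
    qed
    have alt': "val d G i = (1 + s) div 2" if "i \<in> Bm d j n" for i
    proof -
      have "i \<in> Idx k" "i \<notin> Bp d j n" using that sub Bp_Bm_disjoint[of d j n] by auto
      then show ?thesis using val_upd[of i k j d G n s] that j s vals[of i] by auto
    qed
    have "(\<Sum>i\<in>Bd d j n. val d G i) = (\<Sum>i\<in>Bp d j n. val d G i) + (\<Sum>i\<in>Bm d j n. val d G i)"
      by (simp add: Bd_eq sum.union_disjoint finite_Bp finite_Bm Bp_Bm_disjoint)
    also have "\<dots> = int (card (Bp d j n))" using s alt alt' by (auto simp: card_Bp)
    finally have "finite (border k d (face d j n)) \<and> card (border k d (face d j n)) = 2 * card (Bp d j n) \<and>
      card (border k d (face d j n) \<inter> Psi k d G) = card (Bp d j n)" using *[OF j] by simp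
    moreover have "face d j n \<in> bounded_faces k d" using j k by (auto simp: bounded_faces_eq)
    ultimately show "flip k d (Psi k d G) M"
      unfolding flip_def M using new[OF j s, of n] alt alt' by blast
  qed
qed

section \<open>Admissibility and the minimal matching\<close>

definition Winc :: "(nat \<Rightarrow> diamond) \<Rightarrow> nat \<Rightarrow> int \<Rightarrow> (ekind \<times> nat \<times> int) set" where
  "Winc d j n = (if primed d j then {(Up, j, n), (Dn, j, n), (Hz, j, n)}
     else {(Up, j, n), (Dn, j, n + 1), (Hz, j, n)})"

definition Vleft :: "(nat \<Rightarrow> diamond) \<Rightarrow> nat \<Rightarrow> int \<Rightarrow> (ekind \<times> nat \<times> int) set" where
  "Vleft d j n = (if j = 0 then {} else if primed d j then {(Up, j, n), (Dn, j, n + 1)}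
     else {(Hz, j, n)})"

definition Vright :: "nat \<Rightarrow> (nat \<Rightarrow> diamond) \<Rightarrow> nat \<Rightarrow> int \<Rightarrow> (ekind \<times> nat \<times> int) set" where
  "Vright k d j n = (if k \<le> j then {} else if primed d (Suc j) then {(Hz, Suc j, n)}
     else {(Up, Suc j, n), (Dn, Suc j, n)})"

lemma Wp_in_gedge:
  assumes "1 \<le> j" "i \<in> Idx k"
  shows "Wp d j n \<in> gedge d i \<longleftrightarrow> i \<in> Winc d j n"
proof -
  obtain e h m where i: "i = (e, h, m)" by (cases i)
  show ?thesis unfolding i Winc_def by (cases e) (auto simp: Lp_def Rp_def)
qed

lemma Vp_in_gedge:
  assumes "j \<le> k" "i \<in> Idx k"
  shows "Vp j n \<in> gedge d i \<longleftrightarrow> i \<in> Vleft d j n \<union> Vright k d j n"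
proof -
  obtain e h m where i: "i = (e, Suc h, m)" "Suc h \<le> k"
    using assms(2) by (cases i) (auto simp: Idx_def dest: Suc_le_D)
  show ?thesis unfolding i Vleft_def Vright_def using assms(1) i(2)
    by (cases e) (auto simp: Lp_def Rp_def)
qed

lemma inc_subset_Idx:
  "1 \<le> j \<Longrightarrow> j \<le> k \<Longrightarrow> Winc d j n \<subseteq> Idx k" "j \<le> k \<Longrightarrow> Vleft d j n \<subseteq> Idx k"
  "Vright k d j n \<subseteq> Idx k"
  by (auto simp: Winc_def Vleft_def Vright_def Idx_def)

lemma finite_inc [simp]: "finite (Winc d j n)" "finite (Vleft d j n)" "finite (Vright k d j n)"
  by (auto simp: Winc_def Vleft_def Vright_def)

lemma Vleft_Vright_disjoint: "Vleft d j n \<inter> Vright k d j n = {}"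
  by (auto simp: Vleft_def Vright_def)

lemma gedge_vertices:
  assumes "i \<in> Idx k" "v \<in> gedge d i"
  shows "(\<exists>j n. j \<le> k \<and> v = Vp j n) \<or> (\<exists>j n. 1 \<le> j \<and> j \<le> k \<and> v = Wp d j n)"
proof -
  obtain e h m where i: "i = (e, h, m)" "1 \<le> h" "h \<le> k" using assms(1) by (cases i) (auto simp: Idx_def)
  have "h - 1 \<le> k" using i by simp
  then show ?thesis using assms(2) i
    by (cases e) (auto simp: Lp_def Rp_def split: if_splits)
qed

text \<open>Round a vertex the height differences cancel and only the constants in
  \<open>val\<close> remain; these are chosen so that the result is 1.\<close>

lemma val_Winc:
  assumes "1 \<le> j"
  shows "(\<Sum>i\<in>Winc d j n. val d G i) = 1"
  by (simp add: Winc_def)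

lemma val_Vleft:
  assumes "1 \<le> j"
  shows "(\<Sum>i\<in>Vleft d j n. val d G i) = G j n - G j (n + 1)"
  using assms by (simp add: Vleft_def)

lemma val_Vright:
  assumes "j < k"
  shows "(\<Sum>i\<in>Vright k d j n. val d G i) = 1 - (G j n - G j (n + 1))"
  using assms by (simp add: Vright_def)

lemma val_sum_ex:
  assumes "valid k d G" "I \<subseteq> Idx k" "finite I" "(\<Sum>i\<in>I. val d G i) = 1"
  shows "\<exists>!i. i \<in> I \<and> val d G i = 1"
proof -
  have v: "val d G i = 0 \<or> val d G i = 1" if "i \<in> I" for i
    using assms(1,2) that by (auto simp: valid_def)
  have "\<exists>i\<in>I. val d G i \<noteq> 0" using assms(4) by (metis sum.neutral zero_neq_one)
  then obtain i where i: "i \<in> I" "val d G i = 1" using v by blast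
  have "(\<Sum>i\<in>I - {i}. val d G i) = 0" using assms(3,4) i by (simp add: sum.remove)
  then have "\<forall>l\<in>I - {i}. val d G l = 0"
    using v assms(3) by (subst (asm) sum_nonneg_eq_0_iff) force+
  then show ?thesis using i by (intro ex1I[of _ i]) force+
qed

lemma val_sum_nex:
  assumes "valid k d G" "I \<subseteq> Idx k" "finite I" "(\<Sum>i\<in>I. val d G i) = 0" "i \<in> I"
  shows "val d G i = 0"
proof -
  have "0 \<le> val d G i" if "i \<in> I" for i using assms(1,2) that by (fastforce simp: valid_def)
  then show ?thesis using assms(3-5) by (simp add: sum_nonneg_eq_0_iff)
qed

text \<open>In an inner column the two sums add up to exactly 1. In an outer column one side has no
  edges, and the column difference only gives the bound 1: such a vertex may stay uncovered.\<close>

lemma val_Vinc_le: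
  assumes "valid k d G" "j \<le> k" "a \<in> Vleft d j n \<union> Vright k d j n"
    "b \<in> Vleft d j n \<union> Vright k d j n" "val d G a = 1" "val d G b = 1"
  shows "a = b"
proof -
  let ?I = "Vleft d j n \<union> Vright k d j n"
  have v: "val d G i = 0 \<or> val d G i = 1" if "i \<in> ?I" for i
    using assms(1) that inc_subset_Idx(2)[OF assms(2), of d n] inc_subset_Idx(3)[of k d j n]
    by (auto simp: valid_def)
  have "(\<Sum>i\<in>Vleft d j n. val d G i) + (\<Sum>i\<in>Vright k d j n. val d G i) \<le> 1"
  proof -
    consider "j = 0" "k \<le> j" | "j = 0" "j < k" | "1 \<le> j" "k \<le> j" | "1 \<le> j" "j < k" by linarith
    then show ?thesis
    proof cases
      case 2
      then show ?thesis using val_Vright[where j = j and k = k and d = d and n = n and G = G] valid_col[OF assms(1,2), of n]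
        by (auto simp: Vleft_def)
    next
      case 3
      then show ?thesis using val_Vleft[where j = j and d = d and n = n and G = G] valid_col[OF assms(1,2), of n]
        by (auto simp: Vright_def)
    next
      case 4
      then show ?thesis using val_Vleft[where j = j and d = d and n = n and G = G] val_Vright[where j = j and k = k and d = d and n = n and G = G] by simp
    qed (auto simp: Vleft_def Vright_def)
  qed
  then have s: "(\<Sum>i\<in>?I. val d G i) \<le> 1"
    by (simp add: sum.union_disjoint Vleft_Vright_disjoint)
  show ?thesis
  proof (rule ccontr)
    assume "a \<noteq> b"
    then have "(\<Sum>i\<in>{a, b}. val d G i) = 2" using assms by simp
    moreover have "(\<Sum>i\<in>{a, b}. val d G i) \<le> (\<Sum>i\<in>?I. val d G i)"
      using assms v by (intro sum_mono2) force+
    ultimately show False using s by simp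
  qed
qed

lemma matching_Psi:
  assumes v: "valid k d G"
  shows "matching k d (Psi k d G)"
  unfolding matching_def
proof (intro conjI)
  show "Psi k d G \<subseteq> edges k d" by (auto simp: Psi_def edges_eq)
  show "pairwise disjnt (Psi k d G)"
  proof (rule pairwiseI)
    fix e f assume e: "e \<in> Psi k d G" and f: "f \<in> Psi k d G" and ef: "e \<noteq> f"
    obtain a b where a: "e = gedge d a" "a \<in> Idx k" "val d G a = 1"
      and b: "f = gedge d b" "b \<in> Idx k" "val d G b = 1"
      using e f by (auto simp: Psi_def)
    have "a = b" if "x \<in> e" "x \<in> f" for x
    proof -
      from gedge_vertices[OF a(2), of x d] that a consider
          (V) j n where "j \<le> k" "x = Vp j n" | (W) j n where "1 \<le> j" "j \<le> k" "x = Wp d j n"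
        by auto
      then show ?thesis
      proof cases
        case V
        then show ?thesis using that a b val_Vinc_le[OF v, of j a n b] by (simp add: Vp_in_gedge)
      next
        case W
        then show ?thesis
          using that a b val_sum_ex[OF v inc_subset_Idx(1)[OF W(1,2), of d n] _ val_Winc[OF W(1)]]
          by (auto simp: Wp_in_gedge)
      qed
    qed
    then show "disjnt e f" using ef a b by (auto simp: disjnt_iff)
  qed
  show "verts k d - (Vcol 0 \<union> Vcol k) \<subseteq> \<Union> (Psi k d G)"
  proof
    fix x assume x: "x \<in> verts k d - (Vcol 0 \<union> Vcol k)"
    then have "x \<in> Vverts k \<or> x \<in> Wverts k d" by (simp add: verts_def)
    then consider (V) j n where "1 \<le> j" "j < k" "x = Vp j n" | (W) j n where "1 \<le> j" "j \<le> k" "x = Wp d j n"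
    proof
      assume "x \<in> Vverts k"
      then obtain j n where jn: "j \<le> k" "x = Vp j n" by (auto simp: Vverts_eq)
      then have "j \<noteq> 0" "j \<noteq> k" using x by (auto simp: Vcol_eq)
      then show thesis using jn by (intro that(1)) auto
    next
      assume "x \<in> Wverts k d"
      then show thesis using that(2) by (auto simp: Wverts_eq)
    qed
    then show "x \<in> \<Union> (Psi k d G)"
    proof cases
      case V
      then have jk: "j \<le> k" by simp
      have sub: "Vleft d j n \<union> Vright k d j n \<subseteq> Idx k" using inc_subset_Idx(2)[OF jk] inc_subset_Idx(3) by blast
      have "(\<Sum>i\<in>Vleft d j n \<union> Vright k d j n. val d G i) = 1"
        using val_Vleft[OF V(1), where d = d and n = n and G = G] val_Vright[OF V(2), where d = d and n = n and G = G]
        by (simp add: sum.union_disjoint Vleft_Vright_disjoint)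
      then obtain i where "i \<in> Vleft d j n \<union> Vright k d j n" "val d G i = 1"
        using val_sum_ex[OF v sub] by auto
      then have "gedge d i \<in> Psi k d G" "x \<in> gedge d i"
        using sub V jk Vp_in_gedge[OF jk, of i n d] by (auto simp: Psi_def)
      then show ?thesis by blast
    next
      case W
      obtain i where "i \<in> Winc d j n" "val d G i = 1"
        using val_sum_ex[OF v inc_subset_Idx(1)[OF W(1,2), of d n] _ val_Winc[OF W(1)]] by auto
      then have "gedge d i \<in> Psi k d G" "x \<in> gedge d i"
        using inc_subset_Idx(1)[OF W(1,2), of d n] W Wp_in_gedge[OF W(1), of i k d n]
        by (auto simp: Psi_def)
      then show ?thesis by blast
    qed
  qed
qed

section \<open>Vertices matched to the left and to the right\<close>

lemma matched_sides:
  assumes M: "M \<subseteq> edges k d" and j: "j \<le> k"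
  shows "(\<exists>u. {u, Vp j n} \<in> M \<and> fst u < fst (Vp j n)) \<longleftrightarrow> (\<exists>i\<in>Vleft d j n. gedge d i \<in> M)"
    and "(\<exists>u. {u, Vp j n} \<in> M \<and> fst u > fst (Vp j n)) \<longleftrightarrow> (\<exists>i\<in>Vright k d j n. gedge d i \<in> M)"
    and "Vp j n \<in> \<Union>M \<longleftrightarrow> (\<exists>i\<in>Vleft d j n \<union> Vright k d j n. gedge d i \<in> M)"
proof -
  have "\<exists>m. gedge d i = {Wp d j m, Vp j n}" if "i \<in> Vleft d j n" for i
    using that by (auto simp: Vleft_def Lp_def Rp_def doubleton_eq_iff split: if_splits)
  moreover have "fst (Wp d j m) < fst (Vp j n)" for m by (simp add: Vp_def Wp_def)
  ultimately have L: "\<exists>u. gedge d i = {u, Vp j n} \<and> fst u < fst (Vp j n)" if "i \<in> Vleft d j n" for i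
    using that by blast
  have "\<exists>m. gedge d i = {Wp d (Suc j) m, Vp j n}" if "i \<in> Vright k d j n" for i
    using that by (auto simp: Vright_def Lp_def Rp_def doubleton_eq_iff split: if_splits)
  moreover have "fst (Wp d (Suc j) m) > fst (Vp j n)" for m
    by (simp add: Vp_def Wp_def add_divide_distrib)
  ultimately have R: "\<exists>u. gedge d i = {u, Vp j n} \<and> fst u > fst (Vp j n)" if "i \<in> Vright k d j n" for i
    using that by blast
  have ex: "\<exists>i\<in>Vleft d j n \<union> Vright k d j n. e = gedge d i" if e: "e \<in> M" "Vp j n \<in> e" for e
  proof -
    obtain i where i: "i \<in> Idx k" "e = gedge d i" using e(1) M unfolding edges_eq by blast
    then show ?thesis using e(2) Vp_in_gedge[OF j i(1), of n d] by blast
  qed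
  have uniq: "u = u'" if "{u, Vp j n} = {u', Vp j n}" for u u' :: point
    using that by (auto simp: doubleton_eq_iff)
  show "(\<exists>u. {u, Vp j n} \<in> M \<and> fst u < fst (Vp j n)) \<longleftrightarrow> (\<exists>i\<in>Vleft d j n. gedge d i \<in> M)"
  proof
    assume "\<exists>u. {u, Vp j n} \<in> M \<and> fst u < fst (Vp j n)"
    then obtain u where u: "{u, Vp j n} \<in> M" "fst u < fst (Vp j n)" by blast
    then obtain i where i: "i \<in> Vleft d j n \<union> Vright k d j n" "{u, Vp j n} = gedge d i"
      using ex[of "{u, Vp j n}"] by auto
    have "i \<notin> Vright k d j n"
    proof
      assume "i \<in> Vright k d j n"
      then obtain u' where "gedge d i = {u', Vp j n}" "fst u' > fst (Vp j n)" using R by blast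
      then show False using u(2) uniq[of u u'] i(2) by auto
    qed
    then show "\<exists>i\<in>Vleft d j n. gedge d i \<in> M" using i u by auto
  next
    assume "\<exists>i\<in>Vleft d j n. gedge d i \<in> M"
    then obtain i where i: "i \<in> Vleft d j n" "gedge d i \<in> M" by blast
    then obtain u where "gedge d i = {u, Vp j n}" "fst u < fst (Vp j n)" using L by blast
    then show "\<exists>u. {u, Vp j n} \<in> M \<and> fst u < fst (Vp j n)" using i(2) by (intro exI[of _ u]) simp
  qed
  show "(\<exists>u. {u, Vp j n} \<in> M \<and> fst u > fst (Vp j n)) \<longleftrightarrow> (\<exists>i\<in>Vright k d j n. gedge d i \<in> M)"
  proof
    assume "\<exists>u. {u, Vp j n} \<in> M \<and> fst u > fst (Vp j n)"
    then obtain u where u: "{u, Vp j n} \<in> M" "fst u > fst (Vp j n)" by blast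
    then obtain i where i: "i \<in> Vleft d j n \<union> Vright k d j n" "{u, Vp j n} = gedge d i"
      using ex[of "{u, Vp j n}"] by auto
    have "i \<notin> Vleft d j n"
    proof
      assume "i \<in> Vleft d j n"
      then obtain u' where "gedge d i = {u', Vp j n}" "fst u' < fst (Vp j n)" using L by blast
      then show False using u(2) uniq[of u u'] i(2) by auto
    qed
    then show "\<exists>i\<in>Vright k d j n. gedge d i \<in> M" using i u by auto
  next
    assume "\<exists>i\<in>Vright k d j n. gedge d i \<in> M"
    then obtain i where i: "i \<in> Vright k d j n" "gedge d i \<in> M" by blast
    then obtain u where "gedge d i = {u, Vp j n}" "fst u > fst (Vp j n)" using R by blast
    then show "\<exists>u. {u, Vp j n} \<in> M \<and> fst u > fst (Vp j n)" using i(2) by (intro exI[of _ u]) simp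
  qed
  show "Vp j n \<in> \<Union>M \<longleftrightarrow> (\<exists>i\<in>Vleft d j n \<union> Vright k d j n. gedge d i \<in> M)"
  proof
    assume "Vp j n \<in> \<Union>M"
    then show "\<exists>i\<in>Vleft d j n \<union> Vright k d j n. gedge d i \<in> M" using ex by auto
  next
    assume "\<exists>i\<in>Vleft d j n \<union> Vright k d j n. gedge d i \<in> M"
    then obtain i where i: "i \<in> Vleft d j n \<union> Vright k d j n" "gedge d i \<in> M" by blast
    then have "Vp j n \<in> gedge d i" using L[of i] R[of i] by auto
    then show "Vp j n \<in> \<Union>M" using i(2) by blast
  qed
qed

text \<open>No edge leaves column 0 to the left, so there matched to the left means uncovered, that
  is, without a matched edge to the right.\<close>

lemma matched_left_iff:
  assumes "M \<subseteq> edges k d" "j \<le> k"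
  shows "matched_left M (Vp j n) \<longleftrightarrow>
    (if j = 0 then \<not> (\<exists>i\<in>Vright k d j n. gedge d i \<in> M) else \<exists>i\<in>Vleft d j n. gedge d i \<in> M)"
  unfolding matched_left_def matched_sides[OF assms] by (auto simp: Vcol_eq Vleft_def)

lemma matched_right_iff:
  assumes "M \<subseteq> edges k d" "j \<le> k"
  shows "matched_right k M (Vp j n) \<longleftrightarrow>
    (if j = k then \<not> (\<exists>i\<in>Vleft d j n. gedge d i \<in> M) else \<exists>i\<in>Vright k d j n. gedge d i \<in> M)"
  unfolding matched_right_def matched_sides[OF assms] by (auto simp: Vcol_eq Vright_def)

lemma ex_gedge_in_Psi:
  assumes "valid k d G" "I \<subseteq> Idx k" "finite I" "(\<Sum>i\<in>I. val d G i) = s" "s = 0 \<or> s = 1"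
  shows "(\<exists>i\<in>I. gedge d i \<in> Psi k d G) \<longleftrightarrow> s = 1"
proof -
  have "(\<exists>i\<in>I. gedge d i \<in> Psi k d G) \<longleftrightarrow> (\<exists>i\<in>I. val d G i = 1)"
    using assms(2) gedge_in_Psi by blast
  also have "\<dots> \<longleftrightarrow> s = 1"
    using assms val_sum_ex[OF assms(1-3)] val_sum_nex[OF assms(1-3)] by (metis zero_neq_one)
  finally show ?thesis .
qed

lemma matched_Psi:
  assumes v: "valid k d G" and jk: "j \<le> k" and k: "1 \<le> k"
  shows "matched_left (Psi k d G) (Vp j n) \<longleftrightarrow> G j n - G j (n + 1) = 1"
    and "matched_right k (Psi k d G) (Vp j n) \<longleftrightarrow> G j n - G j (n + 1) = 0"
proof -
  have M: "Psi k d G \<subseteq> edges k d" using matching_Psi[OF v] by (simp add: matching_def)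
  have c: "G j n - G j (n + 1) = 0 \<or> G j n - G j (n + 1) = 1" by (rule valid_col[OF v jk])
  have L: "(\<exists>i\<in>Vleft d j n. gedge d i \<in> Psi k d G) \<longleftrightarrow> G j n - G j (n + 1) = 1" if "1 \<le> j"
    by (rule ex_gedge_in_Psi[OF v inc_subset_Idx(2)[OF jk] _ val_Vleft[OF that] c]) simp
  have R: "(\<exists>i\<in>Vright k d j n. gedge d i \<in> Psi k d G) \<longleftrightarrow> 1 - (G j n - G j (n + 1)) = 1" if "j < k"
    by (rule ex_gedge_in_Psi[OF v inc_subset_Idx(3) _ val_Vright[OF that]]) (use c in auto)
  show "matched_left (Psi k d G) (Vp j n) \<longleftrightarrow> G j n - G j (n + 1) = 1"
    unfolding matched_left_iff[OF M jk] using L R c k by (cases "j = 0") auto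
  show "matched_right k (Psi k d G) (Vp j n) \<longleftrightarrow> G j n - G j (n + 1) = 0"
    unfolding matched_right_iff[OF M jk] using L R c k jk by (cases "j = k") auto
qed

lemma sum_telescope_int:
  fixes f :: "int \<Rightarrow> int"
  assumes "a \<le> b"
  shows "(\<Sum>n\<in>{a..<b}. f n - f (n + 1)) = f a - f b"
  using assms
proof (induction b rule: int_ge_induct)
  case (step b)
  have "{a..<b + 1} = insert b {a..<b}" using step(1) by auto
  then show ?case using step by simp
qed simp

lemma of_int_less_half: "(of_int a :: real) < of_int b + 1/2 \<longleftrightarrow> a \<le> b"
  "(of_int b + 1/2 :: real) < of_int a \<longleftrightarrow> b < a"
proof -
  have "(of_int a :: real) < of_int b + 1/2 \<longleftrightarrow> a \<le> b"
  proof
    assume "(of_int a :: real) < of_int b + 1/2"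
    then have "(of_int a :: real) < of_int (b + 1)" by simp
    then show "a \<le> b" unfolding of_int_less_iff by simp
  next
    assume "a \<le> b"
    then have "(of_int a :: real) \<le> of_int b" by simp
    then show "(of_int a :: real) < of_int b + 1/2" by simp
  qed
  moreover have "(of_int b + 1/2 :: real) \<noteq> of_int a"
  proof
    assume "(of_int b + 1/2 :: real) = of_int a"
    then have "(of_int (2 * b + 1) :: real) = of_int (2 * a)" by simp
    then have "2 * b + 1 = 2 * a" unfolding of_int_eq_iff .
    then show False by presburger
  qed
  ultimately show "(of_int a :: real) < of_int b + 1/2 \<longleftrightarrow> a \<le> b"
    "(of_int b + 1/2 :: real) < of_int a \<longleftrightarrow> b < a" by linarith+
qed

lemma snd_Vp_Yord: "snd (Vp j n) > Yord d j \<longleftrightarrow> yy d j \<le> n" "snd (Vp j n) < Yord d j \<longleftrightarrow> n < yy d j"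
  using of_int_less_half(1)[of "yy d j" n] of_int_less_half(2)[of n "yy d j"] by (simp_all add: Vp_def Yord_eq add_divide_distrib)

lemma finite_col_bound:
  assumes "valid k d G"
  shows "\<exists>N. (\<forall>n. N \<le> \<bar>n\<bar> \<longrightarrow> G j n = G0 d j n) \<and> \<bar>yy d j\<bar> \<le> N"
proof -
  have "finite ((\<lambda>(i, n). \<bar>n\<bar>) ` {(i, n). G i n \<noteq> G0 d i n})" using assms by (simp add: valid_def)
  then have "bdd_above ((\<lambda>(i, n). \<bar>n\<bar>) ` {(i, n). G i n \<noteq> G0 d i n})" by (rule bdd_above_finite)
  then obtain B where B: "\<And>x. x \<in> (\<lambda>(i, n). \<bar>n\<bar>) ` {(i, n). G i n \<noteq> G0 d i n} \<Longrightarrow> x \<le> B"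
    unfolding bdd_above_def by blast
  show ?thesis
  proof (intro exI[of _ "max (B + 1) \<bar>yy d j\<bar>"] conjI allI impI)
    fix n assume n: "max (B + 1) \<bar>yy d j\<bar> \<le> \<bar>n\<bar>"
    show "G j n = G0 d j n"
    proof (rule ccontr)
      assume "G j n \<noteq> G0 d j n"
      then have "\<bar>n\<bar> \<le> B" by (intro B) auto
      then show False using n by simp
    qed
  qed simp
qed

text \<open>Both counts telescope to \<open>G j (yy d j) - ss d j\<close>, the excess over
  \<open>G0\<close> at the face centred at the level \<open>Yord d j\<close>.\<close>

lemma admissible_Psi:
  assumes v: "valid k d G" and k: "1 \<le> k"
  shows "admissible k d (Psi k d G)"
  unfolding admissible_def
proof (intro conjI ballI matching_Psi v)
  fix j assume "j \<in> {0..k}"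
  then have jk: "j \<le> k" by simp
  obtain N where N: "\<And>n. N \<le> \<bar>n\<bar> \<Longrightarrow> G j n = G0 d j n" "\<bar>yy d j\<bar> \<le> N"
    using finite_col_bound[OF v, of j] by blast
  let ?y = "yy d j" and ?S = "\<lambda>n. G j n - G j (n + 1)"
  have S: "?S n = 0 \<or> ?S n = 1" for n by (rule valid_col[OF v jk])
  have S0: "?S n = of_bool (n < ?y)" if "n \<notin> {- N..<N}" for n
    using that N(1)[of n] N(1)[of "n + 1"] N(2) G0_col[of d j n] by (cases "n < - N"; cases "n = - N - 1") auto
  have la: "left_above d (Psi k d G) j = Vp j ` {n \<in> {?y..<N}. ?S n = 1}"
  proof -
    have "left_above d (Psi k d G) j = Vp j ` {n. ?y \<le> n \<and> ?S n = 1}"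
      unfolding left_above_def Vcol_eq using matched_Psi(1)[OF v jk k] snd_Vp_Yord(1)[of d j] by auto
    moreover have "n < N" if "?y \<le> n" "?S n = 1" for n
    proof (rule ccontr)
      assume "\<not> n < N"
      then have "n \<notin> {- N..<N}" by simp
      from S0[OF this] that show False by simp
    qed
    then have "{n. ?y \<le> n \<and> ?S n = 1} = {n \<in> {?y..<N}. ?S n = 1}" by auto
    ultimately show ?thesis by simp
  qed
  have rb: "right_below k d (Psi k d G) j = Vp j ` {n \<in> {- N..<?y}. ?S n = 0}"
  proof -
    have "right_below k d (Psi k d G) j = Vp j ` {n. n < ?y \<and> ?S n = 0}"
      unfolding right_below_def Vcol_eq using matched_Psi(2)[OF v jk k] snd_Vp_Yord(2)[of j _ d] by auto
    moreover have "- N \<le> n" if "n < ?y" "?S n = 0" for n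
    proof (rule ccontr)
      assume "\<not> - N \<le> n"
      then have "n \<notin> {- N..<N}" by simp
      from S0[OF this] that show False by simp
    qed
    then have "{n. n < ?y \<and> ?S n = 0} = {n \<in> {- N..<?y}. ?S n = 0}" by auto
    ultimately show ?thesis by simp
  qed
  have inj: "inj_on (Vp j) A" for A by (auto simp: inj_on_def)
  have "int (card {n \<in> {?y..<N}. ?S n = 1}) = (\<Sum>n\<in>{?y..<N}. if ?S n = 1 then 1 else 0)"
    by (simp add: sum.If_cases Int_def)
  also have "\<dots> = (\<Sum>n\<in>{?y..<N}. G j n - G j (n + 1))"
    using S by (intro sum.cong) auto
  also have "\<dots> = G j ?y - G j N" using N(2) by (intro sum_telescope_int) simp
  finally have c1: "int (card {n \<in> {?y..<N}. ?S n = 1}) = G j ?y - ss d j"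
    using N(1)[of N] N(2) by (simp add: G0_def)
  have "int (card {n \<in> {- N..<?y}. ?S n = 0}) = (\<Sum>n\<in>{- N..<?y}. if ?S n = 0 then 1 else 0)"
    by (simp add: sum.If_cases Int_def)
  \<comment> \<open>Counting zeros means summing one minus the column difference, which telescopes
    for \<open>- n - G j n\<close>.\<close>
  also have "\<dots> = (\<Sum>n\<in>{- N..<?y}. (- n - G j n) - (- (n + 1) - G j (n + 1)))"
    using S by (intro sum.cong) fastforce+
  also have "\<dots> = (N - G j (- N)) - (- ?y - G j ?y)"
    using N(2) sum_telescope_int[of "- N" ?y "\<lambda>n. - n - G j n"] by simp
  finally have c2: "int (card {n \<in> {- N..<?y}. ?S n = 0}) = G j ?y - ss d j"
    using N(1)[of "- N"] N(2) by (simp add: G0_def)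
  show "finite (left_above d (Psi k d G) j)"
    unfolding la by (rule finite_imageI, rule finite_subset[of _ "{?y..<N}"]) auto
  show "finite (right_below k d (Psi k d G) j)"
    unfolding rb by (rule finite_imageI, rule finite_subset[of _ "{- N..<?y}"]) auto
  show "card (left_above d (Psi k d G) j) = card (right_below k d (Psi k d G) j)"
    unfolding la rb card_image[OF inj] using c1 c2 by linarith
qed

section \<open>A matching is determined by the sides of its \<open>V\<close>-vertices\<close>

definition edge_ind :: "point set set \<Rightarrow> point set \<Rightarrow> int" where
  "edge_ind M e = (if e \<in> M then 1 else 0)"

lemma matching_sum:
  assumes M: "matching k d M" and I: "I \<subseteq> Idx k" "finite I" "\<And>i. i \<in> I \<Longrightarrow> v \<in> gedge d i"
  shows "(\<Sum>i\<in>I. edge_ind M (gedge d i)) = (of_bool (\<exists>i\<in>I. gedge d i \<in> M) :: int)"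
proof (cases "\<exists>i\<in>I. gedge d i \<in> M")
  case True
  then obtain i where i: "i \<in> I" "gedge d i \<in> M" by blast
  have "gedge d l \<notin> M" if "l \<in> I - {i}" for l
  proof
    assume "gedge d l \<in> M"
    moreover have "gedge d l \<noteq> gedge d i"
      using that i I(1) gedge_inj[of d k] by (auto simp: inj_on_def)
    ultimately have "disjnt (gedge d l) (gedge d i)"
      using M i(2) by (auto simp: matching_def pairwise_def)
    then show False using I(3)[of l] I(3)[of i] that i(1) by (auto simp: disjnt_def)
  qed
  then have "(\<Sum>l\<in>I - {i}. edge_ind M (gedge d l)) = (0 :: int)" by (intro sum.neutral) (auto simp: edge_ind_def)
  then show ?thesis using I(2) i by (subst sum.remove[of I i]) (auto simp: edge_ind_def)
qed (auto simp: edge_ind_def)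

lemma matching_sum_Winc:
  assumes M: "matching k d M" and j: "1 \<le> j" "j \<le> k"
  shows "(\<Sum>i\<in>Winc d j n. edge_ind M (gedge d i)) = (1 :: int)"
proof -
  have sub: "Winc d j n \<subseteq> Idx k" by (rule inc_subset_Idx(1)[OF j])
  have "Wp d j n \<in> verts k d" using j by (auto simp: verts_def Wverts_eq)
  then have "Wp d j n \<in> \<Union>M" using M by (auto simp: matching_def Vcol_eq)
  then obtain e where e: "e \<in> M" "Wp d j n \<in> e" by blast
  then obtain i where i: "i \<in> Idx k" "e = gedge d i"
    using M unfolding matching_def edges_eq by blast
  then have "i \<in> Winc d j n" using e(2) Wp_in_gedge[OF j(1) i(1), of d n] by simp
  then have "\<exists>i\<in>Winc d j n. gedge d i \<in> M" using e i by blast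
  moreover have "Wp d j n \<in> gedge d i" if "i \<in> Winc d j n" for i
    using Wp_in_gedge[OF j(1) subsetD[OF sub that], where n = n] that by blast
  ultimately show ?thesis using matching_sum[OF M sub, of "Wp d j n"] by simp
qed

lemma matching_sum_Vleft:
  assumes M: "matching k d M" and j: "1 \<le> j" "j \<le> k"
  shows "(\<Sum>i\<in>Vleft d j n. edge_ind M (gedge d i)) = (of_bool (matched_left M (Vp j n)) :: int)"
proof -
  have sub: "Vleft d j n \<subseteq> Idx k" by (rule inc_subset_Idx(2)[OF j(2)])
  have ed: "M \<subseteq> edges k d" using M by (simp add: matching_def)
  have "Vp j n \<in> gedge d i" if "i \<in> Vleft d j n" for i
    using Vp_in_gedge[OF j(2) subsetD[OF sub that], where n = n] that by blast
  then show ?thesis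
    using matching_sum[OF M sub, of "Vp j n"] matched_left_iff[OF ed j(2), of n] j by simp
qed

text \<open>An inner vertex is covered, hence matched to exactly one side; in column 0 the uncovered
  vertices count as matched to the left.\<close>

lemma matching_sum_Vright:
  assumes M: "matching k d M" and j: "j < k"
  shows "(\<Sum>i\<in>Vright k d j n. edge_ind M (gedge d i)) =
    (of_bool (\<not> matched_left M (Vp j n)) :: int)"
proof -
  have jk: "j \<le> k" using j by simp
  have sub: "Vright k d j n \<subseteq> Idx k" by (rule inc_subset_Idx(3))
  have ed: "M \<subseteq> edges k d" using M by (simp add: matching_def)
  have *: "(\<Sum>i\<in>Vright k d j n. edge_ind M (gedge d i)) =
      (of_bool (\<exists>i\<in>Vright k d j n. gedge d i \<in> M) :: int)"
  proof (rule matching_sum[OF M sub finite_inc(3)])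
    show "Vp j n \<in> gedge d i" if "i \<in> Vright k d j n" for i
      using Vp_in_gedge[OF jk subsetD[OF sub that], where n = n] that by blast
  qed
  show ?thesis
  proof (cases "j = 0")
    case True
    then show ?thesis unfolding * matched_left_iff[OF ed jk] by simp
  next
    case False
    let ?I = "Vleft d j n \<union> Vright k d j n"
    have sub': "?I \<subseteq> Idx k" using sub inc_subset_Idx(2)[OF jk, of d n] by blast
    have "Vp j n \<in> verts k d - (Vcol 0 \<union> Vcol k)"
      using j False by (auto simp: verts_def Vverts_eq Vcol_eq)
    then have "Vp j n \<in> \<Union>M" using M unfolding matching_def by blast
    then have "\<exists>i\<in>?I. gedge d i \<in> M" using matched_sides(3)[OF ed jk] by blast
    moreover have "Vp j n \<in> gedge d i" if "i \<in> ?I" for i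
      using Vp_in_gedge[OF jk subsetD[OF sub' that], where n = n] that by blast
    ultimately have "(\<Sum>i\<in>?I. edge_ind M (gedge d i)) = (1 :: int)"
      using matching_sum[OF M sub', of "Vp j n"] by simp
    then have "(\<Sum>i\<in>Vleft d j n. edge_ind M (gedge d i)) +
        (\<Sum>i\<in>Vright k d j n. edge_ind M (gedge d i)) = (1 :: int)"
      by (simp add: sum.union_disjoint Vleft_Vright_disjoint)
    moreover have "(\<Sum>i\<in>Vleft d j n. edge_ind M (gedge d i)) =
        (of_bool (matched_left M (Vp j n)) :: int)"
      using matching_sum_Vleft[OF M _ jk] False by simp
    ultimately show ?thesis by (cases "matched_left M (Vp j n)") auto
  qed
qed

lemma constant_int_seq:
  fixes f :: "int \<Rightarrow> int"
  assumes "\<And>n. f (n + 1) = f n"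
  shows "f m = f n"
proof -
  have "f m = f n" if "m \<le> n" for m n
    using that by (induction n rule: int_ge_induct) (auto simp: assms)
  then show ?thesis by (metis linorder_linear)
qed

text \<open>In each strip, the sums of the edge indicators around the two families of zigzag vertices
  are known. Hence the indicators of two such matchings on the \<open>Dn\<close>-edges differ by a constant,
  which vanishes because somewhere both zigzag edges are unused.\<close>

lemma matching_determined:
  assumes M: "matching k d M" and M': "matching k d M'"
    and ml: "\<And>j n. j \<le> k \<Longrightarrow> matched_left M (Vp j n) \<longleftrightarrow> matched_left M' (Vp j n)"
    and ex: "\<And>j. j \<le> k \<Longrightarrow> \<exists>n. matched_left M (Vp j n)" "\<And>j. j \<le> k \<Longrightarrow> \<exists>n. \<not> matched_left M (Vp j n)"
  shows "M = M'"
proof -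
  have strip: "gedge d (e, Suc i, n) \<in> M \<longleftrightarrow> gedge d (e, Suc i, n) \<in> M'" if ik: "Suc i \<le> k" for e i n
  proof -
    let ?x = "\<lambda>N e n. edge_ind N (gedge d (e, Suc i, n))"
    let ?l = "\<lambda>j n. of_bool (matched_left M (Vp j n)) :: int"
    have k: "1 \<le> Suc i" "i < k" using ik by auto
    have sums: "?x N Hz n = (if primed d (Suc i) then 1 - ?l i n else ?l (Suc i) n) \<and>
      ?x N Up n + ?x N Dn n = (if primed d (Suc i) then ?l i n else 1 - ?l i n) \<and>
      ?x N Up n + ?x N Dn (n + 1) = (if primed d (Suc i) then ?l (Suc i) n else 1 - ?l (Suc i) n)"
      if N: "N = M \<or> N = M'" for N n
    proof -
      have NM: "matching k d N" using N M M' by auto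
      have "matched_left N (Vp j n) \<longleftrightarrow> matched_left M (Vp j n)" if "j \<le> k" for j n
        using N ml that by auto
      then have l: "of_bool (matched_left N (Vp (Suc i) n)) = ?l (Suc i) n"
        "of_bool (\<not> matched_left N (Vp i n)) = 1 - ?l i n"
        using ik by auto
      show ?thesis
        using matching_sum_Winc[OF NM k(1) ik, of n] matching_sum_Vleft[OF NM k(1) ik, of n]
          matching_sum_Vright[OF NM k(2), of n] k
        unfolding l
        by (cases "primed d (Suc i)") (simp_all add: Winc_def Vleft_def Vright_def del: gedge.simps)
    qed
    define f where "f = (\<lambda>n. ?x M Dn n - ?x M' Dn n)"
    have "f (n + 1) = f n" for n
      using sums[of M n] sums[of M' n] unfolding f_def by simp
    then have const: "f m = f n" for m n by (rule constant_int_seq)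
    obtain m where "(if primed d (Suc i) then ?l i m else 1 - ?l i m) = 0"
      using ex[of i] k(2) by (cases "primed d (Suc i)") auto
    then have s: "?x M Up m + ?x M Dn m = 0" "?x M' Up m + ?x M' Dn m = 0"
      using sums[of M m] sums[of M' m] by auto
    have x0: "0 \<le> ?x N e n" for N e n by (simp add: edge_ind_def)
    have "f m = 0" unfolding f_def using s x0[of M Up m] x0[of M Dn m] x0[of M' Up m] x0[of M' Dn m]
      by linarith
    then have f0: "f n = 0" for n using const[of n m] by simp
    have Dn: "?x M Dn n = ?x M' Dn n" using f0[of n] by (simp add: f_def)
    moreover have "?x M Up n = ?x M' Up n" using Dn sums[of M n] sums[of M' n] by simp
    moreover have "?x M Hz n = ?x M' Hz n" using sums[of M n] sums[of M' n] by simp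
    ultimately have "?x M e n = ?x M' e n" by (cases e) auto
    then show ?thesis by (simp add: edge_ind_def del: gedge.simps split: if_splits)
  qed
  have idx: "gedge d i \<in> M \<longleftrightarrow> gedge d i \<in> M'" if i: "i \<in> Idx k" for i
  proof -
    obtain e j n where "i = (e, j, n)" by (cases i)
    then obtain h where "i = (e, Suc h, n)" "Suc h \<le> k" using i by (cases j) (auto simp: Idx_def)
    then show ?thesis using strip[of h e n] by simp
  qed
  have "M \<subseteq> gedge d ` Idx k" "M' \<subseteq> gedge d ` Idx k" using M M' by (auto simp: matching_def edges_eq)
  then show ?thesis using idx by blast
qed

text \<open>The description prescribes the side of every \<open>V\<close>-vertex, and each column
  has vertices of both sides, so \<open>matching_determined\<close> yields uniqueness.\<close>

lemma minimal_matching_eq: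
  assumes k: "1 \<le> k"
  shows "minimal_matching k d = Psi k d (G0 d)"
  unfolding minimal_matching_def
proof (rule the_equality)
  have ml: "matched_left (Psi k d (G0 d)) (Vp j n) \<longleftrightarrow> n < yy d j" if "j \<le> k" for j n
    using matched_Psi(1)[OF valid_G0 that k, of d n] G0_col[of d j n] by simp
  show "admissible k d (Psi k d (G0 d)) \<and>
    (\<forall>j\<in>{0..k}. \<forall>v\<in>Vcol j. matched_left (Psi k d (G0 d)) v \<longleftrightarrow> snd v < Yord d j)"
    using admissible_Psi[OF valid_G0 k, of d] ml snd_Vp_Yord(2) by (auto simp: Vcol_eq)
  fix M assume M: "admissible k d M \<and> (\<forall>j\<in>{0..k}. \<forall>v\<in>Vcol j. matched_left M v \<longleftrightarrow> snd v < Yord d j)"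
  then have ml': "matched_left M (Vp j n) \<longleftrightarrow> n < yy d j" if "j \<le> k" for j n
    using that snd_Vp_Yord(2)[of j n d] by (auto simp: Vcol_eq)
  show "M = Psi k d (G0 d)"
  proof (rule matching_determined)
    show "matching k d M" using M by (simp add: admissible_def)
    show "matching k d (Psi k d (G0 d))" by (rule matching_Psi[OF valid_G0])
    fix j assume j: "j \<le> k"
    show "matched_left M (Vp j n) \<longleftrightarrow> matched_left (Psi k d (G0 d)) (Vp j n)" for n
      using ml ml' j by simp
    show "\<exists>n. matched_left M (Vp j n)" using ml'[OF j, of "yy d j - 1"] by auto
    show "\<exists>n. \<not> matched_left M (Vp j n)" using ml'[OF j, of "yy d j"] by auto
  qed
qed

section \<open>The flip distance\<close>

lemma flip_up:
  assumes "valid k d G" "1 \<le> j" "j < k" "valid k d (upd G j n 1)"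
  shows "flip k d (Psi k d G) (Psi k d (upd G j n 1))"
  using assms by (subst flip_Psi_iff) auto

lemma area_G0 [simp]: "area d (G0 d) = 0"
  by (simp add: area_def)

lemma relpowp_flip_Psi:
  assumes "valid k d G" "1 \<le> k"
  shows "(flip k d ^^ area d G) (Psi k d (G0 d)) (Psi k d G)"
  using assms(1)
proof (induction rule: valid_induct)
  case (step G j n)
  then show ?case using flip_up[OF step(1,2,3,4)] by (auto simp: area_upd)
qed simp

text \<open>A flip changes the area by exactly one, so \<open>m\<close> flips cannot reach an area
  above \<open>m\<close>. This is the lower bound for the flip distance.\<close>

lemma relpowp_flip_from_min:
  assumes "(flip k d ^^ m) (Psi k d (G0 d)) M" "1 \<le> k"
  shows "\<exists>G. valid k d G \<and> M = Psi k d G \<and> area d G \<le> m"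
  using assms(1)
proof (induction m arbitrary: M)
  case 0
  then show ?case using valid_G0 by (intro exI[of _ "G0 d"]) auto
next
  case (Suc m)
  then obtain N where N: "(flip k d ^^ m) (Psi k d (G0 d)) N" "flip k d N M" by auto
  then obtain G where G: "valid k d G" "N = Psi k d G" "area d G \<le> m" using Suc.IH by blast
  then obtain j n s where s: "s \<in> {1, - 1}" "valid k d (upd G j n s)" "M = Psi k d (upd G j n s)"
    using N(2) flip_Psi_iff[OF G(1) assms(2)] by auto
  have "area d (upd G j n s) \<le> Suc m"
  proof (cases "s = 1")
    case True
    then show ?thesis using area_upd[OF G(1), of j n] G(3) by simp
  next
    case False
    \<comment> \<open>A decrement is undone by an increment, so \<open>area_upd\<close> applied to
      the new height shows that the area went down.\<close>
    then have "area d (upd (upd G j n s) j n 1) = area d (upd G j n s) + 1"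
      using area_upd[OF s(2)] by blast
    then show ?thesis using False s(1) G(3) upd_upd(2)[of G j n 1] by auto
  qed
  then show ?case using s by blast
qed

lemma reachable_eq:
  assumes "1 \<le> k"
  shows "reachable k d = Psi k d ` {G. valid k d G}"
proof (intro equalityI subsetI)
  fix M assume "M \<in> reachable k d"
  then have "(flip k d)\<^sup>*\<^sup>* (Psi k d (G0 d)) M" by (simp add: reachable_def minimal_matching_eq[OF assms])
  then obtain m where "(flip k d ^^ m) (Psi k d (G0 d)) M" using rtranclp_imp_relpowp by fastforce
  then show "M \<in> Psi k d ` {G. valid k d G}" using relpowp_flip_from_min[OF _ assms] by blast
next
  fix M assume "M \<in> Psi k d ` {G. valid k d G}"
  then obtain G where G: "M = Psi k d G" "valid k d G" by blast
  then show "M \<in> reachable k d"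
    using admissible_Psi[OF G(2) assms] relpowp_imp_rtranclp[OF relpowp_flip_Psi[OF G(2) assms]]
    by (simp add: reachable_def minimal_matching_eq[OF assms])
qed

lemma flip_dist_Psi:
  assumes "1 \<le> k" "valid k d G"
  shows "flip_dist k d (Psi k d G) = area d G"
  unfolding flip_dist_def minimal_matching_eq[OF assms(1)]
proof (rule Least_equality)
  show "(flip k d ^^ area d G) (Psi k d (G0 d)) (Psi k d G)" by (rule relpowp_flip_Psi[OF assms(2,1)])
  fix m assume "(flip k d ^^ m) (Psi k d (G0 d)) (Psi k d G)"
  then obtain H where "valid k d H" "Psi k d G = Psi k d H" "area d H \<le> m"
    using relpowp_flip_from_min assms(1) by blast
  then show "area d G \<le> m" using Psi_inj[OF assms(2)] by blast
qed

lemma reachable_level: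
  assumes "1 \<le> k"
  shows "bij_betw (Psi k d) {G. valid k d G \<and> area d G = n} {M \<in> reachable k d. flip_dist k d M = n}"
  unfolding bij_betw_def
proof
  show "inj_on (Psi k d) {G. valid k d G \<and> area d G = n}" by (auto intro: inj_onI Psi_inj)
  show "Psi k d ` {G. valid k d G \<and> area d G = n} = {M \<in> reachable k d. flip_dist k d M = n}"
    by (auto simp: reachable_eq[OF assms] flip_dist_Psi[OF assms])
qed

section \<open>Young diagrams and strips\<close>

type_synonym diagram = "(nat \<times> nat) set"

definition young :: "diagram \<Rightarrow> bool" where
  "young D \<longleftrightarrow> finite D \<and> (\<forall>r s. (Suc r, s) \<in> D \<longrightarrow> (r, s) \<in> D) \<and>
     (\<forall>r s. (r, Suc s) \<in> D \<longrightarrow> (r, s) \<in> D)"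

text \<open>The interlacing form of a horizontal strip: for Young diagrams it says that
  \<open>E - D\<close> has at most one box in each column, the first coordinate being the row.
  \<open>vstrip\<close> is the transposed notion.\<close>

definition hstrip :: "diagram \<Rightarrow> diagram \<Rightarrow> bool" where
  "hstrip D E \<longleftrightarrow> D \<subseteq> E \<and> (\<forall>r s. (Suc r, s) \<in> E \<longrightarrow> (r, s) \<in> D)"

definition vstrip :: "diagram \<Rightarrow> diagram \<Rightarrow> bool" where
  "vstrip D E \<longleftrightarrow> D \<subseteq> E \<and> (\<forall>r s. (r, Suc s) \<in> E \<longrightarrow> (r, s) \<in> D)"

definition part :: "(nat \<Rightarrow> nat) \<Rightarrow> bool" where
  "part a \<longleftrightarrow> (\<forall>r. a (Suc r) \<le> a r) \<and> (\<exists>N. \<forall>r\<ge>N. a r = 0)"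

definition dg :: "(nat \<Rightarrow> nat) \<Rightarrow> diagram" where
  "dg a = {(r, s). s < a r}"

lemma mem_dg [simp]: "(r, s) \<in> dg a \<longleftrightarrow> s < a r"
  by (simp add: dg_def)

lemma down_closed_nat:
  fixes S :: "nat set"
  assumes "finite S" "\<And>i. Suc i \<in> S \<Longrightarrow> i \<in> S"
  shows "i \<in> S \<longleftrightarrow> i < card S"
proof -
  have down: "j \<in> S" if "i \<in> S" "j \<le> i" for i j
    using that(2,1) by (induction rule: inc_induct) (auto intro: assms(2))
  have "S = {..<card S}"
  proof (cases "S = {}")
    case False
    have "S = {..Max S}"
    proof (intro equalityI subsetI)
      fix j assume "j \<in> S"
      then show "j \<in> {..Max S}" using Max_ge[OF assms(1)] by simp
    next
      fix j assume "j \<in> {..Max S}"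
      then show "j \<in> S" using down[OF Max_in[OF assms(1) False]] by simp
    qed
    then show ?thesis by (metis card_atMost lessThan_Suc_atMost)
  qed simp
  then show ?thesis by blast
qed

lemma dg_inj: "dg a = dg b \<longleftrightarrow> a = b"
proof
  assume h: "dg a = dg b"
  have "{..<a r} = {..<b r}" for r using h by (auto simp: dg_def set_eq_iff)
  then have "a r = b r" for r by (simp add: lessThan_eq_iff)
  then show "a = b" by blast
qed simp

lemma dg_eq_Sigma: "\<forall>r\<ge>N. a r = 0 \<Longrightarrow> dg a = (SIGMA r:{..<N}. {..<a r})"
  by (auto simp: dg_def) (metis not_le not_less0)

lemma card_dg: "\<forall>r\<ge>N. a r = 0 \<Longrightarrow> card (dg a) = (\<Sum>r<N. a r)"
  by (simp add: dg_eq_Sigma)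

lemma young_dg_iff: "young (dg a) \<longleftrightarrow> part a"
proof
  assume y: "young (dg a)"
  have "a (Suc r) \<le> a r" for r
  proof (rule ccontr)
    assume "\<not> a (Suc r) \<le> a r"
    then have "(Suc r, a r) \<in> dg a" by simp
    then have "(r, a r) \<in> dg a" using y unfolding young_def by blast
    then show False by simp
  qed
  moreover have "finite (fst ` dg a)" using y by (simp add: young_def)
  then obtain N where N: "fst ` dg a \<subseteq> {..<N}" using finite_nat_iff_bounded by blast
  have "a r = 0" if "r \<ge> N" for r
  proof (rule ccontr)
    assume "a r \<noteq> 0"
    then have "(r, 0) \<in> dg a" by simp
    then have "r \<in> fst ` dg a" by (rule image_eqI[rotated]) simp
    then show False using N that by auto
  qed
  ultimately show "part a" unfolding part_def by blast
next
  assume p: "part a"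
  then obtain N where "\<forall>r\<ge>N. a r = 0" by (auto simp: part_def)
  then have "finite (dg a)" by (simp add: dg_eq_Sigma)
  then show "young (dg a)" using p unfolding young_def part_def mem_dg by (auto intro: less_le_trans)
qed

lemma young_ex_dg:
  assumes "young D"
  obtains a where "part a" "D = dg a"
proof -
  define a where "a r = card {s. (r, s) \<in> D}" for r
  have "(r, s) \<in> D \<longleftrightarrow> s < a r" for r s
  proof -
    have "{s. (r, s) \<in> D} \<subseteq> snd ` D"
    proof
      fix s assume "s \<in> {s. (r, s) \<in> D}"
      then have "(r, s) \<in> D" by simp
      then show "s \<in> snd ` D" by (rule rev_image_eqI) simp
    qed
    moreover have "finite (snd ` D)" using assms by (simp add: young_def)
    ultimately have fin: "finite {s. (r, s) \<in> D}" by (rule finite_subset)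
    have "i \<in> {s. (r, s) \<in> D}" if "Suc i \<in> {s. (r, s) \<in> D}" for i
      using assms that unfolding young_def by blast
    from down_closed_nat[OF fin this, of s] show ?thesis unfolding a_def by blast
  qed
  then have "D = dg a" by (auto simp: dg_def)
  then show ?thesis using that assms young_dg_iff by metis
qed

lemma all_less_imp: "(\<forall>s. s < x \<longrightarrow> s < y) \<longleftrightarrow> x \<le> y" for x y :: nat
proof
  assume "\<forall>s. s < x \<longrightarrow> s < y"
  from this[rule_format, of y] show "x \<le> y" by linarith
qed auto

lemma all_Suc_less_imp: "(\<forall>s. Suc s < y \<longrightarrow> s < x) \<longleftrightarrow> y \<le> Suc x" for x y :: nat
proof
  assume "\<forall>s. Suc s < y \<longrightarrow> s < x"
  from this[rule_format, of x] show "y \<le> Suc x" by linarith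
qed auto

lemma hstrip_dg: "hstrip (dg a) (dg b) \<longleftrightarrow> (\<forall>r. a r \<le> b r \<and> b (Suc r) \<le> a r)"
  unfolding hstrip_def subset_iff split_paired_All mem_dg all_less_imp by blast

lemma vstrip_dg: "vstrip (dg a) (dg b) \<longleftrightarrow> (\<forall>r. a r \<le> b r \<and> b r \<le> Suc (a r))"
  unfolding vstrip_def subset_iff split_paired_All mem_dg all_less_imp all_Suc_less_imp by blast

section \<open>Local commutation\<close>

text \<open>The sizes of an element and of its image add up to a constant plus the extra parameter;
  this is the form in which an exchange enters the weight of a sequence. If \<open>M\<close> is all
  of \<open>nat\<close> the parameter produces a geometric series, with two values a factor of two
  terms.\<close>

definition size_bij :: "('a \<Rightarrow> nat) \<Rightarrow> ('a \<Rightarrow> 'a \<times> nat) \<Rightarrow> 'a set \<Rightarrow> 'a set \<Rightarrow> nat set \<Rightarrow> nat \<Rightarrow> bool" where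
  "size_bij sz \<beta> A B M x \<longleftrightarrow> bij_betw \<beta> A (B \<times> M) \<and>
     (\<forall>c\<in>A. sz c + sz (fst (\<beta> c)) = x + snd (\<beta> c))"

lemma size_bij_empty: "size_bij sz \<beta> {} {} M x"
  by (simp add: size_bij_def bij_betw_def)

text \<open>The rows \<open>c (Suc r)\<close> and \<open>e r\<close> range over the same interval,
  from the larger of the entries \<open>Suc r\<close> of \<open>a\<close> and \<open>b\<close> to
  the smaller of their entries \<open>r\<close>. Reflecting this interval maps one to the other. The
  first row of \<open>c\<close> is bounded only from below, and its excess is the free
  parameter.\<close>

lemma local_hh:
  assumes a: "part a" and b: "part b"
  shows "\<exists>\<beta>. size_bij (\<lambda>c. card (dg c)) \<beta>
    {c. part c \<and> (\<forall>r. a r \<le> c r \<and> c (Suc r) \<le> a r) \<and> (\<forall>r. b r \<le> c r \<and> c (Suc r) \<le> b r)}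
    {e. part e \<and> (\<forall>r. e r \<le> a r \<and> a (Suc r) \<le> e r) \<and> (\<forall>r. e r \<le> b r \<and> b (Suc r) \<le> e r)}
    UNIV (card (dg a) + card (dg b))" (is "\<exists>\<beta>. size_bij _ \<beta> ?A ?B _ _")
proof -
  \<comment> \<open>The sum of the two ends of the interval, so that subtracting from
    \<open>s r\<close> is the reflection.\<close>
  define s where "s r = min (a r) (b r) + max (a (Suc r)) (b (Suc r))" for r
  define \<beta> where "\<beta> c = (\<lambda>r. s r - c (Suc r), c 0 - max (a 0) (b 0))" for c :: "nat \<Rightarrow> nat"
  define \<gamma> where "\<gamma> = (\<lambda>(e, m :: nat). case_nat (max (a 0) (b 0) + m) (\<lambda>r. s r - e r :: nat))"
  have A: "max (a r) (b r) \<le> c r" "c (Suc r) \<le> min (a r) (b r)" "c (Suc r) \<le> s r" if "c \<in> ?A" for c r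
  proof -
    show "max (a r) (b r) \<le> c r" "c (Suc r) \<le> min (a r) (b r)" using that by auto
    then show "c (Suc r) \<le> s r" unfolding s_def by linarith
  qed
  have B: "e r \<le> min (a r) (b r)" "max (a (Suc r)) (b (Suc r)) \<le> e r" "e r \<le> s r" if "e \<in> ?B" for e r
  proof -
    show "e r \<le> min (a r) (b r)" "max (a (Suc r)) (b (Suc r)) \<le> e r" using that by auto
    then show "e r \<le> s r" unfolding s_def by linarith
  qed
  obtain N where N: "\<And>r. N \<le> r \<Longrightarrow> a r = 0" "\<And>r. N \<le> r \<Longrightarrow> b r = 0"
  proof -
    obtain N1 N2 where "\<forall>r\<ge>N1. a r = 0" "\<forall>r\<ge>N2. b r = 0" using a b by (auto simp: part_def)
    then show thesis by (intro that[of "max N1 N2"]) auto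
  qed
  have \<beta>: "\<beta> c \<in> ?B \<times> UNIV" if c: "c \<in> ?A" for c
  proof -
    have e: "max (a (Suc r)) (b (Suc r)) \<le> s r - c (Suc r)" "s r - c (Suc r) \<le> min (a r) (b r)" for r
      using A(1)[OF c, of "Suc r"] A(2)[OF c, of r] unfolding s_def by linarith+
    have "s (Suc r) - c (Suc (Suc r)) \<le> s r - c (Suc r)" for r
      using e(1)[of r] e(2)[of "Suc r"] by linarith
    moreover have "s r - c (Suc r) = 0" if "N \<le> r" for r using e(2)[of r] N(1)[OF that] by simp
    ultimately have "part (\<lambda>r. s r - c (Suc r))" unfolding part_def by blast
    then show ?thesis using e by (auto simp: \<beta>_def)
  qed
  have \<gamma>: "\<gamma> (e, m) \<in> ?A" if e: "e \<in> ?B" for e m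
  proof -
    have c: "max (a r) (b r) \<le> \<gamma> (e, m) r" for r
      using B(1)[OF e, of "r - 1"] by (cases r) (auto simp: \<gamma>_def s_def)
    have c': "\<gamma> (e, m) (Suc r) \<le> min (a r) (b r)" for r
      using B(2)[OF e, of r] by (auto simp: \<gamma>_def s_def)
    have "\<gamma> (e, m) (Suc r) \<le> \<gamma> (e, m) r" for r using c[of r] c'[of r] by linarith
    moreover have "\<gamma> (e, m) r = 0" if "Suc N \<le> r" for r
      using that c'[of "r - 1"] N(1)[of "r - 1"] by (cases r) auto
    ultimately have "part (\<gamma> (e, m))" unfolding part_def by blast
    then show ?thesis using c c' by auto
  qed
  have "bij_betw \<beta> ?A (?B \<times> UNIV)"
  proof (rule bij_betw_byWitness[where f' = \<gamma>])
    show "\<forall>c\<in>?A. \<gamma> (\<beta> c) = c"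
    proof
      fix c assume c: "c \<in> ?A"
      have "\<gamma> (\<beta> c) r = c r" for r
        using A(1)[OF c, of 0] A(3)[OF c, of "r - 1"] by (cases r) (auto simp: \<gamma>_def \<beta>_def)
      then show "\<gamma> (\<beta> c) = c" by blast
    qed
    show "\<forall>x\<in>?B \<times> UNIV. \<beta> (\<gamma> x) = x"
      using B(3) by (auto simp: \<gamma>_def \<beta>_def fun_eq_iff)
    show "\<beta> ` ?A \<subseteq> ?B \<times> UNIV" using \<beta> by blast
    show "\<gamma> ` (?B \<times> UNIV) \<subseteq> ?A" using \<gamma> by blast
  qed
  moreover have "card (dg c) + card (dg (fst (\<beta> c))) = card (dg a) + card (dg b) + snd (\<beta> c)"
    if c: "c \<in> ?A" for c
  proof -
    have "card (dg c) = (\<Sum>r<Suc N. c r)"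
    proof (rule card_dg, intro allI impI)
      fix r assume "Suc N \<le> r"
      then show "c r = 0" using A(2)[OF c, of "r - 1"] N(1)[of "r - 1"] by (cases r) auto
    qed
    also have "\<dots> = c 0 + (\<Sum>r<N. c (Suc r))" by (rule sum.lessThan_Suc_shift)
    finally have 1: "card (dg c) = c 0 + (\<Sum>r<N. c (Suc r))" .
    have "fst (\<beta> c) r = 0" if "N \<le> r" for r
      using \<beta>[OF c] B(1)[of "fst (\<beta> c)" r] N(1)[OF that] by (simp add: mem_Times_iff)
    then have 2: "card (dg (fst (\<beta> c))) = (\<Sum>r<N. s r - c (Suc r))"
      using card_dg[of N "fst (\<beta> c)"] by (simp add: \<beta>_def)
    have "(\<Sum>r<N. c (Suc r)) + (\<Sum>r<N. s r - c (Suc r)) = (\<Sum>r<N. s r)"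
      using A(3)[OF c] by (simp flip: sum.distrib)
    \<comment> \<open>The maxima in \<open>s\<close> are shifted by one row; the lower bound for the
      first row of \<open>c\<close> supplies the missing one.\<close>
    moreover have "max (a 0) (b 0) + (\<Sum>r<N. s r) = (\<Sum>r<N. min (a r) (b r)) + (\<Sum>r<Suc N. max (a r) (b r))"
      by (simp add: s_def sum.distrib sum.lessThan_Suc_shift del: sum.lessThan_Suc)
    moreover have "(\<Sum>r<Suc N. max (a r) (b r)) = (\<Sum>r<N. max (a r) (b r))" using N by simp
    moreover have "(\<Sum>r<N. min (a r) (b r)) + (\<Sum>r<N. max (a r) (b r)) = (\<Sum>r<N. a r) + (\<Sum>r<N. b r)"
      by (auto simp flip: sum.distrib intro!: sum.cong)
    moreover have "card (dg a) = (\<Sum>r<N. a r)" "card (dg b) = (\<Sum>r<N. b r)"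
      using N by (auto intro: card_dg)
    ultimately show ?thesis using 1 2 A(1)[OF c, of 0] by (simp add: \<beta>_def)
  qed
  ultimately show ?thesis unfolding size_bij_def by blast
qed

lemma Pow_split_bij:
  assumes g: "bij_betw g (F - {x}) H" and x: "x \<in> F"
  shows "bij_betw (\<lambda>S. (g ` (S - {x}), of_bool (x \<in> S) :: nat)) (Pow F) (Pow H \<times> {0, 1})"
proof (rule bij_betw_imageI)
  have inj: "inj_on g (F - {x})" and im: "g ` (F - {x}) = H" using g by (auto simp: bij_betw_def)
  show "inj_on (\<lambda>S. (g ` (S - {x}), of_bool (x \<in> S) :: nat)) (Pow F)"
  proof (rule inj_onI)
    fix S T assume S: "S \<in> Pow F" and T: "T \<in> Pow F"
      and eq: "(g ` (S - {x}), of_bool (x \<in> S) :: nat) = (g ` (T - {x}), of_bool (x \<in> T))"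
    have "S - {x} \<subseteq> F - {x}" "T - {x} \<subseteq> F - {x}" using S T by auto
    then have "S - {x} = T - {x}" using eq inj_on_image_eq_iff[OF inj] by blast
    moreover have "x \<in> S \<longleftrightarrow> x \<in> T" using eq by (auto split: if_splits simp: of_bool_def)
    ultimately show "S = T" by blast
  qed
  show "(\<lambda>S. (g ` (S - {x}), of_bool (x \<in> S) :: nat)) ` Pow F = Pow H \<times> {0, 1}"
  proof (intro equalityI subsetI)
    fix y assume "y \<in> (\<lambda>S. (g ` (S - {x}), of_bool (x \<in> S) :: nat)) ` Pow F"
    then show "y \<in> Pow H \<times> {0, 1}" using im by auto
  next
    fix y assume "y \<in> Pow H \<times> {0, 1 :: nat}"
    then obtain T m where y: "y = (T, m)" "T \<subseteq> g ` (F - {x})" "m = 0 \<or> m = 1" using im by auto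
    then obtain S where S: "S \<subseteq> F - {x}" "T = g ` S" using subset_imageE by metis
    have "S - {x} = S" "insert x S - {x} = S" "x \<notin> S" using S by auto
    then show "y \<in> (\<lambda>S. (g ` (S - {x}), of_bool (x \<in> S) :: nat)) ` Pow F"
      using S y x by (intro image_eqI[of _ _ "if m = 1 then insert x S else S"]) auto
  qed
qed

text \<open>Each row of \<open>c\<close> exceeds the larger of \<open>a r\<close> and
  \<open>b r\<close> by at most one, and each row of \<open>e\<close> falls short of the smaller by
  at most one. So \<open>c\<close> is a subset of the rows \<open>F\<close> where a box may be added
  and \<open>e\<close> a subset of the rows \<open>H\<close> where one may be removed, all choices
  being independent. \<open>F\<close> has one row more than \<open>H\<close>, and its spare row
  \<open>x\<close> is the extra bit.\<close>

lemma local_hv: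
  assumes a: "part a" and b: "part b"
  shows "\<exists>\<beta>. size_bij (\<lambda>c. card (dg c)) \<beta>
    {c. part c \<and> (\<forall>r. a r \<le> c r \<and> c (Suc r) \<le> a r) \<and> (\<forall>r. b r \<le> c r \<and> c r \<le> Suc (b r))}
    {e. part e \<and> (\<forall>r. e r \<le> a r \<and> a r \<le> Suc (e r)) \<and> (\<forall>r. e r \<le> b r \<and> b (Suc r) \<le> e r)}
    {0, 1} (card (dg a) + card (dg b))" (is "\<exists>\<beta>. size_bij _ \<beta> ?A ?B _ _")
proof (cases "\<forall>r. a r \<le> Suc (b r) \<and> b (Suc r) \<le> a r")
  case False
  have "a r \<le> Suc (b r) \<and> b (Suc r) \<le> a r" if "c \<in> ?A" for c r
    using that by (auto intro: le_trans)
  then have A: "?A = {}" using False by blast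
  have "a r \<le> Suc (b r) \<and> b (Suc r) \<le> a r" if "e \<in> ?B" for e r
  proof -
    have "a r \<le> Suc (e r)" "e r \<le> b r" "b (Suc r) \<le> e r" "e r \<le> a r" using that by auto
    then show ?thesis by linarith
  qed
  then have B: "?B = {}" using False by blast
  show ?thesis unfolding A B using size_bij_empty by blast
next
  case True
  then have nec: "a r \<le> Suc (b r)" "b (Suc r) \<le> a r" for r by auto
  obtain N where N: "\<And>r. N \<le> r \<Longrightarrow> a r = 0" "\<And>r. N \<le> r \<Longrightarrow> b r = 0"
  proof -
    obtain N1 N2 where "\<forall>r\<ge>N1. a r = 0" "\<forall>r\<ge>N2. b r = 0" using a b by (auto simp: part_def)
    then show thesis by (intro that[of "max N1 N2"]) auto
  qed
  have am: "a (Suc r) \<le> a r" and bm: "b (Suc r) \<le> b r" for r using a b by (auto simp: part_def)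
  \<comment> \<open>Room for one more box at the end of row \<open>r\<close>, which is automatic in
    row 0. The condition for removing a box from row \<open>r\<close> is \<open>s (Suc r)\<close>,
    which makes the comparison of \<open>F\<close> and \<open>H\<close> telescope. If
    \<open>a r > b r\<close>, both \<open>c r\<close> and \<open>e r\<close> are forced.\<close>
  define s where "s r = (r = 0 \<or> b r < a (r - 1))" for r
  define F where "F = {r. a r \<le> b r \<and> s r}"
  define H where "H = {r. a r \<le> b r \<and> s (Suc r)}"
  have s_Suc: "s (Suc r) \<longleftrightarrow> b (Suc r) < a r" for r by (simp add: s_def)
  have sN: "\<not> s r" if "Suc N \<le> r" for r using that N by (cases r) (auto simp: s_def)
  have F_sub: "F \<subseteq> {..<Suc N}"
    using sN by (auto simp: F_def) (meson linorder_not_less)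
  have H_sub: "H \<subseteq> {..<Suc N}"
  proof
    fix r assume "r \<in> H"
    then have "\<not> Suc N \<le> Suc r" using sN[of "Suc r"] by (auto simp: H_def)
    then show "r \<in> {..<Suc N}" by simp
  qed
  from F_sub H_sub have fin: "finite F" "finite H" using finite_subset by blast+
  text \<open>Where \<open>a r > b r\<close>, both neighbouring comparisons hold, so the numbers of free rows on the
    two sides differ by a telescoping sum.\<close>
  have "card F = card H + 1"
  proof -
    have "int (card F) - int (card H) =
        (\<Sum>r<Suc N. of_bool (r \<in> F)) - (\<Sum>r<Suc N. of_bool (r \<in> H))"
      using F_sub H_sub by (simp add: Int_absorb1 del: sum.lessThan_Suc)
    also have "\<dots> = (\<Sum>r<Suc N. of_bool (s r) - of_bool (s (Suc r)))"
      unfolding sum_subtractf[symmetric]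
    proof (rule sum.cong[OF refl])
      fix r
      have "s r" "s (Suc r)" if "b r < a r"
        using that nec(1)[of "r"] am[of "r - 1"] bm[of r] by (cases r; auto simp: s_def)+
      then show "(of_bool (r \<in> F) :: int) - of_bool (r \<in> H) = of_bool (s r) - of_bool (s (Suc r))"
        by (cases "b r < a r") (auto simp: F_def H_def)
    qed
    also have "\<dots> = of_bool (s 0) - of_bool (s (Suc N))" by (rule sum_lessThan_telescope')
    also have "\<dots> = 1" using sN[of "Suc N"] by (simp add: s_def)
    finally show ?thesis by simp
  qed
  then obtain x where x: "x \<in> F" by fastforce
  have "card (F - {x}) = card H" using x fin \<open>card F = card H + 1\<close> by simp
  \<comment> \<open>Any bijection will do, because the sizes depend only on the number of chosen
    rows.\<close>
  then obtain g where g: "bij_betw g (F - {x}) H"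
    using finite_same_card_bij[of "F - {x}" H] fin by auto
  define up where "up S r = max (a r) (b r) + of_bool (r \<in> S)" for S r
  define dn where "dn S r = min (a r) (b r) - of_bool (r \<in> S)" for S r
  have upF: "a r \<le> b r" "r = 0 \<or> b r < a (r - 1)" if "r \<in> F" for r using that by (auto simp: F_def s_def)
  have dnH: "a r \<le> b r" "b (Suc r) < a r" if "r \<in> H" for r using that by (auto simp: H_def s_def)
  have up_P: "\<forall>c\<in>?A. up {r. max (a r) (b r) < c r} = c"
    proof
      fix c assume c: "c \<in> ?A"
      have "up {r. max (a r) (b r) < c r} r = c r" for r
      proof -
        have "a r \<le> c r" "b r \<le> c r" "c r \<le> Suc (b r)" using c by auto
        then show ?thesis unfolding up_def of_bool_def mem_Collect_eq by presburger
      qed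
      then show "up {r. max (a r) (b r) < c r} = c" by blast
    qed
  have A_bij: "bij_betw (\<lambda>c. {r. max (a r) (b r) < c r}) ?A (Pow F)"
  proof (rule bij_betw_byWitness[where f' = up, OF up_P])
    show "\<forall>S\<in>Pow F. {r. max (a r) (b r) < up S r} = S" by (auto simp: up_def)
    show "(\<lambda>c. {r. max (a r) (b r) < c r}) ` ?A \<subseteq> Pow F"
    proof (clarsimp simp: F_def)
      fix c r assume c: "\<forall>r. a r \<le> c r \<and> c (Suc r) \<le> a r" "\<forall>r. b r \<le> c r \<and> c r \<le> Suc (b r)"
        "a r < c r" "b r < c r"
      then have "a r < c r" "c r \<le> Suc (b r)" by auto
      then have "a r \<le> b r" by linarith
      moreover have "s r"
      proof (cases r)
        case (Suc q)
        then have "c r \<le> a q" using c(1) by blast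
        then show ?thesis using Suc c(4) by (simp add: s_def)
      qed (simp add: s_def)
      ultimately show "a r \<le> b r \<and> s r" by blast
    qed
    show "up ` Pow F \<subseteq> ?A"
    proof clarify
      fix S assume S: "S \<subseteq> F"
      have up1: "a r \<le> up S r" "b r \<le> up S r" for r by (auto simp: up_def)
      have up2: "up S r \<le> Suc (b r)" for r using S upF(1)[of r] nec(1)[of r] by (auto simp: up_def)
      have up3: "up S (Suc r) \<le> a r" for r
        using S upF[of "Suc r"] nec(2)[of r] am[of r] by (auto simp: up_def)
      have "up S (Suc r) \<le> up S r" for r using up3[of r] up1(1)[of r] by linarith
      moreover have "up S r = 0" if "Suc N \<le> r" for r
        using that up3[of "r - 1"] N(1)[of "r - 1"] by (cases r) auto
      ultimately have "part (up S)" unfolding part_def by blast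
      then show "part (up S) \<and> (\<forall>r. a r \<le> up S r \<and> up S (Suc r) \<le> a r) \<and>
          (\<forall>r. b r \<le> up S r \<and> up S r \<le> Suc (b r))"
        using up1 up2 up3 by blast
    qed
  qed
  have B_bij: "bij_betw dn (Pow H) ?B"
  proof (rule bij_betw_byWitness[where f' = "\<lambda>e. {r. e r < min (a r) (b r)}"])
    show "\<forall>S\<in>Pow H. {r. dn S r < min (a r) (b r)} = S"
    proof
      fix S assume S: "S \<in> Pow H"
      have "dn S r < min (a r) (b r) \<longleftrightarrow> r \<in> S" for r
        using S dnH[of r] by (cases "r \<in> S") (auto simp: dn_def)
      then show "{r. dn S r < min (a r) (b r)} = S" by blast
    qed
    show "\<forall>e\<in>?B. dn {r. e r < min (a r) (b r)} = e"
    proof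
      fix e assume e: "e \<in> ?B"
      have "dn {r. e r < min (a r) (b r)} r = e r" for r
      proof -
        have "e r \<le> a r" "a r \<le> Suc (e r)" "e r \<le> b r" using e by auto
        then show ?thesis by (auto simp: dn_def min_def)
      qed
      then show "dn {r. e r < min (a r) (b r)} = e" by blast
    qed
    show "(\<lambda>e. {r. e r < min (a r) (b r)}) ` ?B \<subseteq> Pow H"
    proof (clarsimp simp: H_def s_Suc)
      fix e r assume e: "\<forall>r. e r \<le> a r \<and> a r \<le> Suc (e r)" "\<forall>r. e r \<le> b r \<and> b (Suc r) \<le> e r"
        "e r < a r" "e r < b r"
      then have "a r \<le> Suc (e r)" "b (Suc r) \<le> e r" by auto
      then show "a r \<le> b r \<and> b (Suc r) < a r" using e(3,4) by linarith
    qed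
    show "dn ` Pow H \<subseteq> ?B"
    proof clarify
      fix S assume S: "S \<subseteq> H"
      have dn1: "dn S r \<le> a r" "dn S r \<le> b r" for r by (auto simp: dn_def)
      have dn2: "a r \<le> Suc (dn S r)" for r using S dnH(1)[of r] nec(1)[of r] by (auto simp: dn_def)
      have dn3: "b (Suc r) \<le> dn S r" for r
        using S dnH[of r] nec(2)[of r] bm[of r] by (auto simp: dn_def)
      have "dn S (Suc r) \<le> dn S r" for r using dn3[of r] dn1(2)[of "Suc r"] by linarith
      moreover have "dn S r = 0" if "N \<le> r" for r using dn1(1)[of r] N(1)[OF that] by simp
      ultimately have "part (dn S)" unfolding part_def by blast
      then show "part (dn S) \<and> (\<forall>r. dn S r \<le> a r \<and> a r \<le> Suc (dn S r)) \<and>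
          (\<forall>r. dn S r \<le> b r \<and> b (Suc r) \<le> dn S r)"
        using dn1 dn2 dn3 by blast
    qed
  qed
  define P where "P c = {r. max (a r) (b r) < c r}" for c
  define \<beta> where "\<beta> c = (dn (g ` (P c - {x})), of_bool (x \<in> P c) :: nat)" for c
  have "bij_betw \<beta> ?A (?B \<times> {0, 1})"
  proof -
    have 1: "bij_betw P ?A (Pow F)" using A_bij unfolding P_def .
    have 2: "bij_betw (map_prod dn id) (Pow H \<times> {0, 1 :: nat}) (?B \<times> {0, 1})"
      using bij_betw_map_prod[OF B_bij bij_betw_id] .
    have "\<beta> = map_prod dn id \<circ> ((\<lambda>S. (g ` (S - {x}), of_bool (x \<in> S))) \<circ> P)"
      by (auto simp: \<beta>_def)
    then show ?thesis
      using bij_betw_trans[OF bij_betw_trans[OF 1 Pow_split_bij[OF g x]] 2] by simp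
  qed
  moreover have "card (dg c) + card (dg (fst (\<beta> c))) = card (dg a) + card (dg b) + snd (\<beta> c)"
    if c: "c \<in> ?A" for c
  proof -
    have "P c \<in> Pow F" unfolding P_def by (rule bij_betw_apply[OF A_bij c])
    then have PF: "P c \<subseteq> F" by simp
    define T where "T = g ` (P c - {x})"
    have T: "T \<subseteq> H" using PF g unfolding T_def by (auto simp: bij_betw_def)
    have cT: "card T = card (P c - {x})"
      unfolding T_def using g PF by (intro card_image) (auto simp: bij_betw_def intro: inj_on_subset)
    have finP: "finite (P c)" using PF fin finite_subset by blast
    have cP: "card (P c) = card T + of_bool (x \<in> P c)"
    proof (cases "x \<in> P c")
      case True
      then show ?thesis unfolding cT using card.remove[OF finP True] by (simp only: of_bool_eq Suc_eq_plus1)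
    next
      case False
      then show ?thesis unfolding cT by simp
    qed
    have cup: "c r = up (P c) r" for r
      using up_P c by (simp add: P_def)
    have "card (dg c) = (\<Sum>r<Suc N. c r)"
    proof (rule card_dg, intro allI impI)
      fix r assume "Suc N \<le> r"
      then show "c r = 0" using c N(1)[of "r - 1"] by (cases r) (auto, metis le_zero_eq)
    qed
    also have "\<dots> = (\<Sum>r<Suc N. max (a r) (b r) + of_bool (r \<in> P c))"
      by (rule sum.cong[OF refl], rule cup[unfolded up_def])
    also have "\<dots> = (\<Sum>r<Suc N. max (a r) (b r)) + card (P c)"
      using PF F_sub by (simp add: sum.distrib Int_absorb1 del: sum.lessThan_Suc)
    finally have 1: "card (dg c) = (\<Sum>r<Suc N. max (a r) (b r)) + card (P c)" .
    have "card (dg (dn T)) = (\<Sum>r<Suc N. dn T r)"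
      by (rule card_dg) (use N in \<open>auto simp: dn_def\<close>)
    then have "card (dg (dn T)) + card T = (\<Sum>r<Suc N. dn T r + of_bool (r \<in> T))"
      using T H_sub by (simp add: sum.distrib Int_absorb1 del: sum.lessThan_Suc)
    also have "\<dots> = (\<Sum>r<Suc N. min (a r) (b r))"
      using T dnH by (intro sum.cong) (force simp: dn_def)+
    finally have 2: "card (dg (dn T)) + card T = (\<Sum>r<Suc N. min (a r) (b r))" .
    have "(\<Sum>r<Suc N. max (a r) (b r)) + (\<Sum>r<Suc N. min (a r) (b r)) =
        (\<Sum>r<Suc N. a r) + (\<Sum>r<Suc N. b r)"
      unfolding sum.distrib[symmetric] by (intro sum.cong) auto
    moreover have "card (dg a) = (\<Sum>r<Suc N. a r)" "card (dg b) = (\<Sum>r<Suc N. b r)"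
      using N by (auto intro!: card_dg simp del: sum.lessThan_Suc)
    ultimately show ?thesis using 1 2 cP by (simp add: \<beta>_def T_def)
  qed
  ultimately show ?thesis unfolding size_bij_def by blast
qed

section \<open>Exchange of strips of either kind\<close>

definition strip :: "bool \<Rightarrow> diagram \<Rightarrow> diagram \<Rightarrow> bool" where
  "strip h D E \<longleftrightarrow> (if h then hstrip D E else vstrip D E)"

definition above :: "bool \<Rightarrow> bool \<Rightarrow> diagram \<Rightarrow> diagram \<Rightarrow> diagram set" where
  "above t t' D E = {N. young N \<and> strip t D N \<and> strip t' E N}"

text \<open>The kinds change places: after the exchange the removal of kind \<open>t'\<close> starts
  from \<open>D\<close>, and the addition of kind \<open>t\<close> leads to
  \<open>E\<close>.\<close>

definition below :: "bool \<Rightarrow> bool \<Rightarrow> diagram \<Rightarrow> diagram \<Rightarrow> diagram set" where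
  "below t t' D E = {K. young K \<and> strip t' K D \<and> strip t K E}"

lemma size_bij_transfer:
  assumes \<beta>: "size_bij (\<lambda>c. sz (f c)) \<beta> A B M x" and f: "inj_on f A"
    "inj_on f B"
  shows "\<exists>\<beta>'. size_bij sz \<beta>' (f ` A) (f ` B) M x"
proof -
  define \<beta>' where "\<beta>' = map_prod f id \<circ> (\<beta> \<circ> inv_into A f)"
  have 1: "bij_betw (inv_into A f) (f ` A) A"
    using f(1) by (simp add: bij_betw_inv_into inj_on_imp_bij_betw)
  have 2: "bij_betw \<beta> A (B \<times> M)" using \<beta> by (simp add: size_bij_def)
  have "bij_betw f B (f ` B)" using f(2) by (rule inj_on_imp_bij_betw)
  then have 3: "bij_betw (map_prod f id) (B \<times> M) (f ` B \<times> M)" by (rule bij_betw_map_prod) simp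
  have "bij_betw \<beta>' (f ` A) (f ` B \<times> M)"
    unfolding \<beta>'_def using bij_betw_trans[OF bij_betw_trans[OF 1 2] 3] by (simp add: comp_assoc)
  moreover have "sz (f c) + sz (fst (\<beta>' (f c))) = x + snd (\<beta>' (f c))" if "c \<in> A" for c
    using \<beta> that f(1) by (simp add: size_bij_def \<beta>'_def inv_into_f_f)
  ultimately show ?thesis unfolding size_bij_def by blast
qed

lemma young_converse: "young D \<Longrightarrow> young (D\<inverse>)"
  unfolding young_def finite_converse converse_iff by blast

lemma vstrip_converse: "vstrip D E \<longleftrightarrow> hstrip (D\<inverse>) (E\<inverse>)"
  unfolding hstrip_def vstrip_def converse_mono converse_iff by blast

text \<open>Transposing the diagrams turns two vertical strips into two horizontal ones and keeps
  sizes; the two mixed cases are mirror images under exchanging \<open>D\<close> and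
  \<open>E\<close>.\<close>

lemma local_strip:
  assumes D: "young D" and E: "young E"
  shows "\<exists>\<beta>. size_bij card \<beta> (above t t' D E) (below t t' D E) (if t = t' then UNIV else {0, 1})
    (card D + card E)"
proof -
  have dg_image: "{N. young N \<and> P N} = dg ` {c. part c \<and> P (dg c)}" for P
    by (auto simp: young_dg_iff elim: young_ex_dg)
  have inj: "inj_on dg A" for A by (simp add: inj_on_def dg_inj)
  have hh: "\<exists>\<beta>. size_bij card \<beta> (above True True D E) (below True True D E) UNIV (card D + card E)"
    if y: "young D" "young E" for D E
  proof -
    obtain a where a: "part a" "D = dg a" using y(1) by (rule young_ex_dg)
    obtain b where b: "part b" "E = dg b" using y(2) by (rule young_ex_dg)
    show ?thesis
      unfolding above_def below_def strip_def dg_image a(2) b(2) if_True hstrip_dg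
      by (rule exE[OF local_hh[OF a(1) b(1)]], rule size_bij_transfer[OF _ inj inj])
  qed
  have hv: "\<exists>\<beta>. size_bij card \<beta> (above True False D E) (below True False D E) {0, 1} (card D + card E)"
    if y: "young D" "young E" for D E
  proof -
    obtain a where a: "part a" "D = dg a" using y(1) by (rule young_ex_dg)
    obtain b where b: "part b" "E = dg b" using y(2) by (rule young_ex_dg)
    show ?thesis
      unfolding above_def below_def strip_def dg_image a(2) b(2) if_True if_False hstrip_dg vstrip_dg
      by (rule exE[OF local_hv[OF a(1) b(1)]], rule size_bij_transfer[OF _ inj inj])
  qed
  have conv_image: "{N. young N \<and> P (N\<inverse>)} = converse ` {N. young N \<and> P N}" for P
  proof (intro equalityI subsetI)
    fix N assume "N \<in> {N. young N \<and> P (N\<inverse>)}"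
    then show "N \<in> converse ` {N. young N \<and> P N}"
      using young_converse[of N] by (intro image_eqI[of _ _ "N\<inverse>"]) auto
  next
    fix N assume "N \<in> converse ` {N. young N \<and> P N}"
    then show "N \<in> {N. young N \<and> P (N\<inverse>)}" using young_converse by auto
  qed
  have vv: "\<exists>\<beta>. size_bij card \<beta> (above False False D E) (below False False D E) UNIV (card D + card E)"
    if y: "young D" "young E" for D E
  proof -
    have "above False False D E = converse ` above True True (D\<inverse>) (E\<inverse>)"
      "below False False D E = converse ` below True True (D\<inverse>) (E\<inverse>)"
      unfolding above_def below_def strip_def if_True if_False vstrip_converse by (rule conv_image)+
    moreover have "inj_on converse (A :: diagram set)" for A by (simp add: inj_on_def)
    moreover obtain \<beta> where "size_bij card \<beta> (above True True (D\<inverse>) (E\<inverse>))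
        (below True True (D\<inverse>) (E\<inverse>)) UNIV (card D + card E)"
      using hh[OF young_converse[OF y(1)] young_converse[OF y(2)]] unfolding card_inverse by blast
    then have "size_bij (\<lambda>c. card (c\<inverse>)) \<beta> (above True True (D\<inverse>) (E\<inverse>))
        (below True True (D\<inverse>) (E\<inverse>)) UNIV (card D + card E)" by simp
    ultimately show ?thesis by (simp only: size_bij_transfer)
  qed
  show ?thesis
  proof (cases t; cases t')
    assume "t" "t'"
    then show ?thesis using hh[OF D E] by simp
  next
    assume "t" "\<not> t'"
    then show ?thesis using hv[OF D E] by simp
  next
    assume "\<not> t" "t'"
    moreover have "above False True D E = above True False E D" "below False True D E = below True False E D"
      by (auto simp: above_def below_def)
    ultimately show ?thesis using hv[OF E D] by (simp add: add.commute)
  next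
    assume "\<not> t" "\<not> t'"
    then show ?thesis using vv[OF D E] by simp
  qed
qed

section \<open>The generating function of sequences of diagrams\<close>

definition grow :: "diamond \<Rightarrow> bool" where
  "grow x \<longleftrightarrow> x \<in> {Prec, Prec'}"

definition hor :: "diamond \<Rightarrow> bool" where
  "hor x \<longleftrightarrow> x \<in> {Prec, Succ}"

definition step :: "diamond \<Rightarrow> diagram \<Rightarrow> diagram \<Rightarrow> bool" where
  "step x D E \<longleftrightarrow> (if grow x then strip (hor x) D E else strip (hor x) E D)"

definition paths :: "nat \<Rightarrow> (nat \<Rightarrow> diamond) \<Rightarrow> (nat \<Rightarrow> diagram) set" where
  "paths k d = {l. (\<forall>j. young (l j)) \<and> (\<forall>j. j = 0 \<or> k \<le> j \<longrightarrow> l j = {}) \<and>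
     (\<forall>j<k. step (d (Suc j)) (l j) (l (Suc j)))}"

text \<open>Step \<open>j\<close> is taken at position \<open>p j\<close>, so the \<open>j\<close>-th diagram persists for
  \<open>p (Suc j) - p j\<close> units of time. Exchanging two adjacent steps together with their positions
  makes this negative in between.\<close>

definition wt :: "nat \<Rightarrow> (nat \<Rightarrow> int) \<Rightarrow> (nat \<Rightarrow> diagram) \<Rightarrow> int" where
  "wt k p l = (\<Sum>j\<le>k. (p (Suc j) - p j) * int (card (l j)))"

definition pairs :: "nat \<Rightarrow> (nat \<Rightarrow> diamond) \<Rightarrow> (nat \<times> nat) set" where
  "pairs k d = {(i, j). 1 \<le> i \<and> i < j \<and> j \<le> k \<and> d i \<in> {Prec, Prec'} \<and> d j \<in> {Succ, Succ'}}"

lemma pairs_iff: "(i, j) \<in> pairs k d \<longleftrightarrow> 1 \<le> i \<and> i < j \<and> j \<le> k \<and> grow (d i) \<and> \<not> grow (d j)"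
  by (cases "d j") (auto simp: pairs_def grow_def)

lemma finite_pairs: "finite (pairs k d)"
  by (rule finite_subset[of _ "{..k} \<times> {..k}"]) (auto simp: pairs_def)

text \<open>Bijections of the \<open>m\<close>-th entry that depend only on the other entries
  combine to a bijection of whole sequences, since changing that entry leaves the bijection in force
  unchanged.\<close>

lemma fun_upd_bij:
  assumes R: "\<And>l X. R (l(m := X)) \<longleftrightarrow> R l"
    and A: "\<And>l X. A (l(m := X)) = A l" and B: "\<And>l X. B (l(m := X)) = B l"
    and \<beta>: "\<And>l X. \<beta> (l(m := X)) = \<beta> l"
    and bij: "\<And>l. R l \<Longrightarrow> bij_betw (\<beta> l) (A l) (B l \<times> M)"
  shows "bij_betw (\<lambda>l. (l(m := fst (\<beta> l (l m))), snd (\<beta> l (l m))))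
    {l. R l \<and> l m \<in> A l} ({l. R l \<and> l m \<in> B l} \<times> M)"
proof (rule bij_betw_byWitness[where f' = "\<lambda>(l, x). l(m := inv_into (A l) (\<beta> l) (l m, x))"])
  show "\<forall>l\<in>{l. R l \<and> l m \<in> A l}. (\<lambda>(l, x). l(m := inv_into (A l) (\<beta> l) (l m, x)))
      (l(m := fst (\<beta> l (l m))), snd (\<beta> l (l m))) = l"
    using bij_betw_inv_into_left[OF bij] by (simp add: A \<beta>)
  show "\<forall>y\<in>{l. R l \<and> l m \<in> B l} \<times> M. (\<lambda>l. (l(m := fst (\<beta> l (l m))), snd (\<beta> l (l m))))
      ((\<lambda>(l, x). l(m := inv_into (A l) (\<beta> l) (l m, x))) y) = y"
    using bij_betw_inv_into_right[OF bij] by (auto simp: A \<beta>)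
  show "(\<lambda>l. (l(m := fst (\<beta> l (l m))), snd (\<beta> l (l m)))) ` {l. R l \<and> l m \<in> A l} \<subseteq>
      {l. R l \<and> l m \<in> B l} \<times> M"
  proof (rule image_subsetI)
    fix l assume "l \<in> {l. R l \<and> l m \<in> A l}"
    then have "R l" "l m \<in> A l" by auto
    then have "\<beta> l (l m) \<in> B l \<times> M" using bij_betw_apply[OF bij] by blast
    then show "(l(m := fst (\<beta> l (l m))), snd (\<beta> l (l m))) \<in> {l. R l \<and> l m \<in> B l} \<times> M"
      using \<open>R l\<close> by (auto simp: R B mem_Times_iff)
  qed
  show "(\<lambda>(l, x). l(m := inv_into (A l) (\<beta> l) (l m, x))) ` ({l. R l \<and> l m \<in> B l} \<times> M) \<subseteq>
      {l. R l \<and> l m \<in> A l}"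
  proof (rule image_subsetI)
    fix y assume "y \<in> {l. R l \<and> l m \<in> B l} \<times> M"
    then obtain l x where y: "y = (l, x)" and "R l" "l m \<in> B l" "x \<in> M" by auto
    then have "inv_into (A l) (\<beta> l) (l m, x) \<in> A l"
      using bij_betw_apply[OF bij_betw_inv_into[OF bij]] by blast
    then show "(\<lambda>(l, x). l(m := inv_into (A l) (\<beta> l) (l m, x))) y \<in> {l. R l \<and> l m \<in> A l}"
      using \<open>R l\<close> by (simp add: y R A)
  qed
qed

section \<open>Exchange of two adjacent steps in a sequence of diagrams\<close>

definition sw :: "nat \<Rightarrow> nat \<Rightarrow> nat" where
  "sw m i = (if i = m then Suc m else if i = Suc m then m else i)"

lemma sw_simps [simp]: "sw m m = Suc m" "sw m (Suc m) = m" "sw m (sw m i) = i"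
  "i \<noteq> m \<Longrightarrow> i \<noteq> Suc m \<Longrightarrow> sw m i = i"
  by (auto simp: sw_def)

text \<open>The first group of conditions mentions only \<open>d\<close>, so it is shared by the
  original and the exchanged sequence of steps; only the condition on \<open>l m\<close>
  differs.\<close>

lemma paths_split:
  fixes d d' :: "nat \<Rightarrow> diamond"
  assumes m: "1 \<le> m" "m < k"
    and dd: "\<And>j. j \<noteq> m \<Longrightarrow> j \<noteq> Suc m \<Longrightarrow> d' j = d j"
  shows "paths k d' = {l. ((\<forall>j. j \<noteq> m \<longrightarrow> young (l j)) \<and> (\<forall>j. j = 0 \<or> k \<le> j \<longrightarrow> l j = {}) \<and>
      (\<forall>j<k. j \<noteq> m \<and> Suc j \<noteq> m \<longrightarrow> step (d (Suc j)) (l j) (l (Suc j)))) \<and>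
      l m \<in> {X. young X \<and> step (d' m) (l (m - 1)) X \<and> step (d' (Suc m)) X (l (Suc m))}}"
    (is "_ = ?R")
proof (intro equalityI subsetI)
  fix l assume l: "l \<in> paths k d'"
  then have st: "step (d' (Suc j)) (l j) (l (Suc j))" if "j < k" for j using that by (simp add: paths_def)
  have "step (d (Suc j)) (l j) (l (Suc j))" if "j < k" "j \<noteq> m" "Suc j \<noteq> m" for j
    using st[of j] that dd[of "Suc j"] by simp
  moreover have "step (d' m) (l (m - 1)) (l m)" using st[of "m - 1"] m by simp
  ultimately show "l \<in> ?R" using l st[OF m(2)] by (simp add: paths_def)
next
  fix l assume l: "l \<in> ?R"
  have "step (d' (Suc j)) (l j) (l (Suc j))" if "j < k" for j
  proof -
    consider "j = m" | "Suc j = m" | "j \<noteq> m" "Suc j \<noteq> m" by blast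
    then show ?thesis using l that dd[of "Suc j"] by cases auto
  qed
  moreover have "young (l j)" for j using l by (cases "j = m") auto
  ultimately show "l \<in> paths k d'" using l by (simp add: paths_def)
qed

text \<open>Exchanging \<open>p m\<close> and \<open>p (Suc m)\<close> negates the coefficient of
  the middle diagram and adds their difference to the coefficients of its two neighbours. The change
  of weight is then that difference times the defect in the size relation.\<close>

lemma wt_swap:
  assumes m: "1 \<le> m" "m < k" and l: "\<And>j. j \<noteq> m \<Longrightarrow> l' j = l j"
    and size: "card (l m) + card (l' m) = card (l (m - 1)) + card (l (Suc m)) + x"
  shows "wt k p l = wt k (p \<circ> sw m) l' + (p (Suc m) - p m) * int x"
proof -
  obtain q where q: "m = Suc q" using m by (cases m) auto
  define f where "f j = (p (Suc j) - p j) * int (card (l j))" for j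
  define f' where "f' j = ((p \<circ> sw m) (Suc j) - (p \<circ> sw m) j) * int (card (l' j))" for j
  have "wt k p l - wt k (p \<circ> sw m) l' = (\<Sum>j\<le>k. f j - f' j)"
    by (simp add: wt_def f_def f'_def sum_subtractf)
  also have "\<dots> = (\<Sum>j\<in>{q, Suc q, Suc (Suc q)}. f j - f' j)"
    using m by (intro sum.mono_neutral_right) (auto simp: q f_def f'_def l sw_def)
  also have "\<dots> = (p (Suc m) - p m) *
      (int (card (l m)) + int (card (l' m)) - int (card (l q)) - int (card (l (Suc m))))"
    using l[of q] l[of "Suc m"] by (simp add: f_def f'_def q sw_def algebra_simps)
  also have "int (card (l m)) + int (card (l' m)) - int (card (l q)) - int (card (l (Suc m))) = int x"
    using size by (simp add: q)
  finally show ?thesis by linarith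
qed

lemma path_swap_bij:
  assumes m: "1 \<le> m" "m < k" and gr: "grow (d m)" "\<not> grow (d (Suc m))"
  shows "\<exists>\<Phi>. bij_betw \<Phi> (paths k d)
      (paths k (d \<circ> sw m) \<times> (if hor (d m) = hor (d (Suc m)) then UNIV else {0, 1})) \<and>
    (\<forall>l\<in>paths k d. wt k p l = wt k (p \<circ> sw m) (fst (\<Phi> l)) + (p (Suc m) - p m) * int (snd (\<Phi> l)))"
proof -
  define t t' where "t = hor (d m)" and "t' = hor (d (Suc m))"
  define M :: "nat set" where "M = (if t = t' then UNIV else {0, 1})"
  have "\<forall>D E. \<exists>\<beta>. young D \<and> young E \<longrightarrow>
      size_bij card \<beta> (above t t' D E) (below t t' D E) M (card D + card E)"
    using local_strip unfolding M_def by blast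
  then obtain \<beta> where \<beta>: "\<And>D E. young D \<Longrightarrow> young E \<Longrightarrow>
      size_bij card (\<beta> D E) (above t t' D E) (below t t' D E) M (card D + card E)" by metis
  define R where "R l \<longleftrightarrow> (\<forall>j. j \<noteq> m \<longrightarrow> young (l j)) \<and> (\<forall>j. j = 0 \<or> k \<le> j \<longrightarrow> l j = {}) \<and>
      (\<forall>j<k. j \<noteq> m \<and> Suc j \<noteq> m \<longrightarrow> step (d (Suc j)) (l j) (l (Suc j)))" for l :: "nat \<Rightarrow> diagram"
  define A where "A l = above t t' (l (m - 1)) (l (Suc m))" for l :: "nat \<Rightarrow> diagram"
  define B where "B l = below t t' (l (m - 1)) (l (Suc m))" for l :: "nat \<Rightarrow> diagram"
  define b where "b l = \<beta> (l (m - 1)) (l (Suc m))" for l :: "nat \<Rightarrow> diagram"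
  have P: "paths k d = {l. R l \<and> l m \<in> A l}"
    unfolding paths_split[OF m, of d d, OF refl] R_def A_def above_def
    using gr by (simp add: step_def t_def t'_def)
  have Q: "paths k (d \<circ> sw m) = {l. R l \<and> l m \<in> B l}"
    by (subst paths_split[OF m, of _ d]) (use gr in \<open>simp_all add: R_def B_def below_def step_def t_def t'_def\<close>)
  have upd: "R (l(m := X)) \<longleftrightarrow> R l" "A (l(m := X)) = A l" "B (l(m := X)) = B l" "b (l(m := X)) = b l" for l X
    using m by (auto simp: R_def A_def B_def b_def)
  have y: "young (l (m - 1))" "young (l (Suc m))" if "R l" for l using that m by (auto simp: R_def)
  define \<Phi> where "\<Phi> l = (l(m := fst (b l (l m))), snd (b l (l m)))" for l
  have bij: "bij_betw \<Phi> (paths k d) (paths k (d \<circ> sw m) \<times> M)"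
    unfolding P Q \<Phi>_def
  proof (rule fun_upd_bij[where A = A and B = B, OF upd])
    fix l assume "R l"
    then show "bij_betw (b l) (A l) (B l \<times> M)"
      using \<beta>[OF y] by (simp add: size_bij_def A_def B_def b_def)
  qed
  have "wt k p l = wt k (p \<circ> sw m) (fst (\<Phi> l)) + (p (Suc m) - p m) * int (snd (\<Phi> l))" if l: "l \<in> paths k d" for l
  proof (rule wt_swap[OF m])
    have "R l" "l m \<in> A l" using l P by auto
    then show "card (l m) + card (fst (\<Phi> l) m) = card (l (m - 1)) + card (l (Suc m)) + snd (\<Phi> l)"
      using \<beta>[OF y] by (simp add: size_bij_def A_def b_def \<Phi>_def)
  qed (simp add: \<Phi>_def)
  then show ?thesis using bij unfolding M_def t_def t'_def by blast
qed

text \<open>Weights are integers since exchanged positions give negative coefficients, while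
  \<open>gf\<close> records only natural values. This condition ensures that \<open>gf\<close>
  misses no element and that its coefficients are true cardinalities.\<close>

definition good :: "'a set \<Rightarrow> ('a \<Rightarrow> int) \<Rightarrow> bool" where
  "good P w \<longleftrightarrow> (\<forall>l\<in>P. 0 \<le> w l) \<and> (\<forall>n::nat. finite {l \<in> P. w l = int n})"

definition gf :: "'a set \<Rightarrow> ('a \<Rightarrow> int) \<Rightarrow> rat fps" where
  "gf P w = Abs_fps (\<lambda>n. of_nat (card {l \<in> P. w l = int n}))"

text \<open>A level of \<open>P\<close> corresponds to the pairs of an element of \<open>Q\<close>
  and a parameter of total weight \<open>n\<close>. With unbounded parameter the geometric series is
  expressed by the recursion for these pairs, that is, by multiplying with
  \<open>1 - fps_X ^ q\<close>. Finiteness uses \<open>0 < q\<close>, which bounds the parameter by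
  \<open>n\<close>.\<close>

lemma gf_bij:
  assumes bij: "bij_betw \<Phi> P (Q \<times> M)" and q: "0 < q"
    and w: "\<And>l. l \<in> P \<Longrightarrow> w l = v (fst (\<Phi> l)) + int q * int (snd (\<Phi> l))"
    and good: "good Q v"
  shows "good P w"
    and "M = {0, 1} \<Longrightarrow> gf P w = gf Q v * (1 + fps_X ^ q)"
    and "M = UNIV \<Longrightarrow> gf P w * (1 - fps_X ^ q) = gf Q v"
proof -
  define L where "L n = {(b, x). b \<in> Q \<and> x \<in> M \<and> v b + int q * int x = int n}" for n
  define K where "K n = {b \<in> Q. v b = int n}" for n
  have v0: "0 \<le> v b" if "b \<in> Q" for b using good that by (simp add: good_def)
  have finK: "finite (K n)" for n using good by (simp add: good_def K_def)
  have bijL: "bij_betw \<Phi> {l \<in> P. w l = int n} (L n)" for n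
  proof (rule bij_betw_imageI)
    show "inj_on \<Phi> {l \<in> P. w l = int n}"
      using bij by (auto simp: bij_betw_def intro: inj_on_subset)
    have im: "\<Phi> ` P = Q \<times> M" using bij by (simp add: bij_betw_def)
    show "\<Phi> ` {l \<in> P. w l = int n} = L n"
    proof (intro equalityI subsetI)
      fix y assume "y \<in> \<Phi> ` {l \<in> P. w l = int n}"
      then obtain l where l: "l \<in> P" "w l = int n" "y = \<Phi> l" by auto
      then have "y \<in> Q \<times> M" using im by blast
      then show "y \<in> L n" using l w[OF l(1)] by (simp add: L_def case_prod_beta mem_Times_iff)
    next
      fix y assume y: "y \<in> L n"
      then have "y \<in> \<Phi> ` P" unfolding im by (auto simp: L_def)
      then obtain l where l: "l \<in> P" "y = \<Phi> l" by auto
      then show "y \<in> \<Phi> ` {l \<in> P. w l = int n}"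
        using y w[OF l(1)] by (auto simp: L_def case_prod_beta)
    qed
  qed
  have finL: "finite (L n)" for n
  proof (rule finite_subset)
    show "finite ((\<Union>i\<le>n. K i) \<times> {..n})" using finK by simp
    show "L n \<subseteq> (\<Union>i\<le>n. K i) \<times> {..n}"
    proof
      fix y assume "y \<in> L n"
      then obtain b x where y: "y = (b, x)" "b \<in> Q" "v b + int q * int x = int n" by (auto simp: L_def)
      have "int x \<le> int q * int x" using q by (simp add: mult_le_cancel_right1)
      then have x: "x \<le> n" using v0[OF y(2)] y(3) by linarith
      have "0 \<le> int q * int x" by simp
      then have "v b \<le> int n" using y(3) by linarith
      then have "b \<in> K (nat (v b))" "nat (v b) \<le> n" using v0[OF y(2)] y(2) by (auto simp: K_def)
      then show "y \<in> (\<Union>i\<le>n. K i) \<times> {..n}" using x y(1) by blast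
    qed
  qed
  have "0 \<le> w l" if "l \<in> P" for l
  proof -
    have "\<Phi> l \<in> Q \<times> M" using bij_betw_apply[OF bij that] .
    then show ?thesis using w[OF that] v0[of "fst (\<Phi> l)"] by (simp add: mem_Times_iff)
  qed
  then show "good P w"
    using bij_betw_finite[OF bijL] finL by (simp add: good_def)
  have gfP: "fps_nth (gf P w) n = of_nat (card (L n))" for n
    using bij_betw_same_card[OF bijL] by (simp add: gf_def)
  have gfQ: "fps_nth (gf Q v) n = of_nat (card (K n))" for n by (simp add: gf_def K_def)
  have injP: "inj_on (\<lambda>b. (b, c)) X" for c X by (simp add: inj_on_def)
  show "gf P w = gf Q v * (1 + fps_X ^ q)" if M: "M = {0, 1}"
  proof (rule fps_ext)
    fix n
    have "card (L n) = card (K n) + (if n < q then 0 else card (K (n - q)))"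
    proof (cases "n < q")
      case True
      have "L n = (\<lambda>b. (b, 0)) ` K n"
        using v0 True by (auto simp: L_def K_def M) force
      then show ?thesis using True by (simp add: card_image injP)
    next
      case False
      have "L n = (\<lambda>b. (b, 0)) ` K n \<union> (\<lambda>b. (b, 1)) ` K (n - q)"
        using False by (auto simp: L_def K_def M image_iff of_nat_diff)
      moreover have "card ((\<lambda>b. (b, 0 :: nat)) ` K n \<union> (\<lambda>b. (b, 1)) ` K (n - q)) =
          card ((\<lambda>b. (b, 0 :: nat)) ` K n) + card ((\<lambda>b. (b, 1 :: nat)) ` K (n - q))"
        using finK by (intro card_Un_disjoint) auto
      ultimately show ?thesis using False by (simp add: card_image injP)
    qed
    then show "fps_nth (gf P w) n = fps_nth (gf Q v * (1 + fps_X ^ q)) n"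
      by (simp add: gfP gfQ distrib_left fps_X_power_mult_right_nth)
  qed
  show "gf P w * (1 - fps_X ^ q) = gf Q v" if M: "M = UNIV"
  proof (rule fps_ext)
    fix n
    have "card (L n) = card (K n) + (if n < q then 0 else card (L (n - q)))"
    proof (cases "n < q")
      case True
      have "L n = (\<lambda>b. (b, 0)) ` K n"
      proof (intro equalityI subsetI)
        fix y assume "y \<in> L n"
        then obtain b x where y: "y = (b, x)" "b \<in> Q" "v b + int q * int x = int n" by (auto simp: L_def)
        have "x = 0"
        proof (rule ccontr)
          assume "x \<noteq> 0"
          then have "int q * 1 \<le> int q * int x" by (intro mult_left_mono) auto
          then show False using v0[OF y(2)] y(3) True by linarith
        qed
        then show "y \<in> (\<lambda>b. (b, 0)) ` K n" using y by (auto simp: K_def)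
      qed (auto simp: L_def K_def M)
      then show ?thesis using True by (simp add: card_image injP)
    next
      case False
      \<comment> \<open>Either the parameter is 0, or lowering it by one lowers the weight by
        \<open>q\<close>.\<close>
      have "L n = (\<lambda>b. (b, 0)) ` K n \<union> (\<lambda>(b, x). (b, Suc x)) ` L (n - q)"
      proof (intro equalityI subsetI)
        fix y assume "y \<in> L n"
        then obtain b x where y: "y = (b, x)" "b \<in> Q" "v b + int q * int x = int n" by (auto simp: L_def)
        show "y \<in> (\<lambda>b. (b, 0)) ` K n \<union> (\<lambda>(b, x). (b, Suc x)) ` L (n - q)"
        proof (cases x)
          case 0
          then show ?thesis using y by (auto simp: K_def)
        next
          case (Suc x')
          then have "(b, x') \<in> L (n - q)" using y False by (simp add: L_def M of_nat_diff algebra_simps)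
          then show ?thesis using y Suc by (intro UnI2 image_eqI[of _ _ "(b, x')"]) auto
        qed
      next
        fix y assume "y \<in> (\<lambda>b. (b, 0)) ` K n \<union> (\<lambda>(b, x). (b, Suc x)) ` L (n - q)"
        then show "y \<in> L n" using False by (auto simp: L_def K_def M of_nat_diff algebra_simps)
      qed
      moreover have "card ((\<lambda>b. (b, 0 :: nat)) ` K n \<union> (\<lambda>(b, x). (b, Suc x)) ` L (n - q)) =
          card ((\<lambda>b. (b, 0 :: nat)) ` K n) + card ((\<lambda>(b, x). (b, Suc x)) ` L (n - q))"
        using finK finL by (intro card_Un_disjoint) auto
      moreover have "inj_on (\<lambda>(b, x). (b, Suc x)) (L (n - q))" by (auto simp: inj_on_def)
      ultimately show ?thesis using False by (simp add: card_image injP)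
    qed
    then show "fps_nth (gf P w * (1 - fps_X ^ q)) n = fps_nth (gf Q v) n"
      by (simp add: gfP gfQ right_diff_distrib fps_X_power_mult_right_nth)
  qed
qed

section \<open>Induction on the number of pairs\<close>

lemma strip_subset: "strip h D E \<Longrightarrow> D \<subseteq> E"
  by (auto simp: strip_def hstrip_def vstrip_def split: if_splits)

text \<open>All removals precede all additions. Removals starting from the empty diagram stay there,
  and additions ending in the empty diagram never left it.\<close>

lemma paths_no_pairs:
  assumes "pairs k d = {}"
  shows "paths k d = {\<lambda>_. {}}"
proof (intro equalityI subsetI)
  fix l assume l: "l \<in> paths k d"
  then have st: "step (d (Suc j)) (l j) (l (Suc j))" if "j < k" for j using that by (simp add: paths_def)
  have z: "l 0 = {}" "\<And>j. k \<le> j \<Longrightarrow> l j = {}" using l by (auto simp: paths_def)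
  have "l j = {}" for j
  proof (cases "j \<le> k")
    case True
    show ?thesis
    proof (cases "\<exists>i. 1 \<le> i \<and> i \<le> j \<and> grow (d i)")
      case False
      have "l i = {}" if "i \<le> j" for i
        using that
      proof (induction i)
        case (Suc i)
        then have "strip (hor (d (Suc i))) (l (Suc i)) (l i)"
          using st[of i] False True by (auto simp: step_def)
        then show ?case using strip_subset Suc by force
      qed (rule z)
      then show ?thesis by simp
    next
      case ex: True
      then obtain i where i: "1 \<le> i" "i \<le> j" "grow (d i)" by blast
      have all: "grow (d i')" if "j < i'" "i' \<le> k" for i'
        using i that assms pairs_iff[of i i' k d] by auto
      have "l i' = {}" if "j \<le> i'" "i' \<le> k" for i'
        using that(2,1)
      proof (induction i' rule: inc_induct)
        case base
        show ?case by (simp add: z)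
      next
        case (step i')
        then have "strip (hor (d (Suc i'))) (l i') (l (Suc i'))"
          using st[of i'] all[of "Suc i'"] by (auto simp: step_def)
        then show ?case using strip_subset step by force
      qed
      then show ?thesis using True by simp
    qed
  qed (use z in simp)
  then show "l \<in> {\<lambda>_. {}}" by auto
next
  fix l :: "nat \<Rightarrow> diagram" assume "l \<in> {\<lambda>_. {}}"
  then show "l \<in> paths k d"
    by (simp add: paths_def young_def step_def strip_def hstrip_def vstrip_def)
qed

lemma ex_adjacent_pair:
  assumes "pairs k d \<noteq> {}"
  obtains m where "1 \<le> m" "m < k" "grow (d m)" "\<not> grow (d (Suc m))"
proof -
  obtain i j where ij: "(i, j) \<in> pairs k d" using assms by auto
  then have *: "1 \<le> i" "i < j" "j \<le> k" "grow (d i)" "\<not> grow (d j)" by (auto simp: pairs_iff)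
  have "\<exists>m. i \<le> m \<and> m < j \<and> grow (d m) \<and> \<not> grow (d (Suc m))"
  proof (rule ccontr)
    assume no: "\<not> ?thesis"
    have "grow (d m)" if "i \<le> m" "m \<le> j" for m
      using that by (induction m rule: dec_induct) (use no * in \<open>auto simp: Suc_le_eq\<close>)
    then show False using * by auto
  qed
  then obtain m where "i \<le> m" "m < j" "grow (d m)" "\<not> grow (d (Suc m))" by blast
  then show thesis using * by (intro that[of m]) auto
qed

text \<open>The pairs are the inversions of the word of additions and removals: an adjacent
  transposition removes one inversion and relabels the others.\<close>

lemma pairs_swap:
  assumes m: "1 \<le> m" "m < k" and gr: "grow (d m)" "\<not> grow (d (Suc m))"
  shows "pairs k d = insert (m, Suc m) (map_prod (sw m) (sw m) ` pairs k (d \<circ> sw m))"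
    and "(m, Suc m) \<notin> map_prod (sw m) (sw m) ` pairs k (d \<circ> sw m)"
proof -
  have ran: "1 \<le> sw m i" "sw m i \<le> k" if "1 \<le> i" "i \<le> k" for i using that m by (auto simp: sw_def)
  have less: "sw m i < sw m j" if "i < j" "\<not> (i = m \<and> j = Suc m)" for i j
    using that by (auto simp: sw_def)
  have 1: "map_prod (sw m) (sw m) (i, j) \<in> pairs k d \<and> \<not> (i = Suc m \<and> j = m)"
    if "(i, j) \<in> pairs k (d \<circ> sw m)" for i j
  proof -
    have *: "1 \<le> i" "i < j" "j \<le> k" "grow (d (sw m i))" "\<not> grow (d (sw m j))"
      using that by (auto simp: pairs_iff)
    then have "\<not> (i = m \<and> j = Suc m)" using gr by auto
    then show ?thesis using less[OF *(2)] ran(1)[of i] ran(2)[of j] * by (auto simp: pairs_iff)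
  qed
  have 2: "(sw m i, sw m j) \<in> pairs k (d \<circ> sw m)" if "(i, j) \<in> pairs k d" "(i, j) \<noteq> (m, Suc m)" for i j
  proof -
    have *: "1 \<le> i" "i < j" "j \<le> k" "grow (d i)" "\<not> grow (d j)" using that by (auto simp: pairs_iff)
    then show ?thesis using less[OF *(2)] ran(1)[of i] ran(2)[of j] that(2) by (auto simp: pairs_iff)
  qed
  show "pairs k d = insert (m, Suc m) (map_prod (sw m) (sw m) ` pairs k (d \<circ> sw m))"
  proof (intro equalityI subsetI)
    fix y assume y: "y \<in> pairs k d"
    obtain i j where ij: "y = (i, j)" by force
    show "y \<in> insert (m, Suc m) (map_prod (sw m) (sw m) ` pairs k (d \<circ> sw m))"
    proof (cases "y = (m, Suc m)")
      case False
      then show ?thesis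
        using 2[of i j] y unfolding ij
        by (intro insertI2 image_eqI[of _ _ "(sw m i, sw m j)"]) auto
    qed simp
  next
    fix y assume "y \<in> insert (m, Suc m) (map_prod (sw m) (sw m) ` pairs k (d \<circ> sw m))"
    moreover have "(m, Suc m) \<in> pairs k d" using m gr by (simp add: pairs_iff)
    ultimately show "y \<in> pairs k d" using 1 by auto
  qed
  show "(m, Suc m) \<notin> map_prod (sw m) (sw m) ` pairs k (d \<circ> sw m)"
  proof
    assume "(m, Suc m) \<in> map_prod (sw m) (sw m) ` pairs k (d \<circ> sw m)"
    then obtain i j where ij: "(i, j) \<in> pairs k (d \<circ> sw m)" "sw m i = m" "sw m j = Suc m" by auto
    then have "i = Suc m" "j = m" by (auto simp: sw_def split: if_splits)
    then show False using 1[OF ij(1)] by simp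
  qed
qed

definition factor :: "(nat \<Rightarrow> diamond) \<Rightarrow> (nat \<Rightarrow> int) \<Rightarrow> nat \<times> nat \<Rightarrow> rat fps" where
  "factor d p = (\<lambda>(i, j). (1 + of_int (eps (d i) (d j)) * fps_X ^ nat (p j - p i)) powi eps (d i) (d j))"

lemma eps_hor: "grow a \<Longrightarrow> \<not> grow b \<Longrightarrow> eps a b = (if hor a = hor b then - 1 else 1)"
  by (cases a; cases b) (auto simp: eps_def grow_def hor_def)

text \<open>The positions are arbitrary because steps that move with their labels soon leave the
  natural order. Only the pairs still to be exchanged must have increasing positions; an exchange
  merely relabels the remaining pairs, so this is inherited, and each factor keeps its
  exponent.\<close>

theorem paths_gf:
  assumes "\<And>i j. (i, j) \<in> pairs k d \<Longrightarrow> p i < p j"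
  shows "good (paths k d) (wt k p) \<and> gf (paths k d) (wt k p) = prod (factor d p) (pairs k d)"
  using assms
proof (induction "card (pairs k d)" arbitrary: d p)
  case 0
  then have e: "pairs k d = {}" by (simp add: finite_pairs)
  have w: "wt k p (\<lambda>_. {}) = 0" by (simp add: wt_def)
  have "gf (paths k d) (wt k p) = 1"
    by (rule fps_ext) (auto simp: gf_def paths_no_pairs[OF e] w Collect_conv_if)
  then show ?case by (simp add: e good_def paths_no_pairs w)
next
  case (Suc c)
  then have "pairs k d \<noteq> {}" by auto
  then obtain m where m: "1 \<le> m" "m < k" and gr: "grow (d m)" "\<not> grow (d (Suc m))"
    by (rule ex_adjacent_pair)
  let ?d = "d \<circ> sw m" and ?p = "p \<circ> sw m"
  note sw = pairs_swap[OF m gr]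
  have inj: "inj_on (map_prod (sw m) (sw m)) X" for X
    by (rule inj_on_inverseI[where g = "map_prod (sw m) (sw m)"]) auto
  have "card (pairs k d) = Suc (card (pairs k ?d))"
    unfolding sw(1) using sw(2) by (simp add: finite_pairs card_image[OF inj])
  then have c: "c = card (pairs k ?d)" using Suc.hyps(2) by simp
  have less: "?p i < ?p j" if "(i, j) \<in> pairs k ?d" for i j
    using Suc.prems[of "sw m i" "sw m j"] sw(1) that by force
  have IH: "good (paths k ?d) (wt k ?p)" "gf (paths k ?d) (wt k ?p) = prod (factor ?d ?p) (pairs k ?d)"
    using Suc.hyps(1)[OF c, of ?p] less by blast+
  have "p m < p (Suc m)" using Suc.prems[of m "Suc m"] m gr by (simp add: pairs_iff)
  define q where "q = nat (p (Suc m) - p m)"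
  have q: "0 < q" "p (Suc m) - p m = int q" using \<open>p m < p (Suc m)\<close> by (auto simp: q_def)
  define M :: "nat set" where "M = (if hor (d m) = hor (d (Suc m)) then UNIV else {0, 1})"
  obtain \<Phi> where \<Phi>: "bij_betw \<Phi> (paths k d) (paths k ?d \<times> M)"
    "\<And>l. l \<in> paths k d \<Longrightarrow> wt k p l = wt k ?p (fst (\<Phi> l)) + int q * int (snd (\<Phi> l))"
    using path_swap_bij[OF m, of d p] gr unfolding q(2) M_def by blast
  note gb = gf_bij[OF \<Phi>(1) q(1) \<Phi>(2) IH(1)]
  have "factor d p (map_prod (sw m) (sw m) ij) = factor ?d ?p ij" for ij
    by (cases ij) (simp add: factor_def)
  then have "prod (factor d p) (pairs k d) = factor d p (m, Suc m) * prod (factor ?d ?p) (pairs k ?d)"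
    unfolding sw(1) using sw(2) by (simp add: finite_pairs prod.reindex[OF inj])
  moreover have "gf (paths k d) (wt k p) = factor d p (m, Suc m) * gf (paths k ?d) (wt k ?p)"
  proof (cases "hor (d m) = hor (d (Suc m))")
    case False
    then show ?thesis
      using gb(2) eps_hor[OF gr] by (simp add: M_def factor_def q_def mult.commute)
  next
    case True
    have "factor d p (m, Suc m) = inverse (1 - fps_X ^ q)"
      using True eps_hor[OF gr] by (simp add: factor_def q_def power_int_minus)
    moreover have "(1 - fps_X ^ q) * inverse (1 - fps_X ^ q) = (1 :: rat fps)"
      using q(1) by (intro inverse_mult_eq_1') simp
    ultimately show ?thesis
      using gb(3) True by (simp add: M_def flip: gb(3)) (metis (no_types) mult.assoc mult.commute mult_1_right)
  qed
  ultimately show ?case using gb(1) IH(2) by simp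
qed

section \<open>Height functions as sequences of diagrams\<close>

definition cont :: "nat \<times> nat \<Rightarrow> int" where
  "cont x = int (snd x) - int (fst x)"

definition diag_len :: "diagram \<Rightarrow> int \<Rightarrow> int" where
  "diag_len D c = int (card {x \<in> D. cont x = c})"

text \<open>The \<open>i\<close>-th box, counted from the border of the quadrant, on the diagonal of
  content \<open>c\<close>.\<close>

definition diag_box :: "int \<Rightarrow> nat \<Rightarrow> nat \<times> nat" where
  "diag_box c i = (nat (- c) + i, nat c + i)"

lemma diag_box_cont: "(r, s) = diag_box (int s - int r) (min r s)"
  by (auto simp: diag_box_def min_def)

lemma diag_len_nonneg: "0 \<le> diag_len D c"
  by (simp add: diag_len_def)

lemma diag_len_empty [simp]: "diag_len {} c = 0"
  by (simp add: diag_len_def)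

text \<open>On each diagonal a Young diagram occupies an initial segment, so the length of the
  segment decides membership.\<close>

lemma diag_box_mem:
  assumes "young D"
  shows "diag_box c i \<in> D \<longleftrightarrow> int i < diag_len D c"
proof -
  let ?I = "{i. diag_box c i \<in> D}"
  have inj: "inj_on (diag_box c) A" for A by (auto simp: inj_on_def diag_box_def)
  have im: "{x \<in> D. cont x = c} = diag_box c ` ?I"
  proof (intro equalityI subsetI)
    fix x assume x: "x \<in> {x \<in> D. cont x = c}"
    obtain r s where rs: "x = (r, s)" by force
    then have "int s - int r = c" using x by (simp add: cont_def)
    then have "x = diag_box c (min r s)" using diag_box_cont[of r s] rs by simp
    then show "x \<in> diag_box c ` ?I" using x by blast
  next
    fix x assume "x \<in> diag_box c ` ?I"
    then show "x \<in> {x \<in> D. cont x = c}" by (auto simp: cont_def diag_box_def)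
  qed
  have "finite {x \<in> D. cont x = c}" using assms by (simp add: young_def)
  then have fin: "finite ?I" unfolding im using finite_imageD inj by blast
  have "(a, b) \<in> D" if "(Suc a, Suc b) \<in> D" for a b
    using assms that unfolding young_def by blast
  then have "j \<in> ?I" if "Suc j \<in> ?I" for j
    using that by (simp add: diag_box_def)
  from down_closed_nat[OF fin this, of i] have "diag_box c i \<in> D \<longleftrightarrow> i < card ?I" by simp
  also have "card ?I = card {x \<in> D. cont x = c}" unfolding im by (simp add: card_image[OF inj])
  finally show ?thesis by (simp add: diag_len_def)
qed

lemma young_mem:
  assumes "young D"
  shows "(r, s) \<in> D \<longleftrightarrow> int (min r s) < diag_len D (int s - int r)"
  by (subst diag_box_cont) (rule diag_box_mem[OF assms])

lemma int_le_by_nats: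
  assumes "\<And>i. int i < x \<Longrightarrow> int i < y" "0 \<le> y"
  shows "x \<le> y"
  using assms(1)[of "nat y"] assms(2) by linarith

lemma int_le_Suc_by_nats:
  assumes "\<And>i. int (Suc i) < x \<Longrightarrow> int i < y" "0 \<le> y"
  shows "x \<le> y + 1"
proof (rule ccontr)
  assume "\<not> x \<le> y + 1"
  then have "int (Suc (nat y)) < x" using assms(2) by linarith
  then show False using assms(1)[of "nat y"] assms(2) by simp
qed

text \<open>Moving a box up by one row raises its content by one. Its index on the diagonal drops by
  one if the old content \<open>c\<close> is nonnegative and stays the same otherwise, whence the
  correction \<open>of_bool (0 <= c)\<close>.\<close>

lemma hstrip_iff:
  assumes D: "young D" and E: "young E"
  shows "hstrip D E \<longleftrightarrow> (\<forall>c. diag_len D c \<le> diag_len E c \<and>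
    diag_len E c \<le> diag_len D (c + 1) + of_bool (0 \<le> c))"
proof
  assume h: "hstrip D E"
  show "\<forall>c. diag_len D c \<le> diag_len E c \<and> diag_len E c \<le> diag_len D (c + 1) + of_bool (0 \<le> c)"
  proof
    fix c
    have "diag_len D c \<le> diag_len E c"
    proof (rule int_le_by_nats)
      fix i assume "int i < diag_len D c"
      then have "diag_box c i \<in> D" using diag_box_mem[OF D] by blast
      then show "int i < diag_len E c" using h diag_box_mem[OF E] unfolding hstrip_def by blast
    qed (rule diag_len_nonneg)
    moreover have "diag_len E c \<le> diag_len D (c + 1) + of_bool (0 \<le> c)"
    proof (cases "0 \<le> c")
      case True
      have "diag_len E c \<le> diag_len D (c + 1) + 1"
      proof (rule int_le_Suc_by_nats)
        fix i assume "int (Suc i) < diag_len E c"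
        then have "(Suc i, nat c + Suc i) \<in> E"
          using diag_box_mem[OF E, of c "Suc i"] True by (simp add: diag_box_def)
        then have "(i, nat c + Suc i) \<in> D" using h unfolding hstrip_def by blast
        moreover have "(i, nat c + Suc i) = diag_box (c + 1) i" using True by (simp add: diag_box_def nat_add_distrib)
        ultimately show "int i < diag_len D (c + 1)" using diag_box_mem[OF D] by simp
      qed (rule diag_len_nonneg)
      then show ?thesis using True by simp
    next
      case False
      have "diag_len E c \<le> diag_len D (c + 1)"
      proof (rule int_le_by_nats)
        fix i assume "int i < diag_len E c"
        moreover have "diag_box c i = (Suc (nat (- (c + 1)) + i), i)" using False by (simp add: diag_box_def)
        ultimately have "(Suc (nat (- (c + 1)) + i), i) \<in> E" using diag_box_mem[OF E, of c i] by simp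
        then have "(nat (- (c + 1)) + i, i) \<in> D" using h unfolding hstrip_def by blast
        moreover have "(nat (- (c + 1)) + i, i) = diag_box (c + 1) i" using False by (simp add: diag_box_def)
        ultimately show "int i < diag_len D (c + 1)" using diag_box_mem[OF D] by simp
      qed (rule diag_len_nonneg)
      then show ?thesis using False by simp
    qed
    ultimately show "diag_len D c \<le> diag_len E c \<and> diag_len E c \<le> diag_len D (c + 1) + of_bool (0 \<le> c)" ..
  qed
next
  assume h: "\<forall>c. diag_len D c \<le> diag_len E c \<and> diag_len E c \<le> diag_len D (c + 1) + of_bool (0 \<le> c)"
  have "(r, s) \<in> E" if "(r, s) \<in> D" for r s
    using that h[rule_format, of "int s - int r"] unfolding young_mem[OF D] young_mem[OF E] by linarith
  moreover have "(r, s) \<in> D" if "(Suc r, s) \<in> E" for r s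
  proof -
    have "int s - int (Suc r) + 1 = int s - int r" by simp
    then show ?thesis
      using that h[rule_format, of "int s - int (Suc r)"] unfolding young_mem[OF D] young_mem[OF E]
      by (cases "Suc r \<le> s") (auto simp: min_def)
  qed
  ultimately show "hstrip D E" unfolding hstrip_def by auto
qed

lemma diag_len_converse: "diag_len (D\<inverse>) c = diag_len D (- c)"
proof -
  have "{x \<in> D\<inverse>. cont x = c} = {x \<in> D. cont x = - c}\<inverse>" by (auto simp: cont_def)
  then show ?thesis by (simp only: diag_len_def card_inverse)
qed

lemma vstrip_iff:
  assumes D: "young D" and E: "young E"
  shows "vstrip D E \<longleftrightarrow> (\<forall>c. diag_len D c \<le> diag_len E c \<and>
    diag_len E (c + 1) \<le> diag_len D c + of_bool (c < 0))"
proof -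
  have "vstrip D E \<longleftrightarrow> hstrip (D\<inverse>) (E\<inverse>)" by (rule vstrip_converse)
  also have "\<dots> \<longleftrightarrow> (\<forall>c. diag_len D (- c) \<le> diag_len E (- c) \<and>
    diag_len E (- c) \<le> diag_len D (- (c + 1)) + of_bool (0 \<le> c))"
    by (simp only: hstrip_iff[OF young_converse[OF D] young_converse[OF E]] diag_len_converse)
  also have "\<dots> \<longleftrightarrow> (\<forall>c. diag_len D c \<le> diag_len E c) \<and>
      (\<forall>c. diag_len E (- c) \<le> diag_len D (- (c + 1)) + of_bool (0 \<le> c))"
    by (metis minus_minus)
  also have "(\<forall>c. diag_len E (- c) \<le> diag_len D (- (c + 1)) + of_bool (0 \<le> c)) \<longleftrightarrow>
      (\<forall>c. diag_len E (c + 1) \<le> diag_len D c + of_bool (c < 0))"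
  proof
    assume h: "\<forall>c. diag_len E (- c) \<le> diag_len D (- (c + 1)) + of_bool (0 \<le> c)"
    show "\<forall>c. diag_len E (c + 1) \<le> diag_len D c + of_bool (c < 0)"
    proof
      fix c :: int
      have "(0 \<le> - (c + 1)) = (c < 0)" "- (- (c + 1)) = c + 1" "- (- (c + 1) + 1) = c"
        by presburger+
      then show "diag_len E (c + 1) \<le> diag_len D c + of_bool (c < 0)"
        using h[rule_format, of "- (c + 1)"] by (simp only:)
    qed
  next
    assume h: "\<forall>c. diag_len E (c + 1) \<le> diag_len D c + of_bool (c < 0)"
    show "\<forall>c. diag_len E (- c) \<le> diag_len D (- (c + 1)) + of_bool (0 \<le> c)"
    proof
      fix c :: int
      have "(- (c + 1) < 0) = (0 \<le> c)" "- (c + 1) + 1 = - c" by presburger+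
      then show "diag_len E (- c) \<le> diag_len D (- (c + 1)) + of_bool (0 \<le> c)"
        using h[rule_format, of "- (c + 1)"] by (simp only:)
    qed
  qed
  finally show ?thesis by blast
qed

text \<open>A Young diagram is a strip of either kind over itself, so these bounds are the strip
  criteria with both diagrams equal.\<close>

lemma diag_len_col:
  assumes "young D"
  shows "diag_len D c \<le> diag_len D (c + 1) + of_bool (0 \<le> c)"
    and "diag_len D (c + 1) \<le> diag_len D c + of_bool (c < 0)"
proof -
  have "hstrip D D" "vstrip D D" using assms unfolding young_def hstrip_def vstrip_def by blast+
  then show "diag_len D c \<le> diag_len D (c + 1) + of_bool (0 \<le> c)"
    "diag_len D (c + 1) \<le> diag_len D c + of_bool (c < 0)"
    using hstrip_iff[OF assms assms] vstrip_iff[OF assms assms] by blast+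
qed

text \<open>The two bounds \<open>col\<close> express closure under moving a box up and to the left;
  a diagram is read off by filling an initial segment of each diagonal.\<close>

lemma ex_diagram:
  fixes h :: "int \<Rightarrow> int"
  assumes nonneg: "\<And>c. 0 \<le> h c" and fin: "finite {c. h c \<noteq> 0}"
    and col: "\<And>c. h c \<le> h (c + 1) + of_bool (0 \<le> c)" "\<And>c. h (c + 1) \<le> h c + of_bool (c < 0)"
  shows "\<exists>D. young D \<and> diag_len D = h"
proof (intro exI conjI)
  define D where "D = {(r, s). int (min r s) < h (int s - int r)}"
  have mem: "(r, s) \<in> D \<longleftrightarrow> int (min r s) < h (int s - int r)" for r s by (simp add: D_def)
  have "D \<subseteq> (\<lambda>(c, i). diag_box c i) ` (SIGMA c:{c. h c \<noteq> 0}. {..<nat (h c)})"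
  proof
    fix x assume x: "x \<in> D"
    obtain r s where rs: "x = (r, s)" by force
    have "int (min r s) < h (int s - int r)" using x mem rs by simp
    then show "x \<in> (\<lambda>(c, i). diag_box c i) ` (SIGMA c:{c. h c \<noteq> 0}. {..<nat (h c)})"
      unfolding rs by (intro image_eqI[of _ _ "(int s - int r, min r s)"]) (auto simp: diag_box_cont[symmetric])
  qed
  moreover have "finite ((\<lambda>(c, i). diag_box c i) ` (SIGMA c:{c. h c \<noteq> 0}. {..<nat (h c)}))"
    using fin by auto
  ultimately have "finite D" by (rule finite_subset)
  moreover have "(r, s) \<in> D" if "(Suc r, s) \<in> D" for r s
  proof -
    have "int s - int (Suc r) + 1 = int s - int r" by simp
    then show ?thesis using that col(1)[of "int s - int (Suc r)"] unfolding mem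
      by (cases "Suc r \<le> s") (auto simp: min_def)
  qed
  moreover have "(r, s) \<in> D" if "(r, Suc s) \<in> D" for r s
  proof -
    have e: "int (Suc s) - int r = int s - int r + 1" by simp
    then show ?thesis using that col(2)[of "int s - int r"] unfolding mem e
      by (cases "r \<le> s") (auto simp: min_def split: if_splits)
  qed
  ultimately show y: "young D" unfolding young_def by blast
  show "diag_len D = h"
  proof
    fix c
    have "int i < diag_len D c \<longleftrightarrow> int i < h c" for i
    proof -
      have "min (nat (- c) + i) (nat c + i) = i" "int (nat c + i) - int (nat (- c) + i) = c" by auto
      then have "diag_box c i \<in> D \<longleftrightarrow> int i < h c" unfolding diag_box_def mem by simp
      then show ?thesis using diag_box_mem[OF y] by simp
    qed
    then show "diag_len D c = h c"
      using int_le_by_nats[of "diag_len D c" "h c"] int_le_by_nats[of "h c" "diag_len D c"]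
        nonneg diag_len_nonneg by (metis order_antisym)
  qed
qed

text \<open>Adding a box of content \<open>c\<close> to the \<open>j\<close>-th diagram corresponds to a flip at the face with index
  \<open>c + yy d j\<close>; heights above \<open>G0\<close> are the lengths of the diagonals.\<close>

definition hgt :: "(nat \<Rightarrow> diamond) \<Rightarrow> (nat \<Rightarrow> diagram) \<Rightarrow> height" where
  "hgt d l j n = G0 d j n + diag_len (l j) (n - yy d j)"

text \<open>The contributions of \<open>G0\<close> to \<open>val\<close> reduce to indicators of the
  sign of the content, and these are the corrections in the strip criteria. The strip gives the
  values on two kinds of edges one bound each; their other bounds, and the third kind, also use the
  bounds \<open>cD\<close> and \<open>cE\<close> that hold within one diagram.\<close>

lemma step_iff_val:
  assumes y: "young (l i)" "young (l (Suc i))"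
  shows "step (d (Suc i)) (l i) (l (Suc i)) \<longleftrightarrow> (\<forall>e n. val d (hgt d l) (e, Suc i, n) \<in> {0, 1})"
proof -
  define D E a where "D = l i" and "E = l (Suc i)" and "a = yy d i"
  have yD: "young D" and yE: "young E" using y by (auto simp: D_def E_def)
  note cD = diag_len_col[OF yD] and cE = diag_len_col[OF yE]
  \<comment> \<open>Face indices are turned into contents by subtracting the level \<open>a\<close>
    of the left column. For \<open>Succ\<close> and \<open>Prec'\<close> the level drops by one in
    this strip, which is why \<open>E\<close> then appears shifted by one.\<close>
  have reindex: "(\<forall>e n. val d (hgt d l) (e, Suc i, n) \<in> {0, 1}) \<longleftrightarrow> (\<forall>c. Q c)"
    if Q: "\<And>n. Q (n - a) \<longleftrightarrow> val d (hgt d l) (Up, Suc i, n) \<in> {0, 1} \<and>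
      val d (hgt d l) (Dn, Suc i, n) \<in> {0, 1} \<and> val d (hgt d l) (Hz, Suc i, n) \<in> {0, 1}" for Q
  proof
    assume h: "\<forall>e n. val d (hgt d l) (e, Suc i, n) \<in> {0, 1}"
    have "Q (c + a - a)" for c unfolding Q using h by blast
    then show "\<forall>c. Q c" by simp
  next
    assume h: "\<forall>c. Q c"
    have "val d (hgt d l) (e, Suc i, n) \<in> {0, 1}" for e n
      using Q[of n] h by (cases e) blast+
    then show "\<forall>e n. val d (hgt d l) (e, Suc i, n) \<in> {0, 1}" by blast
  qed
  show ?thesis
  proof (cases "d (Suc i)")
    case Prec
    have v: "val d (hgt d l) (Up, Suc i, n) = diag_len D (n - a + 1) - diag_len E (n - a) + of_bool (0 \<le> n - a)"
      "val d (hgt d l) (Dn, Suc i, n) = diag_len E (n - a) - diag_len D (n - a)"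
      "val d (hgt d l) (Hz, Suc i, n) = of_bool (n - a < 0) + diag_len E (n - a) - diag_len E (n - a + 1)" for n
      using Prec by (auto simp: hgt_def G0_def D_def E_def a_def primed_iff algebra_simps)
    have "(\<forall>e n. val d (hgt d l) (e, Suc i, n) \<in> {0, 1}) \<longleftrightarrow>
        (\<forall>c. diag_len D (c + 1) - diag_len E c + of_bool (0 \<le> c) \<in> {0, 1} \<and>
          diag_len E c - diag_len D c \<in> {0, 1} \<and>
          of_bool (c < 0) + diag_len E c - diag_len E (c + 1) \<in> {0, 1})"
      by (rule reindex) (simp only: v)
    also have "\<dots> \<longleftrightarrow> (\<forall>c. diag_len D c \<le> diag_len E c \<and>
        diag_len E c \<le> diag_len D (c + 1) + of_bool (0 \<le> c))" (is "(\<forall>c. ?L c) \<longleftrightarrow> (\<forall>c. ?R c)")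
    proof (intro iffI allI)
      fix c assume l: "\<forall>c. ?L c"
      show "?R c"
        using l[rule_format, of c] by auto
    next
      fix c assume r: "\<forall>c. ?R c"
      show "?L c"
        using r[rule_format, of c] r[rule_format, of "c + 1"] cD[of c] cE[of c]
        by (cases "c < 0") auto
    qed
    finally show ?thesis
      using hstrip_iff[OF yD yE] Prec by (simp add: step_def strip_def grow_def hor_def D_def E_def)
  next
    case Succ
    have v: "val d (hgt d l) (Up, Suc i, n) = diag_len D (n - a + 1) - diag_len E (n - a + 1)"
      "val d (hgt d l) (Dn, Suc i, n) = diag_len E (n - a + 1) - diag_len D (n - a) + of_bool (0 \<le> n - a)"
      "val d (hgt d l) (Hz, Suc i, n) = of_bool (n - a + 1 < 0) + diag_len E (n - a + 1) - diag_len E (n - a + 1 + 1)" for n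
      using Succ by (auto simp: hgt_def G0_def D_def E_def a_def primed_iff algebra_simps)
    have "(\<forall>e n. val d (hgt d l) (e, Suc i, n) \<in> {0, 1}) \<longleftrightarrow>
        (\<forall>c. diag_len D (c + 1) - diag_len E (c + 1) \<in> {0, 1} \<and>
          diag_len E (c + 1) - diag_len D c + of_bool (0 \<le> c) \<in> {0, 1} \<and>
          of_bool (c + 1 < 0) + diag_len E (c + 1) - diag_len E (c + 1 + 1) \<in> {0, 1})"
      by (rule reindex) (simp only: v)
    also have "\<dots> \<longleftrightarrow> (\<forall>c. diag_len E c \<le> diag_len D c \<and>
        diag_len D c \<le> diag_len E (c + 1) + of_bool (0 \<le> c))" (is "(\<forall>c. ?L c) \<longleftrightarrow> (\<forall>c. ?R c)")
    proof (intro iffI allI)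
      fix c assume l: "\<forall>c. ?L c"
      show "?R c"
        using l[rule_format, of c] l[rule_format, of "c - 1"] by auto
    next
      fix c assume r: "\<forall>c. ?R c"
      show "?L c"
        using r[rule_format, of c] r[rule_format, of "c + 1"] cD[of c] cE[of c] cE[of "c + 1"] cD[of "c + 1"]
        by (cases "c < 0"; cases "c = - 1") auto
    qed
    finally show ?thesis
      using hstrip_iff[OF yE yD] Succ by (simp add: step_def strip_def grow_def hor_def D_def E_def)
  next
    case Prec'
    have v: "val d (hgt d l) (Up, Suc i, n) = diag_len E (n - a + 1) - diag_len D (n - a + 1)"
      "val d (hgt d l) (Dn, Suc i, n) = diag_len D (n - a) - diag_len E (n - a + 1) + of_bool (n - a < 0)"
      "val d (hgt d l) (Hz, Suc i, n) = of_bool (0 \<le> n - a) - diag_len D (n - a) + diag_len D (n - a + 1)" for n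
      using Prec' by (auto simp: hgt_def G0_def D_def E_def a_def primed_iff algebra_simps)
    have "(\<forall>e n. val d (hgt d l) (e, Suc i, n) \<in> {0, 1}) \<longleftrightarrow>
        (\<forall>c. diag_len E (c + 1) - diag_len D (c + 1) \<in> {0, 1} \<and>
          diag_len D c - diag_len E (c + 1) + of_bool (c < 0) \<in> {0, 1} \<and>
          of_bool (0 \<le> c) - diag_len D c + diag_len D (c + 1) \<in> {0, 1})"
      by (rule reindex) (simp only: v)
    also have "\<dots> \<longleftrightarrow> (\<forall>c. diag_len D c \<le> diag_len E c \<and>
        diag_len E (c + 1) \<le> diag_len D c + of_bool (c < 0))" (is "(\<forall>c. ?L c) \<longleftrightarrow> (\<forall>c. ?R c)")
    proof (intro iffI allI)
      fix c assume l: "\<forall>c. ?L c"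
      show "?R c"
        using l[rule_format, of c] l[rule_format, of "c - 1"] by auto
    next
      fix c assume r: "\<forall>c. ?R c"
      show "?L c"
        using r[rule_format, of c] r[rule_format, of "c + 1"] cD[of c] cE[of c]
        by (cases "c < 0") auto
    qed
    finally show ?thesis
      using vstrip_iff[OF yD yE] Prec' by (simp add: step_def strip_def grow_def hor_def D_def E_def)
  next
    case Succ'
    have v: "val d (hgt d l) (Up, Suc i, n) = diag_len E (n - a) - diag_len D (n - a + 1) + of_bool (n - a < 0)"
      "val d (hgt d l) (Dn, Suc i, n) = diag_len D (n - a) - diag_len E (n - a)"
      "val d (hgt d l) (Hz, Suc i, n) = of_bool (0 \<le> n - a) - diag_len D (n - a) + diag_len D (n - a + 1)" for n
      using Succ' by (auto simp: hgt_def G0_def D_def E_def a_def primed_iff algebra_simps)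
    have "(\<forall>e n. val d (hgt d l) (e, Suc i, n) \<in> {0, 1}) \<longleftrightarrow>
        (\<forall>c. diag_len E c - diag_len D (c + 1) + of_bool (c < 0) \<in> {0, 1} \<and>
          diag_len D c - diag_len E c \<in> {0, 1} \<and>
          of_bool (0 \<le> c) - diag_len D c + diag_len D (c + 1) \<in> {0, 1})"
      by (rule reindex) (simp only: v)
    also have "\<dots> \<longleftrightarrow> (\<forall>c. diag_len E c \<le> diag_len D c \<and>
        diag_len D (c + 1) \<le> diag_len E c + of_bool (c < 0))" (is "(\<forall>c. ?L c) \<longleftrightarrow> (\<forall>c. ?R c)")
    proof (intro iffI allI)
      fix c assume l: "\<forall>c. ?L c"
      show "?R c"
        using l[rule_format, of c] by auto
    next
      fix c assume r: "\<forall>c. ?R c"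
      show "?L c"
        using r[rule_format, of c] r[rule_format, of "c + 1"] cD[of c] cE[of c]
        by (cases "c < 0") auto
    qed
    finally show ?thesis
      using vstrip_iff[OF yE yD] Succ' by (simp add: step_def strip_def grow_def hor_def D_def E_def)
  qed
qed

section \<open>Sequences of diagrams and valid heights: support, area, bijection\<close>

lemma diag_len_eq_0: "c \<notin> cont ` D \<Longrightarrow> diag_len D c = 0"
  by (auto simp: diag_len_def image_iff intro!: card_eq_0_iff[THEN iffD2] disjI1)

lemma sum_diag_len: "finite D \<Longrightarrow> (\<Sum>c\<in>cont ` D. nat (diag_len D c)) = card D"
  using sum.image_gen[of D "\<lambda>_. 1 :: nat" cont] by (simp add: diag_len_def)

lemma hgt_support:
  assumes "l \<in> paths k d"
  defines "A \<equiv> SIGMA j:{..k}. (\<lambda>c. c + yy d j) ` cont ` l j"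
  shows "finite A" and "{(j, n). hgt d l j n \<noteq> G0 d j n} \<subseteq> A"
proof -
  have fin: "finite (l j)" for j using assms(1) by (simp add: paths_def young_def)
  then show "finite A" unfolding A_def by (intro finite_SigmaI) auto
  show "{(j, n). hgt d l j n \<noteq> G0 d j n} \<subseteq> A"
  proof clarify
    fix j n assume "hgt d l j n \<noteq> G0 d j n"
    then have nz: "diag_len (l j) (n - yy d j) \<noteq> 0" by (simp add: hgt_def)
    then have "n - yy d j \<in> cont ` l j" using diag_len_eq_0 by blast
    moreover have "j \<le> k"
    proof (rule ccontr)
      assume "\<not> j \<le> k"
      then have "l j = {}" using assms(1) by (simp add: paths_def)
      then show False using nz by simp
    qed
    ultimately show "(j, n) \<in> A" unfolding A_def by (intro SigmaI image_eqI[of n _ "n - yy d j"]) auto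
  qed
qed

lemma valid_hgt:
  assumes "l \<in> paths k d"
  shows "valid k d (hgt d l)"
  unfolding valid_def
proof (intro conjI allI impI ballI)
  show "finite {(j, n). hgt d l j n \<noteq> G0 d j n}"
    using hgt_support[OF assms] by (rule finite_subset[rotated])
  show "hgt d l j n = G0 d j n" if "j = 0 \<or> k \<le> j" for j n
    using that assms by (auto simp: hgt_def paths_def)
  fix x assume "x \<in> Idx k"
  then obtain e j n where ej: "x = (e, j, n)" "1 \<le> j" "j \<le> k" by (auto simp: Idx_def)
  then obtain i where "j = Suc i" by (cases j) auto
  with ej have x: "x = (e, Suc i, n)" "i < k" by auto
  show "val d (hgt d l) x \<in> {0, 1}"
    using step_iff_val[of l i d] assms x by (simp add: paths_def del: val.simps)
qed

lemma area_hgt: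
  assumes "l \<in> paths k d"
  shows "area d (hgt d l) = (\<Sum>j\<le>k. card (l j))"
proof -
  have fin: "finite (l j)" for j using assms by (simp add: paths_def young_def)
  have "area d (hgt d l) =
      (\<Sum>(j, n)\<in>(SIGMA j:{..k}. (\<lambda>c. c + yy d j) ` cont ` l j). nat (hgt d l j n - G0 d j n))"
    using hgt_support[OF assms] by (rule area_superset)
  also have "\<dots> = (\<Sum>j\<le>k. \<Sum>n\<in>(\<lambda>c. c + yy d j) ` cont ` l j. nat (diag_len (l j) (n - yy d j)))"
    using fin by (subst sum.Sigma) (auto simp: hgt_def)
  also have "\<dots> = (\<Sum>j\<le>k. \<Sum>c\<in>cont ` l j. nat (diag_len (l j) c))"
  proof (rule sum.cong[OF refl])
    fix j
    show "(\<Sum>n\<in>(\<lambda>c. c + yy d j) ` cont ` l j. nat (diag_len (l j) (n - yy d j))) =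
        (\<Sum>c\<in>cont ` l j. nat (diag_len (l j) c))"
      using sum.reindex[of "\<lambda>c. c + yy d j" "cont ` l j" "\<lambda>n. nat (diag_len (l j) (n - yy d j))"]
      by (simp add: inj_on_def o_def)
  qed
  finally show ?thesis using fin by (simp add: sum_diag_len)
qed

text \<open>For surjectivity the excess over \<open>G0\<close> must be a family of diagonal lengths:
  it is nonnegative by \<open>valid_ge_G0\<close>, and the column differences of \<open>G\<close>
  and \<open>G0\<close> give the two bounds required by \<open>ex_diagram\<close>.\<close>

lemma bij_hgt: "bij_betw (hgt d) (paths k d) {G. valid k d G}"
proof (rule bij_betw_imageI)
  show "inj_on (hgt d) (paths k d)"
  proof (rule inj_onI)
    fix l l' assume l: "l \<in> paths k d" "l' \<in> paths k d" and eq: "hgt d l = hgt d l'"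
    have "diag_len (l j) c = diag_len (l' j) c" for j c
      using fun_cong[OF fun_cong[OF eq, of j], of "c + yy d j"] by (simp add: hgt_def)
    moreover have "young (l j)" "young (l' j)" for j using l by (auto simp: paths_def)
    ultimately have "(r, s) \<in> l j \<longleftrightarrow> (r, s) \<in> l' j" for j r s using young_mem by simp
    then show "l = l'" by (intro ext) auto
  qed
  show "hgt d ` paths k d = {G. valid k d G}"
  proof (intro equalityI subsetI)
    fix G assume "G \<in> {G. valid k d G}"
    then have v: "valid k d G" by simp
    define h where "h j c = G j (c + yy d j) - G0 d j (c + yy d j)" for j c
    have out: "h j c = 0" if "j = 0 \<or> k \<le> j" for j c using v that by (auto simp: h_def valid_def)
    have "\<exists>D. young D \<and> diag_len D = h j" for j
    proof (rule ex_diagram)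
      show "0 \<le> h j c" for c using valid_ge_G0[OF v] by (simp add: h_def)
      have "(\<lambda>c. (j, c + yy d j)) ` {c. h j c \<noteq> 0} \<subseteq> {(j, n). G j n \<noteq> G0 d j n}"
        by (auto simp: h_def)
      moreover have "inj_on (\<lambda>c. (j, c + yy d j)) {c. h j c \<noteq> 0}" by (simp add: inj_on_def)
      ultimately show "finite {c. h j c \<noteq> 0}"
        using v inj_on_finite unfolding valid_def by blast
      have c: "h j c \<le> h j (c + 1) + of_bool (0 \<le> c) \<and> h j (c + 1) \<le> h j c + of_bool (c < 0)" for c
      proof (cases "j \<le> k")
        case True
        then show ?thesis
          using valid_col[OF v True, of "c + yy d j"] G0_col[of d j "c + yy d j"]
          by (cases "c < 0") (auto simp: h_def algebra_simps)
      qed (simp add: out)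
      show "h j c \<le> h j (c + 1) + of_bool (0 \<le> c)" "h j (c + 1) \<le> h j c + of_bool (c < 0)" for c
        using c by auto
    qed
    then obtain l where l: "\<And>j. young (l j)" "\<And>j. diag_len (l j) = h j" by metis
    have G: "hgt d l = G" by (intro ext) (simp add: hgt_def l h_def)
    have "l j = {}" if "j = 0 \<or> k \<le> j" for j
    proof -
      have "(r, s) \<notin> l j" for r s using young_mem[OF l(1)[of j], of r s] out[OF that] by (simp add: l(2))
      then show ?thesis by auto
    qed
    moreover have "step (d (Suc i)) (l i) (l (Suc i))" if "i < k" for i
      using step_iff_val[OF l(1)[of i] l(1)[of "Suc i"], of d] v that
      by (simp add: G valid_def Idx_def del: val.simps)
    ultimately have "l \<in> paths k d" using l(1) by (simp add: paths_def)
    then show "G \<in> hgt d ` paths k d" using G by blast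
  qed (use valid_hgt in auto)
qed

lemma reachable_bij_paths:
  assumes "1 \<le> k"
  shows "bij_betw (Psi k d \<circ> hgt d) {l \<in> paths k d. wt k int l = int n}
    {M \<in> reachable k d. flip_dist k d M = n}"
proof (rule bij_betw_trans)
  \<comment> \<open>With \<open>int\<close> as positions every diagram has coefficient 1, so the
    weight is the total number of boxes.\<close>
  have w: "wt k int l = int (area d (hgt d l))" if "l \<in> paths k d" for l
    using area_hgt[OF that] by (simp add: wt_def)
  have inj: "inj_on (hgt d) (paths k d)" and im: "hgt d ` paths k d = {G. valid k d G}"
    using bij_hgt[of d k] by (auto simp: bij_betw_def)
  show "bij_betw (hgt d) {l \<in> paths k d. wt k int l = int n} {G. valid k d G \<and> area d G = n}"
  proof (rule bij_betw_imageI)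
    show "inj_on (hgt d) {l \<in> paths k d. wt k int l = int n}" using inj by (rule inj_on_subset) auto
    show "hgt d ` {l \<in> paths k d. wt k int l = int n} = {G. valid k d G \<and> area d G = n}"
    proof (intro equalityI subsetI)
      fix G assume "G \<in> hgt d ` {l \<in> paths k d. wt k int l = int n}"
      then show "G \<in> {G. valid k d G \<and> area d G = n}" using w valid_hgt by auto
    next
      fix G assume G: "G \<in> {G. valid k d G \<and> area d G = n}"
      then have "G \<in> hgt d ` paths k d" unfolding im by simp
      then obtain l where "l \<in> paths k d" "G = hgt d l" by blast
      then show "G \<in> hgt d ` {l \<in> paths k d. wt k int l = int n}" using G w[of l] by auto
    qed
  qed
  show "bij_betw (Psi k d) {G. valid k d G \<and> area d G = n} {M \<in> reachable k d. flip_dist k d M = n}"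
    by (rule reachable_level[OF assms])
qed

theorem theorem16:
  fixes k :: nat and d :: "nat \<Rightarrow> diamond"
  assumes "k \<ge> 1"
  shows "(\<forall>n. finite {M \<in> reachable k d. flip_dist k d M = n}) \<and>
         T_gf k d =
           (\<Prod>(i, j) \<in> {(i, j). 1 \<le> i \<and> i < j \<and> j \<le> k \<and>
                              d i \<in> {Prec, Prec'} \<and> d j \<in> {Succ, Succ'}}.
              (1 + of_int (eps (d i) (d j)) * fps_X ^ (j - i)) powi (eps (d i) (d j)))"
proof -
  note bij = reachable_bij_paths[OF assms, of d]
  have gf: "good (paths k d) (wt k int)"
    "gf (paths k d) (wt k int) = prod (factor d int) (pairs k d)"
    using paths_gf[of k d int] by (auto simp: pairs_def)
  have "T_gf k d = gf (paths k d) (wt k int)"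
    unfolding T_gf_def gf_def bij_betw_same_card[OF bij] ..
  also have "\<dots> = (\<Prod>(i, j) \<in> pairs k d.
      (1 + of_int (eps (d i) (d j)) * fps_X ^ (j - i)) powi (eps (d i) (d j)))"
    unfolding gf(2) by (intro prod.cong refl) (auto simp: factor_def pairs_def nat_diff_distrib)
  finally show ?thesis
    using gf(1) bij_betw_finite[OF bij] by (simp add: good_def pairs_def)
qed

end
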